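(* Let $\mathbb{k} \in \{\mathbb{R}, \mathbb{C}\}$. Let $V, W$ be weakly topologized spaces (respectively Mackey spaces). Then $V \otimes^1_w W$ (respectively $V \otimes^1_m W$) equips the algebraic tensor product $V \otimes_{\mathbb{k}} W$ with the weakest (respectively strongest) Hausdorff locally convex topology such that the isomorphism between bilinear maps $V \times W \to \mathbb{k}$ and linear maps $V \otimes_{\mathbb{k}} W \to \mathbb{k}$, provided by the universal property of the algebraic tensor product, restricts to an isomorphism between separately continuous bilinear maps $V \times W \to \mathbb{k}$ and continuous linear maps $V \otimes^1_w W \to \mathbb{k}$ (respectively $V \otimes^1_m W \to \mathbb{k}$).
   Context: $\mathsf{TVS}$ is the category of Hausdorff locally convex topological $\mathbb{k}$-vector spaces and continuous linear maps; $V'$ is the space of continuous linear functionals on $V$. $\mathsf{chu}$ is the category of triples $(V,W,\langle-,-\rangle)$ with $V,W$ vector spaces and $\langle-,-\rangle: V\otimes_{\mathbb{k}} W\to\mathbb{k}$ linear such that both $V\to W^\star$ and $W\to V^\star$ are injective; a morphism $(V_1,W_1)\to(V_2,W_2)$ is a pair of linear maps $f: V_1\to V_2$, $g: W_2\to W_1$ with $\langle f(v),w\rangle_2=\langle v,g(w)\rangle_1$. The dual of a pair is $(V,W,\langle-,-\rangle)^\star=(W,V,\langle-,-\rangle)$ (arguments swapped). The internal hom is $\underline{\mathrm{Hom}}((V_1,W_1),(V_2,W_2)) = (\mathrm{Hom}_{\mathsf{chu}}((V_1,W_1),(V_2,W_2)),\, V_1\otimes_{\mathbb{k}} W_2)$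 with pairing $\langle(f,g),v\otimes w\rangle=\langle f(v),w\rangle_2$. For $(V,W)\in\mathsf{chu}$, a dual topology on $V$ is a Hausdorff locally convex topology for which $W\to V^\star$ induces an isomorphism of $W$ onto the topological dual; $\sigma(V,W)$ is the weakest and $\tau(V,W)$ the strongest dual topology. A space $V \in \mathsf{TVS}$ is weakly topologized (resp. Mackey) if its topology is $\sigma(V,V')$ (resp. $\tau(V,V')$); $\mathsf{TVS}_w$, $\mathsf{TVS}_m$ are the corresponding full subcategories. $T_w$ and $T_m$ send $V$ to $(V,V',\mathrm{eval})$; $R(V,W)=(V,\sigma(V,W))$ and $L(V,W)=(V,\tau(V,W))$ are their quasi-inverses. Set $\underline{\mathrm{Hom}}_w(V,W)=R(\underline{\mathrm{Hom}}(T_wV,T_wW))$, $D_w(V)=R((T_wV)^\star)$, $V\otimes^1_wW=D_w(\underline{\mathrm{Hom}}_w(V,D_w(W)))$, and analogously $\underline{\mathrm{Hom}}_m$, $D_m$, $\otimes^1_m$ with $L,T_m$ in place of $R,T_w$. The underlying vector space of $V\otimes^1_wW$ (resp. $V\otimes^1_mW$) is identified canonically with $V\otimes_{\mathbb{k}}W$. *)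

theory Defs
  imports "HOL-Analysis.Analysis" "HOL-Library.Function_Algebras"
begin

section \<open>The ground field\<close>

text \<open>Up to isometric isomorphism the instances are exactly \<^typ>\<open>real\<close> and \<^typ>\<open>complex\<close>.\<close>

class real_or_complex = real_normed_field +
  assumes ex_embedding:
    "\<exists>\<phi> :: 'a \<Rightarrow> complex. (\<forall>x y. \<phi> (x + y) = \<phi> x + \<phi> y) \<and> (\<forall>r x. \<phi> (r *\<^sub>R x) = r *\<^sub>R \<phi> x) \<and>
       \<phi> 1 = 1 \<and> (\<forall>x y. \<phi> (x * y) = \<phi> x * \<phi> y) \<and> (\<forall>x. norm (\<phi> x) = norm x) \<and>
       (range \<phi> = \<real> \<or> range \<phi> = UNIV)"

instance real :: real_or_complex
  by standard (rule exI[of _ complex_of_real], auto simp: Reals_def scaleR_conv_of_real)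

instance complex :: real_or_complex
  by standard (rule exI[of _ "\<lambda>x. x"], auto)


section \<open>Vector spaces and linear maps\<close>

text \<open>
  A vector space is a linear subspace \<open>carr V\<close> of an ambient vector space, given by a type of
  class \<^class>\<open>ab_group_add\<close> and a scalar multiplication \<open>scal V\<close>. Maps between vector
  spaces are represented by functions that vanish outside the carrier of their domain; so equality
  of maps is equality of functions, and vector spaces of maps are again linear subspaces
  of a function type with the pointwise operations.
\<close>

record ('k, 'v) kspace =
  scal :: "'k \<Rightarrow> 'v \<Rightarrow> 'v"
  carr :: "'v set"

definition is_kspace :: "('k::field, 'v::ab_group_add) kspace \<Rightarrow> bool" where
  "is_kspace V \<longleftrightarrow> vector_space (scal V) \<and> module.subspace (scal V) (carr V)"

definition ground :: "('k::field, 'k) kspace" where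
  "ground = \<lparr>scal = (*), carr = UNIV\<rparr>"

definition linear_betw ::
  "('k, 'v::ab_group_add) kspace \<Rightarrow> ('k, 'w::ab_group_add) kspace \<Rightarrow> ('v \<Rightarrow> 'w) \<Rightarrow> bool" where
  "linear_betw V W f \<longleftrightarrow> f ` carr V \<subseteq> carr W \<and>
     (\<forall>x\<in>carr V. \<forall>y\<in>carr V. f (x + y) = f x + f y) \<and>
     (\<forall>c. \<forall>x\<in>carr V. f (scal V c x) = scal W c (f x))"

definition lin_maps ::
  "('k, 'v::ab_group_add) kspace \<Rightarrow> ('k, 'w::ab_group_add) kspace \<Rightarrow> ('v \<Rightarrow> 'w) set" where
  "lin_maps V W = {f. linear_betw V W f \<and> (\<forall>x. x \<notin> carr V \<longrightarrow> f x = 0)}"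

definition bilinear_betw ::
  "('k, 'v::ab_group_add) kspace \<Rightarrow> ('k, 'w::ab_group_add) kspace \<Rightarrow>
   ('k, 'x::ab_group_add) kspace \<Rightarrow> ('v \<Rightarrow> 'w \<Rightarrow> 'x) \<Rightarrow> bool" where
  "bilinear_betw V W X B \<longleftrightarrow> (\<forall>v\<in>carr V. linear_betw W X (B v)) \<and>
     (\<forall>w\<in>carr W. linear_betw V X (\<lambda>v. B v w))"

definition bilin_maps ::
  "('k, 'v::ab_group_add) kspace \<Rightarrow> ('k, 'w::ab_group_add) kspace \<Rightarrow>
   ('k, 'x::ab_group_add) kspace \<Rightarrow> ('v \<Rightarrow> 'w \<Rightarrow> 'x) set" where
  "bilin_maps V W X = {B. bilinear_betw V W X B \<and>
     (\<forall>v w. v \<notin> carr V \<or> w \<notin> carr W \<longrightarrow> B v w = 0)}"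

definition functional_scal :: "'k \<Rightarrow> ('v \<Rightarrow> 'k) \<Rightarrow> 'v \<Rightarrow> 'k::times" where
  "functional_scal c f = (\<lambda>x. c * f x)"


section \<open>The algebraic tensor product\<close>

text \<open>
  The elementary tensor of \<open>v\<close> and \<open>w\<close> is evaluation of bilinear forms at \<open>(v, w)\<close>, and the
  tensor product is the span of the elementary tensors in the space of functionals on bilinear
  forms. The universal property below, for bilinear maps into an arbitrary vector space,
  shows that this is the algebraic tensor product; everything else refers to it only through
  \<open>pure_tensor\<close> and \<open>tensor_lift\<close>.
\<close>

definition pure_tensor ::
  "('k::field, 'v::ab_group_add) kspace \<Rightarrow> ('k, 'w::ab_group_add) kspace \<Rightarrow>
   'v \<Rightarrow> 'w \<Rightarrow> ('v \<Rightarrow> 'w \<Rightarrow> 'k) \<Rightarrow> 'k" where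
  "pure_tensor V W v w = (\<lambda>B. if B \<in> bilin_maps V W ground then B v w else 0)"

definition tensor ::
  "('k::field, 'v::ab_group_add) kspace \<Rightarrow> ('k, 'w::ab_group_add) kspace \<Rightarrow>
   ('k, ('v \<Rightarrow> 'w \<Rightarrow> 'k) \<Rightarrow> 'k) kspace" where
  "tensor V W = \<lparr>scal = functional_scal,
     carr = module.span functional_scal {pure_tensor V W v w | v w. v \<in> carr V \<and> w \<in> carr W}\<rparr>"

definition tensor_lift ::
  "('k::field, 'v::ab_group_add) kspace \<Rightarrow> ('k, 'w::ab_group_add) kspace \<Rightarrow>
   ('k, 'x::ab_group_add) kspace \<Rightarrow> ('v \<Rightarrow> 'w \<Rightarrow> 'x) \<Rightarrow> (('v \<Rightarrow> 'w \<Rightarrow> 'k) \<Rightarrow> 'k) \<Rightarrow> 'x" where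
  "tensor_lift V W X B = (THE \<phi>. \<phi> \<in> lin_maps (tensor V W) X \<and>
     (\<forall>v\<in>carr V. \<forall>w\<in>carr W. \<phi> (pure_tensor V W v w) = B v w))"

lemma vector_space_functional_scal: "vector_space (functional_scal :: 'k \<Rightarrow> ('v \<Rightarrow> 'k) \<Rightarrow> 'v \<Rightarrow> 'k::field)"
  by unfold_locales (auto simp: functional_scal_def fun_eq_iff algebra_simps)

lemma vector_space_ground: "vector_space ((*) :: 'k \<Rightarrow> 'k \<Rightarrow> 'k::field)"
  by unfold_locales (auto simp: algebra_simps)

lemma is_kspace_tensor: "is_kspace (tensor V W)"
proof -
  interpret F: vector_space "functional_scal :: 'a \<Rightarrow> (('b \<Rightarrow> 'c \<Rightarrow> 'a) \<Rightarrow> 'a) \<Rightarrow> ('b \<Rightarrow> 'c \<Rightarrow> 'a) \<Rightarrow> 'a"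
    by (rule vector_space_functional_scal)
  show ?thesis
    using F.vector_space_axioms by (simp add: is_kspace_def tensor_def)
qed

lemma bilinear_pure_tensor:
  "bilinear_betw V W (tensor V W) (pure_tensor V W)"
proof -
  interpret F: vector_space "functional_scal :: 'a \<Rightarrow> (('b \<Rightarrow> 'c \<Rightarrow> 'a) \<Rightarrow> 'a) \<Rightarrow> ('b \<Rightarrow> 'c \<Rightarrow> 'a) \<Rightarrow> 'a"
    by (rule vector_space_functional_scal)
  have carr: "pure_tensor V W v w \<in> carr (tensor V W)" if "v \<in> carr V" "w \<in> carr W" for v w
    using that by (auto simp: tensor_def intro!: F.span_base)
  have B: "B v (x + y) = B v x + B v y" "B v (scal W c x) = c * B v x"
    if "B \<in> bilin_maps V W ground" "v \<in> carr V" "x \<in> carr W" "y \<in> carr W" for B v x y c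
    using that by (simp_all add: bilin_maps_def bilinear_betw_def linear_betw_def ground_def)
  have B': "B (x + y) w = B x w + B y w" "B (scal V c x) w = c * B x w"
    if "B \<in> bilin_maps V W ground" "w \<in> carr W" "x \<in> carr V" "y \<in> carr V" for B w x y c
    using that by (simp_all add: bilin_maps_def bilinear_betw_def linear_betw_def ground_def)
  have sc: "scal (tensor V W) = functional_scal"
    by (simp add: tensor_def)
  show ?thesis
    unfolding bilinear_betw_def linear_betw_def sc image_subset_iff
  proof (intro conjI ballI allI)
    fix v w w' c assume *: "v \<in> carr V" "w \<in> carr W" "w' \<in> carr W"
    show "pure_tensor V W v (w + w') = pure_tensor V W v w + pure_tensor V W v w'"
      using B(1)[OF _ *] by (simp add: pure_tensor_def fun_eq_iff)
    show "pure_tensor V W v (scal W c w) = functional_scal c (pure_tensor V W v w)"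
      using B(2)[OF _ *] by (simp add: pure_tensor_def fun_eq_iff functional_scal_def)
  next
    fix w v v' c assume *: "w \<in> carr W" "v \<in> carr V" "v' \<in> carr V"
    show "pure_tensor V W (v + v') w = pure_tensor V W v w + pure_tensor V W v' w"
      using B'(1)[OF _ *] by (simp add: pure_tensor_def fun_eq_iff)
    show "pure_tensor V W (scal V c v) w = functional_scal c (pure_tensor V W v w)"
      using B'(2)[OF _ *] by (simp add: pure_tensor_def fun_eq_iff functional_scal_def)
  qed (simp_all add: carr)
qed

theorem tensor_universal:
  fixes X :: "('k::field, 'x::ab_group_add) kspace"
  assumes V: "is_kspace V" and W: "is_kspace W" and X: "is_kspace X"
    and B: "bilinear_betw V W X B"
  shows "\<exists>!\<phi>. \<phi> \<in> lin_maps (tensor V W) X \<and>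
           (\<forall>v\<in>carr V. \<forall>w\<in>carr W. \<phi> (pure_tensor V W v w) = B v w)"
proof -
  let ?sT = "functional_scal :: 'k \<Rightarrow> (('a \<Rightarrow> 'b \<Rightarrow> 'k) \<Rightarrow> 'k) \<Rightarrow> _"
  let ?P = "{pure_tensor V W v w | v w. v \<in> carr V \<and> w \<in> carr W}"
  interpret F: vector_space ?sT
    by (rule vector_space_functional_scal)
  interpret X: vector_space "scal X"
    using X by (simp add: is_kspace_def)
  interpret V: vector_space "scal V"
    using V by (simp add: is_kspace_def)
  interpret W: vector_space "scal W"
    using W by (simp add: is_kspace_def)
  interpret FX: vector_space_pair ?sT "scal X" ..
  interpret K: vector_space "(*) :: 'k \<Rightarrow> 'k \<Rightarrow> 'k"
    by (rule vector_space_ground)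
  interpret XK: vector_space_pair "scal X" "(*) :: 'k \<Rightarrow> 'k \<Rightarrow> 'k" ..
  interpret FK: vector_space_pair ?sT "(*) :: 'k \<Rightarrow> 'k \<Rightarrow> 'k" ..
  have T: "carr (tensor V W) = F.span ?P" "scal (tensor V W) = ?sT"
    by (simp_all add: tensor_def)
  have sub: "X.subspace (carr X)" "V.subspace (carr V)" "W.subspace (carr W)"
    using X V W by (simp_all add: is_kspace_def)
  have Bcarr: "B v w \<in> carr X" if "v \<in> carr V" "w \<in> carr W" for v w
    using B that by (auto simp: bilinear_betw_def linear_betw_def image_subset_iff)
  obtain b where b: "b \<subseteq> ?P" "F.independent b" "?P \<subseteq> F.span b"
    by (rule F.maximal_independent_subset)
  have "\<exists>p. fst p \<in> carr V \<and> snd p \<in> carr W \<and> t = pure_tensor V W (fst p) (snd p)"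
    if "t \<in> b" for t
  proof -
    obtain v w where "v \<in> carr V" "w \<in> carr W" "t = pure_tensor V W v w"
      using \<open>t \<in> b\<close> b(1) by blast
    then show ?thesis
      by (intro exI[of _ "(v, w)"]) simp
  qed
  then obtain p where p: "\<And>t. t \<in> b \<Longrightarrow>
      fst (p t) \<in> carr V \<and> snd (p t) \<in> carr W \<and> t = pure_tensor V W (fst (p t)) (snd (p t))"
    by metis
  obtain g where g: "Vector_Spaces.linear ?sT (scal X) g"
      "\<And>t. t \<in> b \<Longrightarrow> g t = B (fst (p t)) (snd (p t))"
    using FX.linear_independent_extend[OF b(2), of "\<lambda>t. B (fst (p t)) (snd (p t))"] by auto
  interpret g: Vector_Spaces.linear ?sT "scal X" g by (rule g(1))
  have gB: "g (pure_tensor V W v w) = B v w" if vw: "v \<in> carr V" "w \<in> carr W" for v w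
  proof (rule ccontr)
    assume ne: "g (pure_tensor V W v w) \<noteq> B v w"
    define d where "d = g (pure_tensor V W v w) - B v w"
    have "X.independent {d}"
      using ne by (simp add: d_def X.dependent_single)
    then obtain l where l: "Vector_Spaces.linear (scal X) (*) l" "l d = 1"
      using XK.linear_independent_extend[of "{d}" "\<lambda>_. 1"] by auto
    interpret l: Vector_Spaces.linear "scal X" "(*)" l by (rule l(1))
    define C where "C = (\<lambda>v w. if v \<in> carr V \<and> w \<in> carr W then l (B v w) else 0)"
    have C: "C \<in> bilin_maps V W ground"
      using B sub(2,3)
      by (auto simp: bilin_maps_def bilinear_betw_def linear_betw_def C_def ground_def
          l.add l.scale V.subspace_def W.subspace_def)
    have eq: "l (g t) = t C" if "t \<in> F.span b" for t
      using that
    proof (induction rule: F.span_induct)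
      case base
      have "?sT c x C = c * x C" for c x
        by (simp add: functional_scal_def)
      then show ?case
        by (auto simp: F.subspace_def g.zero g.add g.scale l.zero l.add l.scale)
    next
      case (step t)
      then have "t C = C (fst (p t)) (snd (p t))"
        using p[OF step] C by (metis pure_tensor_def)
      then show ?case
        using p[OF step] g(2)[OF step] by (simp add: C_def)
    qed
    have "l (g (pure_tensor V W v w)) = C v w"
      using eq[of "pure_tensor V W v w"] b(3) vw C by (auto simp: pure_tensor_def)
    then have "l d = 0"
      using vw by (simp add: d_def C_def l.diff)
    with l(2) show False by simp
  qed
  have g_span: "g t \<in> carr X" if "t \<in> F.span ?P" for t
    using that
  proof (induction rule: F.span_induct)
    case base
    then show ?case
      using sub(1)
      by (auto simp: F.subspace_def X.subspace_def g.zero g.add g.scale)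
  next
    case (step t)
    then show ?case
      using gB Bcarr by auto
  qed
  define \<phi> where "\<phi> = (\<lambda>t. if t \<in> F.span ?P then g t else 0)"
  have span: "pure_tensor V W v w \<in> F.span ?P" if "v \<in> carr V" "w \<in> carr W" for v w
    using that by (auto intro!: F.span_base)
  show ?thesis
  proof (rule ex1I[of _ \<phi>])
    show "\<phi> \<in> lin_maps (tensor V W) X \<and>
        (\<forall>v\<in>carr V. \<forall>w\<in>carr W. \<phi> (pure_tensor V W v w) = B v w)"
      using g_span gB span
      by (auto simp: lin_maps_def linear_betw_def T \<phi>_def g.add g.scale F.span_add F.span_scale)
  next
    fix \<psi> assume \<psi>: "\<psi> \<in> lin_maps (tensor V W) X \<and>
        (\<forall>v\<in>carr V. \<forall>w\<in>carr W. \<psi> (pure_tensor V W v w) = B v w)"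
    have add: "\<psi> (s + t) = \<psi> s + \<psi> t" if "s \<in> F.span ?P" "t \<in> F.span ?P" for s t
      using \<psi> that by (auto simp: lin_maps_def linear_betw_def T)
    have scale: "\<psi> (?sT c t) = scal X c (\<psi> t)" if "t \<in> F.span ?P" for c t
      using \<psi> that by (auto simp: lin_maps_def linear_betw_def T)
    have zero: "\<psi> 0 = 0"
      using add[of 0 0] by (simp add: F.span_zero)
    have "t \<in> F.span ?P \<and> \<psi> t = g t" if "t \<in> F.span ?P" for t
      using that
    proof (induction rule: F.span_induct)
      case base
      then show ?case
        by (auto simp: F.subspace_def F.span_zero F.span_add F.span_scale add scale zero
            g.zero g.add g.scale)
    next
      case (step t)
      then show ?case
        using \<psi> gB by (auto intro!: F.span_base)
    qed
    moreover have "\<psi> t = 0" if "t \<notin> F.span ?P" for t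
      using \<psi> that by (auto simp: lin_maps_def T)
    ultimately show "\<psi> = \<phi>"
      by (auto simp: \<phi>_def)
  qed
qed

corollary tensor_lift:
  assumes "is_kspace V" "is_kspace W" "is_kspace X" "bilinear_betw V W X B"
  shows "tensor_lift V W X B \<in> lin_maps (tensor V W) X"
    and "\<lbrakk>v \<in> carr V; w \<in> carr W\<rbrakk> \<Longrightarrow> tensor_lift V W X B (pure_tensor V W v w) = B v w"
  using theI'[OF tensor_universal[OF assms]] by (auto simp: tensor_lift_def)

corollary bij_betw_tensor_lift:
  assumes "is_kspace V" "is_kspace W" "is_kspace X"
  shows "bij_betw (tensor_lift V W X) (bilin_maps V W X) (lin_maps (tensor V W) X)"
proof (rule bij_betw_byWitness[where
      f' = "\<lambda>\<phi> v w. if v \<in> carr V \<and> w \<in> carr W then \<phi> (pure_tensor V W v w) else 0"])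
  show "\<forall>B\<in>bilin_maps V W X. (\<lambda>v w. if v \<in> carr V \<and> w \<in> carr W
      then tensor_lift V W X B (pure_tensor V W v w) else 0) = B"
    by (auto simp: bilin_maps_def fun_eq_iff tensor_lift(2)[OF assms])
  show "tensor_lift V W X ` bilin_maps V W X \<subseteq> lin_maps (tensor V W) X"
    using tensor_lift(1)[OF assms] by (auto simp: bilin_maps_def)
  have sub: "module.subspace (scal V) (carr V)" "module.subspace (scal W) (carr W)"
      "module (scal V)" "module (scal W)"
    using assms by (auto simp: is_kspace_def vector_space_def module_def)
  have *: "(\<lambda>v w. if v \<in> carr V \<and> w \<in> carr W then \<phi> (pure_tensor V W v w) else 0)
      \<in> bilin_maps V W X" if "\<phi> \<in> lin_maps (tensor V W) X" for \<phi>
  proof -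
    have \<phi>: "\<And>s. s \<in> carr (tensor V W) \<Longrightarrow> \<phi> s \<in> carr X"
        "\<And>s t. s \<in> carr (tensor V W) \<Longrightarrow> t \<in> carr (tensor V W) \<Longrightarrow> \<phi> (s + t) = \<phi> s + \<phi> t"
        "\<And>s c. s \<in> carr (tensor V W) \<Longrightarrow> \<phi> (scal (tensor V W) c s) = scal X c (\<phi> s)"
      using that by (auto simp: lin_maps_def linear_betw_def)
    have "bilinear_betw V W (tensor V W) (pure_tensor V W)"
      by (rule bilinear_pure_tensor)
    then show ?thesis
      using sub by (simp add: bilin_maps_def bilinear_betw_def linear_betw_def image_subset_iff
          module.subspace_def \<phi>)
  qed
  then show "(\<lambda>\<phi> v w. if v \<in> carr V \<and> w \<in> carr W then \<phi> (pure_tensor V W v w) else 0) `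
      lin_maps (tensor V W) X \<subseteq> bilin_maps V W X"
    by blast
  show "\<forall>\<phi>\<in>lin_maps (tensor V W) X. tensor_lift V W X (\<lambda>v w. if v \<in> carr V \<and> w \<in> carr W
      then \<phi> (pure_tensor V W v w) else 0) = \<phi>"
  proof
    fix \<phi> assume \<phi>: "\<phi> \<in> lin_maps (tensor V W) X"
    let ?B = "\<lambda>v w. if v \<in> carr V \<and> w \<in> carr W then \<phi> (pure_tensor V W v w) else 0"
    have B: "bilinear_betw V W X ?B"
      using *[OF \<phi>] by (simp add: bilin_maps_def)
    show "tensor_lift V W X ?B = \<phi>"
      unfolding tensor_lift_def
      by (rule the1_equality[OF tensor_universal[OF assms B]]) (simp add: \<phi>)
  qed
qed


section \<open>Locally convex spaces\<close>

definition convex_subset :: "('k::real_normed_field, 'v::ab_group_add) kspace \<Rightarrow> 'v set \<Rightarrow> bool" where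
  "convex_subset V C \<longleftrightarrow> C \<subseteq> carr V \<and>
     (\<forall>x\<in>C. \<forall>y\<in>C. \<forall>a\<ge>0. \<forall>b\<ge>0. a + b = 1 \<longrightarrow> scal V (of_real a) x + scal V (of_real b) y \<in> C)"

definition hausdorff_lc_topology ::
  "('k::real_normed_field, 'v::ab_group_add) kspace \<Rightarrow> 'v topology \<Rightarrow> bool" where
  "hausdorff_lc_topology V T \<longleftrightarrow> topspace T = carr V \<and> Hausdorff_space T \<and>
     continuous_map (prod_topology T T) T (\<lambda>(x, y). x + y) \<and>
     continuous_map (prod_topology euclidean T) T (\<lambda>(c, x). scal V c x) \<and>
     neighbourhood_base_at 0 (convex_subset V) T"

record ('k, 'v) tvs =
  underlying :: "('k, 'v) kspace"
  topo :: "'v topology"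

definition is_tvs :: "('k::real_normed_field, 'v::ab_group_add) tvs \<Rightarrow> bool" where
  "is_tvs V \<longleftrightarrow> is_kspace (underlying V) \<and> hausdorff_lc_topology (underlying V) (topo V)"

definition cont_forms ::
  "('k::real_normed_field, 'v::ab_group_add) kspace \<Rightarrow> 'v topology \<Rightarrow> ('v \<Rightarrow> 'k) set" where
  "cont_forms V T = {f \<in> lin_maps V ground. continuous_map T euclidean f}"

definition top_dual ::
  "('k::real_normed_field, 'v::ab_group_add) tvs \<Rightarrow> ('k, 'v \<Rightarrow> 'k) kspace" where
  "top_dual V = \<lparr>scal = functional_scal, carr = cont_forms (underlying V) (topo V)\<rparr>"

definition sep_cont_bilin_forms ::
  "('k::real_normed_field, 'v::ab_group_add) tvs \<Rightarrow> ('k, 'w::ab_group_add) tvs \<Rightarrow>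
   ('v \<Rightarrow> 'w \<Rightarrow> 'k) set" where
  "sep_cont_bilin_forms V W = {B \<in> bilin_maps (underlying V) (underlying W) ground.
     (\<forall>v\<in>carr (underlying V). continuous_map (topo W) euclidean (B v)) \<and>
     (\<forall>w\<in>carr (underlying W). continuous_map (topo V) euclidean (\<lambda>v. B v w))}"

definition coarser :: "'v topology \<Rightarrow> 'v topology \<Rightarrow> bool" where
  "coarser S T \<longleftrightarrow> topspace S = topspace T \<and> (\<forall>U. openin S U \<longrightarrow> openin T U)"

definition weakest_such :: "('v topology \<Rightarrow> bool) \<Rightarrow> 'v topology \<Rightarrow> bool" where
  "weakest_such P T \<longleftrightarrow> P T \<and> (\<forall>T'. P T' \<longrightarrow> coarser T T')"

definition strongest_such :: "('v topology \<Rightarrow> bool) \<Rightarrow> 'v topology \<Rightarrow> bool" where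
  "strongest_such P T \<longleftrightarrow> P T \<and> (\<forall>T'. P T' \<longrightarrow> coarser T' T)"


section \<open>Dual pairs\<close>

record ('k, 'v, 'w) chu =
  chu_left :: "('k, 'v) kspace"
  chu_right :: "('k, 'w) kspace"
  pairing :: "'v \<Rightarrow> 'w \<Rightarrow> 'k"

definition left_to_dual :: "('k::field, 'v, 'w) chu \<Rightarrow> 'v \<Rightarrow> 'w \<Rightarrow> 'k" where
  "left_to_dual P v = (\<lambda>w. if w \<in> carr (chu_right P) then pairing P v w else 0)"

definition right_to_dual :: "('k::field, 'v, 'w) chu \<Rightarrow> 'w \<Rightarrow> 'v \<Rightarrow> 'k" where
  "right_to_dual P w = (\<lambda>v. if v \<in> carr (chu_left P) then pairing P v w else 0)"

definition is_chu :: "('k::field, 'v::ab_group_add, 'w::ab_group_add) chu \<Rightarrow> bool" where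
  "is_chu P \<longleftrightarrow> is_kspace (chu_left P) \<and> is_kspace (chu_right P) \<and>
     bilinear_betw (chu_left P) (chu_right P) ground (pairing P) \<and>
     inj_on (left_to_dual P) (carr (chu_left P)) \<and>
     inj_on (right_to_dual P) (carr (chu_right P))"

definition chu_dual :: "('k, 'v, 'w) chu \<Rightarrow> ('k, 'w, 'v) chu" where
  "chu_dual P = \<lparr>chu_left = chu_right P, chu_right = chu_left P, pairing = (\<lambda>w v. pairing P v w)\<rparr>"

definition chu_morphisms ::
  "('k, 'v1::ab_group_add, 'w1::ab_group_add) chu \<Rightarrow> ('k, 'v2::ab_group_add, 'w2::ab_group_add) chu \<Rightarrow>
   (('v1 \<Rightarrow> 'v2) \<times> ('w2 \<Rightarrow> 'w1)) set" where
  "chu_morphisms P Q = {(f, g).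
     f \<in> lin_maps (chu_left P) (chu_left Q) \<and> g \<in> lin_maps (chu_right Q) (chu_right P) \<and>
     (\<forall>v\<in>carr (chu_left P). \<forall>w\<in>carr (chu_right Q). pairing Q (f v) w = pairing P v (g w))}"

definition chu_hom ::
  "('k::field, 'v1::ab_group_add, 'w1::ab_group_add) chu \<Rightarrow>
   ('k, 'v2::ab_group_add, 'w2::ab_group_add) chu \<Rightarrow>
   ('k, ('v1 \<Rightarrow> 'v2) \<times> ('w2 \<Rightarrow> 'w1), ('v1 \<Rightarrow> 'w2 \<Rightarrow> 'k) \<Rightarrow> 'k) chu" where
  "chu_hom P Q =
     \<lparr>chu_left =
        \<lparr>scal = (\<lambda>c (f, g). (\<lambda>v. scal (chu_left Q) c (f v), \<lambda>w. scal (chu_right P) c (g w))),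
         carr = chu_morphisms P Q\<rparr>,
      chu_right = tensor (chu_left P) (chu_right Q),
      pairing = (\<lambda>(f, g). tensor_lift (chu_left P) (chu_right Q) ground (\<lambda>v w. pairing Q (f v) w))\<rparr>"

text \<open>Every topology with \<open>dual_topology P T\<close> has underlying set \<open>carr (chu_left P)\<close>. The map
  \<open>right_to_dual P\<close> is linear on \<open>carr (chu_right P)\<close>, so bijectivity makes it an isomorphism.\<close>

definition dual_topology ::
  "('k::real_normed_field, 'v::ab_group_add, 'w::ab_group_add) chu \<Rightarrow> 'v topology \<Rightarrow> bool" where
  "dual_topology P T \<longleftrightarrow> is_chu P \<and> hausdorff_lc_topology (chu_left P) T \<and>
     bij_betw (right_to_dual P) (carr (chu_right P)) (cont_forms (chu_left P) T)"

definition sigma_topology ::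
  "('k::real_normed_field, 'v::ab_group_add, 'w::ab_group_add) chu \<Rightarrow> 'v topology" where
  "sigma_topology P = (THE T. weakest_such (dual_topology P) T)"

definition tau_topology ::
  "('k::real_normed_field, 'v::ab_group_add, 'w::ab_group_add) chu \<Rightarrow> 'v topology" where
  "tau_topology P = (THE T. strongest_such (dual_topology P) T)"

text \<open>The functors \<open>T\<^sub>w\<close> and \<open>T\<^sub>m\<close> are both given by \<open>to_chu\<close>; \<open>R\<close> and \<open>L\<close> are
  \<open>weak_tvs\<close> and \<open>mackey_tvs\<close>.\<close>

definition to_chu ::
  "('k::real_normed_field, 'v::ab_group_add) tvs \<Rightarrow> ('k, 'v, 'v \<Rightarrow> 'k) chu" where
  "to_chu V = \<lparr>chu_left = underlying V, chu_right = top_dual V, pairing = (\<lambda>v f. f v)\<rparr>"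

definition weak_tvs ::
  "('k::real_normed_field, 'v::ab_group_add, 'w::ab_group_add) chu \<Rightarrow> ('k, 'v) tvs" where
  "weak_tvs P = \<lparr>underlying = chu_left P, topo = sigma_topology P\<rparr>"

definition mackey_tvs ::
  "('k::real_normed_field, 'v::ab_group_add, 'w::ab_group_add) chu \<Rightarrow> ('k, 'v) tvs" where
  "mackey_tvs P = \<lparr>underlying = chu_left P, topo = tau_topology P\<rparr>"

definition weakly_topologized :: "('k::real_normed_field, 'v::ab_group_add) tvs \<Rightarrow> bool" where
  "weakly_topologized V \<longleftrightarrow> is_tvs V \<and> topo V = sigma_topology (to_chu V)"

definition mackey_space :: "('k::real_normed_field, 'v::ab_group_add) tvs \<Rightarrow> bool" where
  "mackey_space V \<longleftrightarrow> is_tvs V \<and> topo V = tau_topology (to_chu V)"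


section \<open>Internal homs, duals and tensor products of locally convex spaces\<close>

definition hom_w where "hom_w V W = weak_tvs (chu_hom (to_chu V) (to_chu W))"
definition dual_w where "dual_w V = weak_tvs (chu_dual (to_chu V))"
definition tensor_w where "tensor_w V W = dual_w (hom_w V (dual_w W))"

definition hom_m where "hom_m V W = mackey_tvs (chu_hom (to_chu V) (to_chu W))"
definition dual_m where "dual_m V = mackey_tvs (chu_dual (to_chu V))"
definition tensor_m where "tensor_m V W = dual_m (hom_m V (dual_m W))"

text \<open>
  The underlying space of \<open>tensor_w V W\<close> is the topological dual of \<open>hom_w V (dual_w W)\<close>. The
  canonical map from the algebraic tensor product sends the elementary tensor of \<open>v\<close> and \<open>w\<close> to
  the functional \<open>(f, g) \<mapsto> f v w\<close>, that is, to the pairing in the internal hom with the elementary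
  tensor of \<open>v\<close> and evaluation at \<open>w\<close>.
\<close>

definition hom_eval ::
  "('k::real_normed_field, ('v \<Rightarrow> 'w \<Rightarrow> 'k) \<times> 'g) tvs \<Rightarrow> 'v \<Rightarrow> 'w \<Rightarrow> ('v \<Rightarrow> 'w \<Rightarrow> 'k) \<times> 'g \<Rightarrow> 'k" where
  "hom_eval H v w = (\<lambda>p. if p \<in> carr (underlying H) then fst p v w else 0)"

definition canonical_w where
  "canonical_w V W = tensor_lift (underlying V) (underlying W) (underlying (tensor_w V W))
     (hom_eval (hom_w V (dual_w W)))"

definition canonical_m where
  "canonical_m V W = tensor_lift (underlying V) (underlying W) (underlying (tensor_m V W))
     (hom_eval (hom_m V (dual_m W)))"

abbreviation alg_tensor where
  "alg_tensor V W \<equiv> tensor (underlying V) (underlying W)"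

definition tensor_w_topology where
  "tensor_w_topology V W =
     pullback_topology (carr (alg_tensor V W)) (canonical_w V W) (topo (tensor_w V W))"

definition tensor_m_topology where
  "tensor_m_topology V W =
     pullback_topology (carr (alg_tensor V W)) (canonical_m V W) (topo (tensor_m V W))"

text \<open>\<open>tensor_lift\<close> into the ground field is the isomorphism between bilinear forms on
  \<open>V \<times> W\<close> and linear forms on the tensor product.\<close>

definition classifies_sep_cont ::
  "('k::real_normed_field, 'v::ab_group_add) tvs \<Rightarrow> ('k, 'w::ab_group_add) tvs \<Rightarrow>
   (('v \<Rightarrow> 'w \<Rightarrow> 'k) \<Rightarrow> 'k) topology \<Rightarrow> bool" where
  "classifies_sep_cont V W T \<longleftrightarrow> hausdorff_lc_topology (alg_tensor V W) T \<and>
     bij_betw (tensor_lift (underlying V) (underlying W) ground)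
       (sep_cont_bilin_forms V W) (cont_forms (alg_tensor V W) T)"

end

(*
Put Q = (V (x) W, B), where B is the space of separately continuous bilinear forms and b in B pairs
with t by evaluating t at b.  Q is a dual pair: if the forms phi x psi with continuous phi, psi
kill t, expand t in a basis of W.  A locally convex Hausdorff topology classifies B exactly if it
is a dual topology for Q.  A morphism (f, g) from (V, V') to (W', W) is determined by f, and the
f that occur are exactly the elements of B; so the canonical map is an isomorphism from Q to the
pair of the dual of Hom(V, DW) and Hom(V, DW) itself, and the weakest and strongest dual topologies
are transported along it.

Both of these topologies exist for every dual pair: sigma is given by the seminorms |<., w>| and
tau by all seminorms that are continuous for some dual topology.  That no further forms become
continuous follows from Hahn-Banach: a form bounded by p + q is a sum of a form bounded by 2p and
one bounded by 2q, which reduces everything to forms bounded by a single generating seminorm.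
*)

theory Submission
  imports Defs
begin

section \<open>The Hahn-Banach theorem\<close>

text \<open>Hahn-Banach is needed with lower bounds attached: a functional below \<open>p\<close>
  that lies above a given superlinear function. It is therefore proved for a cone \<open>A\<close>
  of constraints; support at a point and the splitting of a form are two choices of
  \<open>A\<close>. Splitting is order-theoretic, hence real, while forms take values in
  \<open>k\<close>: real parts are split and then complexified. Adding the bounds of real and
  imaginary part costs the factor 2, which is harmless because only bounds up to a constant matter.
  Carriers may be proper subsets of their type, so seminorms are composed with a linear projection
  before Hahn-Banach applies. The obstacle for tau is that a join of dual topologies might acquire
  new continuous forms. Being generated by sums of seminorms, the join admits only forms that split
  into pieces, each continuous for one dual topology. Locally convex topologies are given by convex
  neighbourhoods, so gauges are needed to show that seminorms generate them; without this tau could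
  not be compared with an arbitrary dual topology.\<close>

locale real_space = vector_space scale
  for scale :: "real \<Rightarrow> 'a::ab_group_add \<Rightarrow> 'a" (infixr \<open>\<odot>\<close> 75)
begin

text \<open>Only \<open>\<le>\<close> is asked for scaling: an infimum inherits it directly, and
  equality follows by scaling back with \<open>1/t\<close>.\<close>

definition sublinear :: "('a \<Rightarrow> real) \<Rightarrow> bool" where
  "sublinear p \<longleftrightarrow> (\<forall>x y. p (x + y) \<le> p x + p y) \<and> (\<forall>t>0. \<forall>x. p (t \<odot> x) \<le> t * p x)"

lemma sublinear_add: "sublinear p \<Longrightarrow> p (x + y) \<le> p x + p y"
  by (simp add: sublinear_def)

lemma sublinear_scale_le: "sublinear p \<Longrightarrow> t > 0 \<Longrightarrow> p (t \<odot> x) \<le> t * p x"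
  by (simp add: sublinear_def)

lemma sublinear_zero: assumes "sublinear p" shows "p 0 = 0"
  using sublinear_add[OF assms, of 0 0] sublinear_scale_le[OF assms, of "1/2" 0] by simp

lemma sublinear_scale:
  assumes p: "sublinear p" and "t > 0" shows "p (t \<odot> x) = t * p x"
proof (rule antisym)
  have "p ((1/t) \<odot> (t \<odot> x)) \<le> (1/t) * p (t \<odot> x)"
    using p \<open>t > 0\<close> by (intro sublinear_scale_le) auto
  then show "t * p x \<le> p (t \<odot> x)"
    using \<open>t > 0\<close> by (simp add: field_simps)
qed (use assms in \<open>rule sublinear_scale_le\<close>)

lemma sublinear_uminus: assumes "sublinear p" shows "- p (- x) \<le> p x"
  using sublinear_add[OF assms, of x "- x"] sublinear_zero[OF assms] by simp

text \<open>The pairs \<open>(a, t) \<in> A\<close> are constraints \<open>t \<le> f a\<close> on a linear functional \<open>f\<close> dominated by \<open>p\<close>.\<close>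

lemma sublinear_constrain:
  assumes p: "sublinear p" and "(0, 0) \<in> A"
    and add: "\<And>a s b t. (a, s) \<in> A \<Longrightarrow> (b, t) \<in> A \<Longrightarrow> (a + b, s + t) \<in> A"
    and scale: "\<And>c a s. c > 0 \<Longrightarrow> (a, s) \<in> A \<Longrightarrow> (c \<odot> a, c * s) \<in> A"
    and le: "\<And>a s. (a, s) \<in> A \<Longrightarrow> s \<le> p a"
  obtains r where "sublinear r" "\<And>x. r x \<le> p x" "\<And>a s. (a, s) \<in> A \<Longrightarrow> r (- a) \<le> - s"
proof -
  \<comment> \<open>If \<open>f \<le> p\<close> and \<open>s \<le> f a\<close>, then
    \<open>f x = f (x + a) - f a \<le> p (x + a) - s\<close>; so \<open>r\<close> is the upper bound
    on \<open>f\<close> that all constraints impose together.\<close>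
  define r where "r x = (INF z\<in>A. p (x + fst z) - snd z)" for x
  \<comment> \<open>Since \<open>s \<le> p a \<le> p (x + a) + p (- x)\<close>, the infimum is
    finite.\<close>
  have "- p (- x) \<le> p (x + a) - s" if "(a, s) \<in> A" for x a s
    using sublinear_add[OF p, of "x + a" "- x"] le[OF that] by simp
  then have bdd: "bdd_below ((\<lambda>z. p (x + fst z) - snd z) ` A)" for x
    by (intro bdd_belowI2[of _ "- p (- x)"]) auto
  have upper: "r x \<le> p (x + a) - s" if "(a, s) \<in> A" for x a s
    unfolding r_def using cINF_lower[OF bdd that] by simp
  have lower: "m \<le> r x" if "\<And>a s. (a, s) \<in> A \<Longrightarrow> m \<le> p (x + a) - s" for m x
    unfolding r_def using assms(2) that by (intro cINF_greatest) auto
  have "sublinear r"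
    unfolding sublinear_def
  proof (intro conjI allI impI)
    fix x y
    have "r (x + y) - r y \<le> r x"
    proof (rule lower)
      fix a s assume as: "(a, s) \<in> A"
      have "r (x + y) - (p (x + a) - s) \<le> r y"
      proof (rule lower)
        fix b t assume bt: "(b, t) \<in> A"
        have "r (x + y) \<le> p ((x + a) + (y + b)) - (s + t)"
          using upper[OF add[OF as bt], of "x + y"] by (simp add: algebra_simps)
        then show "r (x + y) - (p (x + a) - s) \<le> p (y + b) - t"
          using sublinear_add[OF p, of "x + a" "y + b"] by simp
      qed
      then show "r (x + y) - r y \<le> p (x + a) - s" by simp
    qed
    then show "r (x + y) \<le> r x + r y" by simp
  next
    fix t :: real and x assume "t > 0"
    have "r (t \<odot> x) / t \<le> r x"
    proof (rule lower)
      fix a s assume as: "(a, s) \<in> A"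
      have "r (t \<odot> x) \<le> t * p (x + a) - t * s"
        using upper[OF scale[OF \<open>t > 0\<close> as], of "t \<odot> x"]
          sublinear_scale[OF p \<open>t > 0\<close>, of "x + a"]
        by (simp add: scale_right_distrib)
      then show "r (t \<odot> x) / t \<le> p (x + a) - s"
        using \<open>t > 0\<close> by (simp add: field_simps)
    qed
    then show "r (t \<odot> x) \<le> t * r x"
      using \<open>t > 0\<close> by (simp add: field_simps)
  qed
  moreover have "r x \<le> p x" for x
    using upper[OF assms(2), of x] by simp
  moreover have "r (- a) \<le> - s" if "(a, s) \<in> A" for a s
    using upper[OF that, of "- a"] sublinear_zero[OF p] by simp
  ultimately show ?thesis using that by blast
qed

text \<open>The cone over the single constraint \<open>p z \<le> f z\<close>, which together with
  \<open>f \<le> p\<close> forces \<open>f z = p z\<close>. It is admissible because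
  \<open>p\<close> is homogeneous for nonnegative factors.\<close>

lemma ray_constraints:
  fixes p z
  defines "A \<equiv> {(t \<odot> z, t * p z) | t. t \<ge> 0}"
  assumes p: "sublinear p"
  shows "(0, 0) \<in> A" "(z, p z) \<in> A"
    and "\<And>a s b t. (a, s) \<in> A \<Longrightarrow> (b, t) \<in> A \<Longrightarrow> (a + b, s + t) \<in> A"
    and "\<And>c a s. c > 0 \<Longrightarrow> (a, s) \<in> A \<Longrightarrow> (c \<odot> a, c * s) \<in> A"
    and "\<And>a s. (a, s) \<in> A \<Longrightarrow> s \<le> p a"
proof -
  have A: "(a, s) \<in> A \<longleftrightarrow> (\<exists>t\<ge>0. a = t \<odot> z \<and> s = t * p z)" for a s
    by (auto simp: A_def)
  show "(0, 0) \<in> A" "(z, p z) \<in> A"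
    unfolding A by (auto intro: exI[of _ 0] exI[of _ 1])
  show "(a + b, s + t) \<in> A" if as: "(a, s) \<in> A" "(b, t) \<in> A" for a s b t
  proof -
    from as obtain u v where "u \<ge> 0" "v \<ge> 0" "a = u \<odot> z" "s = u * p z" "b = v \<odot> z" "t = v * p z"
      unfolding A by auto
    then show ?thesis
      unfolding A by (intro exI[of _ "u + v"]) (simp add: scale_left_distrib algebra_simps)
  qed
  show "(c \<odot> a, c * s) \<in> A" if as: "c > 0" "(a, s) \<in> A" for c a s
  proof -
    from as obtain u where "u \<ge> 0" "a = u \<odot> z" "s = u * p z" unfolding A by auto
    with \<open>c > 0\<close> show ?thesis
      unfolding A by (intro exI[of _ "c * u"]) simp
  qed
  show "s \<le> p a" if as: "(a, s) \<in> A" for a s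
  proof -
    from as obtain u where "u \<ge> 0" "a = u \<odot> z" "s = u * p z" unfolding A by auto
    then show ?thesis
      using sublinear_scale[OF p, of u z] sublinear_zero[OF p] by (cases "u = 0") auto
  qed
qed

text \<open>Constraining \<open>p\<close> by the ray through \<open>x\<close> yields a sublinear
  \<open>r\<close> below \<open>p\<close> with \<open>r (- x) \<le> - p x\<close>; minimality gives
  \<open>r = p\<close>, so \<open>p\<close> is odd. Oddness turns subadditivity into additivity and
  extends homogeneity to negative factors.\<close>

lemma minimal_sublinear_linear:
  assumes p: "sublinear p" and min: "\<And>q. sublinear q \<Longrightarrow> (\<And>x. q x \<le> p x) \<Longrightarrow> q = p"
  shows "p (x + y) = p x + p y" and "p (c \<odot> x) = c * p x"
proof -
  have neg: "p (- x) = - p x" for x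
  proof -
    obtain r where r: "sublinear r" "\<And>y. r y \<le> p y" "r (- x) \<le> - p x"
      by (rule sublinear_constrain[OF p ray_constraints(1,3,4,5)[OF p, where z = x]])
        (use ray_constraints(2)[OF p, where z = x] in blast)+
    have "p (- x) \<le> - p x"
      using r(3) min[OF r(1,2)] by simp
    then show ?thesis
      using sublinear_uminus[OF p, of x] by simp
  qed
  show "p (x + y) = p x + p y"
    using sublinear_add[OF p, of x y] sublinear_add[OF p, of "- x" "- y"] neg[of x] neg[of y]
      neg[of "x + y"] by simp
  show "p (c \<odot> x) = c * p x"
  proof (cases c "0::real" rule: linorder_cases)
    case less
    then show ?thesis
      using sublinear_scale[OF p, of "- c" x] neg[of "c \<odot> x"] by simp
  next
    case equal
    then show ?thesis by (simp add: sublinear_zero[OF p])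
  next
    case greater
    then show ?thesis by (rule sublinear_scale[OF p])
  qed
qed

text \<open>Zorn's lemma downwards: a chain is bounded below by its pointwise infimum, which is
  finite because \<open>q x \<ge> - q (- x) \<ge> - p (- x)\<close> for every sublinear
  \<open>q\<close> below \<open>p\<close>.\<close>

lemma ex_minimal_sublinear:
  assumes p: "sublinear p"
  obtains q where "sublinear q" "\<And>x. q x \<le> p x"
    "\<And>r. sublinear r \<Longrightarrow> (\<And>x. r x \<le> q x) \<Longrightarrow> r = q"
proof -
  let ?A = "{q. sublinear q \<and> q \<le> p}"
  have "\<exists>m\<in>?A. \<forall>q\<in>?A. q \<le> m \<longrightarrow> q = m"
  proof (rule predicate_Zorn)
    show "partial_order_on ?A (relation_of (\<lambda>x y. y \<le> x) ?A)"
      by (rule partial_order_on_relation_ofI) auto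
    fix C assume "C \<in> Chains (relation_of (\<lambda>x y. y \<le> x) ?A)"
    then have C: "C \<subseteq> ?A" and chain: "\<And>f g. f \<in> C \<Longrightarrow> g \<in> C \<Longrightarrow> f \<le> g \<or> g \<le> f"
      by (auto simp: Chains_def relation_of_def)
    show "\<exists>u\<in>?A. \<forall>q\<in>C. u \<le> q"
    proof (cases "C = {}")
      case True
      then show ?thesis using p by auto
    next
      case False
      define u where "u x = (INF q\<in>C. q x)" for x
      have "- p (- x) \<le> q x" if "q \<in> C" for q x
      proof -
        have "sublinear q" "q (- x) \<le> p (- x)"
          using that C by (auto simp: le_fun_def)
        then show ?thesis using sublinear_uminus[of q x] by simp
      qed
      then have bdd: "bdd_below ((\<lambda>q. q x) ` C)" for x
        by (intro bdd_belowI2[of _ "- p (- x)"]) auto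
      have upper: "u x \<le> q x" if "q \<in> C" for q x
        unfolding u_def by (rule cINF_lower[OF bdd that])
      have lower: "m \<le> u x" if "\<And>q. q \<in> C \<Longrightarrow> m \<le> q x" for m x
        unfolding u_def using False that by (intro cINF_greatest) auto
      have "sublinear u"
        unfolding sublinear_def
      proof (intro conjI allI impI)
        fix x y
        have "u (x + y) - u y \<le> u x"
        proof (rule lower)
          fix f assume f: "f \<in> C"
          have "u (x + y) - f x \<le> u y"
          proof (rule lower)
            fix g assume g: "g \<in> C"
            \<comment> \<open>\<open>f\<close> bounds the first term and \<open>g\<close> the
              second, but subadditivity needs one function for both: the smaller of the two.\<close>
            obtain h where h: "h \<in> C" "h \<le> f" "h \<le> g"
              using chain[OF f g] f g by auto
            then have "u (x + y) \<le> h x + h y"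
              using upper[of h "x + y"] sublinear_add[of h x y] C by force
            also have "\<dots> \<le> f x + g y"
              using h by (auto simp: le_fun_def intro: add_mono)
            finally show "u (x + y) - f x \<le> g y" by simp
          qed
          then show "u (x + y) - u y \<le> f x" by simp
        qed
        then show "u (x + y) \<le> u x + u y" by simp
      next
        fix t :: real and x assume "t > 0"
        have "u (t \<odot> x) / t \<le> u x"
        proof (rule lower)
          fix f assume f: "f \<in> C"
          then have "u (t \<odot> x) \<le> t * f x"
            using upper[OF f, of "t \<odot> x"] sublinear_scale_le[of f t x] C \<open>t > 0\<close> by force
          then show "u (t \<odot> x) / t \<le> f x"
            using \<open>t > 0\<close> by (simp add: field_simps)
        qed
        then show "u (t \<odot> x) \<le> t * u x"
          using \<open>t > 0\<close> by (simp add: field_simps)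
      qed
      moreover have "u \<le> p"
      proof -
        obtain q where "q \<in> C" using False by blast
        then have "q \<le> p" using C by auto
        then show ?thesis using upper[OF \<open>q \<in> C\<close>] by (auto simp: le_fun_def intro: order_trans)
      qed
      ultimately show ?thesis using upper by (auto simp: le_fun_def)
    qed
  qed
  then obtain m where "sublinear m" "m \<le> p" "\<And>q. sublinear q \<Longrightarrow> q \<le> p \<Longrightarrow> q \<le> m \<Longrightarrow> q = m"
    by auto
  then show ?thesis
    by (intro that[of m]) (auto simp: le_fun_def, meson order_trans)
qed

text \<open>The Mazur-Orlicz form of the theorem. The constraints are first absorbed into
  \<open>r\<close>: every linear functional below \<open>r\<close> satisfies
  \<open>- f a = f (- a) \<le> r (- a) \<le> - s\<close>, and a minimal sublinear function below
  \<open>r\<close> is linear.\<close>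

theorem hahn_banach:
  assumes p: "sublinear p" and "(0, 0) \<in> A"
    and "\<And>a s b t. (a, s) \<in> A \<Longrightarrow> (b, t) \<in> A \<Longrightarrow> (a + b, s + t) \<in> A"
    and "\<And>c a s. c > 0 \<Longrightarrow> (a, s) \<in> A \<Longrightarrow> (c \<odot> a, c * s) \<in> A"
    and "\<And>a s. (a, s) \<in> A \<Longrightarrow> s \<le> p a"
  obtains f where "\<And>x y. f (x + y) = f x + f y" "\<And>c x. f (c \<odot> x) = c * f x"
    "\<And>x. f x \<le> p x" "\<And>a s. (a, s) \<in> A \<Longrightarrow> s \<le> f a"
proof -
  obtain r where r: "sublinear r" "\<And>x. r x \<le> p x" "\<And>a s. (a, s) \<in> A \<Longrightarrow> r (- a) \<le> - s"
    using sublinear_constrain[OF assms] by blast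
  obtain f where f: "sublinear f" "\<And>x. f x \<le> r x"
    and min: "\<And>q. sublinear q \<Longrightarrow> (\<And>x. q x \<le> f x) \<Longrightarrow> q = f"
    using ex_minimal_sublinear[OF r(1)] by metis
  note lin = minimal_sublinear_linear[OF f(1) min]
  have "s \<le> f a" if "(a, s) \<in> A" for a s
    using r(3)[OF that] f(2)[of "- a"] lin(2)[of "- 1" a] by simp
  then show ?thesis
    using that[of f] lin f(2) r(2) by (meson order_trans)
qed

corollary sublinear_point_support:
  assumes p: "sublinear p"
  obtains f where "\<And>x y. f (x + y) = f x + f y" "\<And>c x. f (c \<odot> x) = c * f x"
    "\<And>x. f x \<le> p x" "f z = p z"
proof -
  obtain f where f: "\<And>x y. f (x + y) = f x + f y" "\<And>c x. f (c \<odot> x) = c * f x"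
    "\<And>x. f x \<le> p x" "p z \<le> f z"
    by (rule hahn_banach[OF p ray_constraints(1,3,4,5)[OF p, where z = z]])
      (use ray_constraints(2)[OF p, where z = z] in blast)+
  from f(4) f(3)[of z] have "f z = p z" by simp
  then show ?thesis using that f(1-3) by blast
qed

text \<open>A sandwich: \<open>u - q\<close> is superlinear and lies below \<open>p\<close>, so a
  linear \<open>f\<close> fits between them. The hypograph of \<open>u - q\<close> serves as the
  constraint cone.\<close>

corollary sublinear_decompose:
  assumes p: "sublinear p" and q: "sublinear q"
    and u: "\<And>x y. u (x + y) = u x + u y" "\<And>c x. u (c \<odot> x) = c * u x"
    and le: "\<And>x. u x \<le> p x + q x"
  obtains f where "\<And>x y. f (x + y) = f x + f y" "\<And>c x. f (c \<odot> x) = c * f x"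
    "\<And>x. f x \<le> p x" "\<And>x. u x - f x \<le> q x"
proof -
  let ?A = "{(x, s). s \<le> u x - q x}"
  obtain f where f: "\<And>x y. f (x + y) = f x + f y" "\<And>c x. f (c \<odot> x) = c * f x"
    "\<And>x. f x \<le> p x" "\<And>a s. (a, s) \<in> ?A \<Longrightarrow> s \<le> f a"
  proof (rule hahn_banach[OF p, of ?A])
    have "u 0 = 0" using u(1)[of 0 0] by simp
    then show "(0, 0) \<in> ?A" using sublinear_zero[OF q] by simp
    show "(a + b, s + t) \<in> ?A" if "(a, s) \<in> ?A" "(b, t) \<in> ?A" for a s b t
      using that u(1)[of a b] sublinear_add[OF q, of a b] by simp
    show "(c \<odot> a, c * s) \<in> ?A" if "c > 0" "(a, s) \<in> ?A" for c a s
    proof -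
      have "c * s \<le> c * (u a - q a)"
        using that by (intro mult_left_mono) auto
      then show ?thesis
        using u(2)[of c a] sublinear_scale[OF q, of c a] that by (simp add: algebra_simps)
    qed
    show "s \<le> p a" if "(a, s) \<in> ?A" for a s
      using that le[of a] by simp
  qed blast
  have "u x - f x \<le> q x" for x
    using f(4)[of x "u x - q x"] by simp
  then show ?thesis using that f(1-3) by blast
qed

end

section \<open>Real and imaginary parts\<close>

definition complex_embedding :: "'k::real_or_complex \<Rightarrow> complex" where
  "complex_embedding = (SOME \<phi>. (\<forall>x y. \<phi> (x + y) = \<phi> x + \<phi> y) \<and> (\<forall>r x. \<phi> (r *\<^sub>R x) = r *\<^sub>R \<phi> x) \<and>
       \<phi> 1 = 1 \<and> (\<forall>x y. \<phi> (x * y) = \<phi> x * \<phi> y) \<and> (\<forall>x. norm (\<phi> x) = norm x) \<and>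
       (range \<phi> = \<real> \<or> range \<phi> = UNIV))"

lemma complex_embedding:
  fixes x y :: "'k::real_or_complex"
  shows "complex_embedding (x + y) = complex_embedding x + complex_embedding y"
    and "complex_embedding (r *\<^sub>R x) = r *\<^sub>R complex_embedding x"
    and "complex_embedding (1::'k) = 1"
    and "complex_embedding (x * y) = complex_embedding x * complex_embedding y"
    and "norm (complex_embedding x) = norm x"
    and "range (complex_embedding :: 'k \<Rightarrow> complex) = \<real> \<or> range (complex_embedding :: 'k \<Rightarrow> complex) = UNIV"
  using someI_ex[OF ex_embedding[where 'a = 'k], folded complex_embedding_def] by blast+

lemma complex_embedding_diff:
  "complex_embedding (x - y) = complex_embedding x - complex_embedding (y::'k::real_or_complex)"
  using complex_embedding(1)[of "x - y" y] by simp

lemma complex_embedding_of_real: "complex_embedding (of_real r :: 'k::real_or_complex) = of_real r"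
  using complex_embedding(2)[of r "1::'k"] complex_embedding(3)[where 'k = 'k]
  by (simp add: of_real_def)

lemma complex_embedding_zero: "complex_embedding (0::'k::real_or_complex) = 0"
  using complex_embedding_of_real[of 0, where 'k = 'k] by simp

lemma inj_complex_embedding: "complex_embedding x = complex_embedding y \<Longrightarrow> x = (y::'k::real_or_complex)"
  using complex_embedding(5)[of "x - y"] by (simp add: complex_embedding_diff)

definition re_part :: "'k::real_or_complex \<Rightarrow> real" where
  "re_part x = Re (complex_embedding x)"

text \<open>A square root of \<open>-1\<close>, and \<open>0\<close> if the field is \<open>\<real>\<close>.\<close>

definition imag_unit :: "'k::real_or_complex" where
  "imag_unit = (if range (complex_embedding :: 'k \<Rightarrow> complex) = UNIV
     then inv complex_embedding \<i> else 0)"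

lemma complex_embedding_imag_unit:
  "imag_unit = (0::'k::real_or_complex) \<and> range (complex_embedding :: 'k \<Rightarrow> complex) = \<real> \<or>
   complex_embedding (imag_unit :: 'k) = \<i>"
proof (cases "range (complex_embedding :: 'k \<Rightarrow> complex) = UNIV")
  case True
  then show ?thesis by (simp add: imag_unit_def surj_f_inv_f)
qed (use complex_embedding(6)[where 'k = 'k] in \<open>auto simp: imag_unit_def\<close>)

lemma re_part_add: "re_part (x + y) = re_part x + re_part y"
  by (simp add: re_part_def complex_embedding)

lemma re_part_of_real_mult: "re_part (of_real r * x) = r * re_part x"
  by (simp add: re_part_def complex_embedding complex_embedding_of_real)

lemma re_part_le_norm: "re_part x \<le> norm x"
  using complex_Re_le_cmod[of "complex_embedding x"] by (simp add: re_part_def complex_embedding)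

text \<open>Values of \<open>complexify\<close> have this shape, so its real part is the real
  functional it started from.\<close>

lemma re_part_imag: "re_part (of_real r - imag_unit * of_real s :: 'k::real_or_complex) = r"
  using complex_embedding_imag_unit[where 'k = 'k] complex_embedding_zero[where 'k = 'k]
  by (auto simp: re_part_def complex_embedding complex_embedding_diff complex_embedding_of_real)

lemma imag_unit_cases: "imag_unit = (0::'k::real_or_complex) \<or> imag_unit * imag_unit = (- 1 :: 'k)"
proof -
  have "imag_unit * imag_unit = (- 1 :: 'k)" if "complex_embedding (imag_unit :: 'k) = \<i>"
    by (rule inj_complex_embedding)
      (use that complex_embedding_of_real[of "- 1", where 'k = 'k] in \<open>simp add: complex_embedding\<close>)
  then show ?thesis using complex_embedding_imag_unit by blast
qed

lemma norm_imag_unit: "norm (imag_unit :: 'k::real_or_complex) \<le> 1"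
  using complex_embedding_imag_unit[where 'k = 'k] complex_embedding(5)[of "imag_unit :: 'k"]
  by auto

text \<open>\<open>Im x = - Re (i x)\<close>, so real parts alone determine a scalar. Over the reals
  \<open>imag_unit\<close> is 0 and the second term vanishes, which lets one formula serve both
  fields.\<close>

lemma re_im_decomp:
  "x = of_real (re_part x) - imag_unit * of_real (re_part (imag_unit * x))" (is "_ = ?r")
proof (rule inj_complex_embedding, rule complex_eqI)
  have "Im (complex_embedding x) = 0" if "range (complex_embedding :: 'a \<Rightarrow> complex) = \<real>"
    using that by (metis complex_is_Real_iff rangeI)
  then show "Im (complex_embedding x) = Im (complex_embedding ?r)"
    using complex_embedding_imag_unit[where 'k = 'a] complex_embedding_zero[where 'k = 'a]
    by (auto simp: re_part_def complex_embedding complex_embedding_diff complex_embedding_of_real)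
  show "Re (complex_embedding x) = Re (complex_embedding ?r)"
    using complex_embedding_imag_unit[where 'k = 'a] complex_embedding_zero[where 'k = 'a]
    by (auto simp: re_part_def complex_embedding complex_embedding_diff complex_embedding_of_real)
qed


section \<open>Seminorms and linear forms\<close>

locale kvs =
  fixes V :: "('k::real_or_complex, 'v::ab_group_add) kspace"
  assumes is_kspace: "is_kspace V"
begin

sublocale vector_space "scal V"
  using is_kspace by (simp add: is_kspace_def)

lemma subspace_carr: "subspace (carr V)"
  using is_kspace by (simp add: is_kspace_def)

lemma carr_closed [simp, intro]:
  "0 \<in> carr V" "x \<in> carr V \<Longrightarrow> y \<in> carr V \<Longrightarrow> x + y \<in> carr V" "x \<in> carr V \<Longrightarrow> scal V c x \<in> carr V"
  "x \<in> carr V \<Longrightarrow> - x \<in> carr V" "x \<in> carr V \<Longrightarrow> y \<in> carr V \<Longrightarrow> x - y \<in> carr V"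
  using subspace_carr subspace_0 subspace_add subspace_scale subspace_neg subspace_diff by blast+

lemma lin_mapsI:
  assumes "\<And>x y. x \<in> carr V \<Longrightarrow> y \<in> carr V \<Longrightarrow> f (x + y) = f x + f y"
    "\<And>c x. x \<in> carr V \<Longrightarrow> f (scal V c x) = c * f x" "\<And>x. x \<notin> carr V \<Longrightarrow> f x = 0"
  shows "f \<in> lin_maps V ground"
  using assms by (simp add: lin_maps_def linear_betw_def ground_def)

lemma lin_mapsD:
  assumes "f \<in> lin_maps V ground"
  shows "x \<in> carr V \<Longrightarrow> y \<in> carr V \<Longrightarrow> f (x + y) = f x + f y"
    "x \<in> carr V \<Longrightarrow> f (scal V c x) = c * f x" "x \<notin> carr V \<Longrightarrow> f x = 0" "f 0 = 0"
    "x \<in> carr V \<Longrightarrow> y \<in> carr V \<Longrightarrow> f (x - y) = f x - f y"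
proof -
  show *: "x \<in> carr V \<Longrightarrow> y \<in> carr V \<Longrightarrow> f (x + y) = f x + f y"
    "x \<in> carr V \<Longrightarrow> f (scal V c x) = c * f x" "x \<notin> carr V \<Longrightarrow> f x = 0" for x y c
    using assms by (simp_all add: lin_maps_def linear_betw_def ground_def)
  show "f 0 = 0" using *(1)[of 0 0] by simp
  show "x \<in> carr V \<Longrightarrow> y \<in> carr V \<Longrightarrow> f (x - y) = f x - f y"
    using *(1)[of "x - y" y] by simp
qed

lemma lin_maps_closed:
  "0 \<in> lin_maps V ground"
  "f \<in> lin_maps V ground \<Longrightarrow> g \<in> lin_maps V ground \<Longrightarrow> f + g \<in> lin_maps V ground"
  "f \<in> lin_maps V ground \<Longrightarrow> g \<in> lin_maps V ground \<Longrightarrow> f - g \<in> lin_maps V ground"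
  "f \<in> lin_maps V ground \<Longrightarrow> functional_scal c f \<in> lin_maps V ground"
  by (auto intro!: lin_mapsI simp: lin_mapsD functional_scal_def algebra_simps)

definition seminorm_on :: "('v \<Rightarrow> real) \<Rightarrow> bool" where
  "seminorm_on p \<longleftrightarrow> (\<forall>x\<in>carr V. \<forall>y\<in>carr V. p (x + y) \<le> p x + p y) \<and>
     (\<forall>c. \<forall>x\<in>carr V. p (scal V c x) = norm c * p x)"

lemma seminorm_on:
  assumes "seminorm_on p"
  shows "x \<in> carr V \<Longrightarrow> y \<in> carr V \<Longrightarrow> p (x + y) \<le> p x + p y"
    "x \<in> carr V \<Longrightarrow> p (scal V c x) = norm c * p x"
    "p 0 = 0" "x \<in> carr V \<Longrightarrow> p (- x) = p x" "x \<in> carr V \<Longrightarrow> 0 \<le> p x"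
    "x \<in> carr V \<Longrightarrow> y \<in> carr V \<Longrightarrow> p (x - y) = p (y - x)"
    "x \<in> carr V \<Longrightarrow> y \<in> carr V \<Longrightarrow> z \<in> carr V \<Longrightarrow> p (x - z) \<le> p (x - y) + p (y - z)"
proof -
  show *: "x \<in> carr V \<Longrightarrow> y \<in> carr V \<Longrightarrow> p (x + y) \<le> p x + p y"
    "x \<in> carr V \<Longrightarrow> p (scal V c x) = norm c * p x" for x y c
    using assms by (simp_all add: seminorm_on_def)
  show zero: "p 0 = 0" using *(2)[of 0 0] by simp
  show neg: "x \<in> carr V \<Longrightarrow> p (- x) = p x" for x using *(2)[of x "- 1"] by simp
  show "x \<in> carr V \<Longrightarrow> 0 \<le> p x" using *(1)[of x "- x"] zero neg[of x] by simp
  show "x \<in> carr V \<Longrightarrow> y \<in> carr V \<Longrightarrow> p (x - y) = p (y - x)" using neg[of "x - y"] by simp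
  show "x \<in> carr V \<Longrightarrow> y \<in> carr V \<Longrightarrow> z \<in> carr V \<Longrightarrow> p (x - z) \<le> p (x - y) + p (y - z)"
    using *(1)[of "x - y" "y - z"] by simp
qed

lemma seminorm_on_zero: "seminorm_on (\<lambda>x. 0)"
  by (simp add: seminorm_on_def)

lemma seminorm_on_plus: "seminorm_on p \<Longrightarrow> seminorm_on q \<Longrightarrow> seminorm_on (\<lambda>x. p x + q x)"
  unfolding seminorm_on_def by (auto simp: algebra_simps) (smt (verit))

lemma seminorm_on_mult: "seminorm_on p \<Longrightarrow> C \<ge> 0 \<Longrightarrow> seminorm_on (\<lambda>x. C * p x)"
  unfolding seminorm_on_def distrib_left[symmetric]
  by (auto intro: mult_left_mono)

lemma seminorm_on_norm: "f \<in> lin_maps V ground \<Longrightarrow> seminorm_on (\<lambda>x. norm (f x))"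
  by (auto simp: seminorm_on_def lin_mapsD norm_mult norm_triangle_ineq)

abbreviation real_scal :: "real \<Rightarrow> 'v \<Rightarrow> 'v" where
  "real_scal r \<equiv> scal V (of_real r)"

sublocale R: real_space real_scal
  by unfold_locales (simp_all add: scale_right_distrib scale_left_distrib)

text \<open>A linear projection onto the carrier: functionals on the carrier extend to the ambient type by
  composition with it.\<close>

definition proj :: "'v \<Rightarrow> 'v" where
  "proj = (SOME f. Vector_Spaces.linear (scal V) (scal V) f \<and> range f \<subseteq> carr V \<and> (\<forall>x\<in>carr V. f x = x))"

lemma proj:
  "Vector_Spaces.linear (scal V) (scal V) proj" "proj x \<in> carr V" "x \<in> carr V \<Longrightarrow> proj x = x"
proof -
  interpret P: vector_space_pair "scal V" "scal V" ..
  have "\<exists>g. g ` UNIV \<subseteq> carr V \<and> Vector_Spaces.linear (scal V) (scal V) g \<and> (\<forall>v\<in>carr V. g (id v) = v)"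
    by (rule P.linear_exists_left_inverse_on) (rule linear_id, rule subspace_carr, simp)
  then have "\<exists>f. Vector_Spaces.linear (scal V) (scal V) f \<and> range f \<subseteq> carr V \<and> (\<forall>x\<in>carr V. f x = x)"
    by auto
  from someI_ex[OF this, folded proj_def]
  show "Vector_Spaces.linear (scal V) (scal V) proj" "proj x \<in> carr V" "x \<in> carr V \<Longrightarrow> proj x = x"
    by auto
qed

lemma proj_simps: "proj (x + y) = proj x + proj y" "proj (scal V c x) = scal V c (proj x)"
proof -
  interpret P: Vector_Spaces.linear "scal V" "scal V" proj by (rule proj)
  show "proj (x + y) = proj x + proj y" "proj (scal V c x) = scal V c (proj x)"
    by (simp_all add: P.add P.scale)
qed

text \<open>\<open>p\<close> is controlled on the carrier only; composing with \<open>proj\<close>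
  extends it to the whole type, where Hahn-Banach applies.\<close>

lemma sublinear_seminorm: "seminorm_on p \<Longrightarrow> R.sublinear (\<lambda>x. p (proj x))"
  by (auto simp: R.sublinear_def proj_simps proj seminorm_on)

text \<open>For real-linear \<open>u\<close>, the classical formula \<open>u x - i * u (i x)\<close>
  for the form over \<open>k\<close> with real part \<open>u\<close>. It is cut off outside the
  carrier as \<open>lin_maps\<close> demands; over the reals the second term disappears.\<close>

definition complexify :: "('v \<Rightarrow> real) \<Rightarrow> 'v \<Rightarrow> 'k" where
  "complexify u x = (if x \<in> carr V then of_real (u x) - imag_unit * of_real (u (scal V imag_unit x)) else 0)"

lemma complexify_lin:
  assumes u: "\<And>x y. u (x + y) = u x + u y" "\<And>r x. u (real_scal r x) = r * u x"
  shows "complexify u \<in> lin_maps V ground"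
proof (rule lin_mapsI)
  let ?g = "complexify u"
  have u0: "u 0 = 0" and um: "u (- x) = - u x" for x
    using u(2)[of 0 0] u(2)[of "- 1" x] by simp_all
  show add: "?g (x + y) = ?g x + ?g y" if "x \<in> carr V" "y \<in> carr V" for x y
    using that by (simp add: complexify_def u scale_right_distrib algebra_simps)
  show "?g x = 0" if "x \<notin> carr V" for x
    using that by (simp add: complexify_def)
  have re: "?g (real_scal r x) = of_real r * ?g x" if "x \<in> carr V" for x r
  proof -
    have "u (scal V imag_unit (real_scal r x)) = r * u (scal V imag_unit x)"
      using u(2)[of r "scal V imag_unit x"] by (simp add: mult.commute)
    then show ?thesis
      using that u(2)[of r x] by (simp add: complexify_def right_diff_distrib del: scale_scale)
  qed
  have im: "?g (scal V imag_unit x) = imag_unit * ?g x" if "x \<in> carr V" for x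
    using imag_unit_cases[where 'k = 'k]
  proof
    assume i: "imag_unit * imag_unit = (- 1 :: 'k)"
    have "imag_unit * ?g x = imag_unit * of_real (u x) - (imag_unit * imag_unit) * of_real (u (scal V imag_unit x))"
      using that by (simp add: complexify_def right_diff_distrib mult.assoc)
    then show ?thesis
      using that i by (simp add: complexify_def um)
  qed (use that u0 in \<open>simp add: complexify_def\<close>)
  show "?g (scal V c x) = c * ?g x" if x: "x \<in> carr V" for c x
  proof -
    \<comment> \<open>\<open>c = a + i b\<close>, so linearity over \<open>k\<close> reduces to real
      factors (\<open>re\<close>) and the single factor \<open>imag_unit\<close>
      (\<open>im\<close>).\<close>
    define a b where "a = re_part c" "b = - re_part (imag_unit * c)"
    have c: "c = of_real a + imag_unit * of_real b"
      using re_im_decomp[of c] by (simp add: a_b_def)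
    have "scal V c x = real_scal a x + scal V imag_unit (real_scal b x)"
      by (simp add: c scale_left_distrib)
    then have "?g (scal V c x) = of_real a * ?g x + imag_unit * (of_real b * ?g x)"
      using x by (simp add: add re im del: scale_scale)
    then show ?thesis
      by (simp add: c distrib_right mult.assoc)
  qed
qed

text \<open>Both summands of \<open>complexify\<close> are at most \<open>p x\<close> in norm, the
  second because \<open>norm imag_unit \<le> 1\<close>; the triangle inequality gives the 2.\<close>

lemma norm_complexify_le:
  assumes u: "\<And>r x. u (real_scal r x) = r * u x"
    and p: "seminorm_on p" and le: "\<And>x. x \<in> carr V \<Longrightarrow> u x \<le> p x" and x: "x \<in> carr V"
  shows "norm (complexify u x) \<le> 2 * p x"
proof -
  have abs: "\<bar>u x\<bar> \<le> p x" if "x \<in> carr V" for x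
    using le[OF that] le[of "- x"] u[of "- 1" x] seminorm_on(4)[OF p that] that by simp
  have "\<bar>u (scal V imag_unit x)\<bar> \<le> norm (imag_unit :: 'k) * p x"
    using abs[of "scal V imag_unit x"] x by (simp add: seminorm_on(2)[OF p])
  also have "\<dots> \<le> p x"
    using norm_imag_unit seminorm_on(5)[OF p x] by (intro mult_left_le_one_le) auto
  finally have 1: "norm (imag_unit :: 'k) * \<bar>u (scal V imag_unit x)\<bar> \<le> p x"
    using mult_left_le_one_le[of "\<bar>u (scal V imag_unit x)\<bar>" "norm (imag_unit :: 'k)"]
      norm_imag_unit[where 'k = 'k] by simp
  have "norm (complexify u x) \<le> \<bar>u x\<bar> + norm (imag_unit :: 'k) * \<bar>u (scal V imag_unit x)\<bar>"
    using x norm_triangle_ineq4[of "of_real (u x) :: 'k" "imag_unit * of_real (u (scal V imag_unit x))"]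
    by (simp add: complexify_def norm_mult)
  with 1 abs[OF x] show ?thesis by simp
qed

text \<open>A form is determined by its real part. Hence splitting the real part and complexifying
  the pieces splits the form.\<close>

lemma complexify_re:
  assumes f: "f \<in> lin_maps V ground" shows "complexify (\<lambda>x. re_part (f (proj x))) = f"
proof
  fix x show "complexify (\<lambda>x. re_part (f (proj x))) x = f x"
    using re_im_decomp[of "f x"] lin_mapsD[OF f] proj(3) by (simp add: complexify_def)
qed

text \<open>The form is the complexification of a real functional supporting \<open>p\<close> at
  \<open>z\<close>; its value there has real part \<open>p z\<close>, hence is not 0.\<close>

lemma seminorm_support:
  assumes p: "seminorm_on p" and z: "z \<in> carr V" "p z \<noteq> 0"
  obtains g where "g \<in> lin_maps V ground" "g z \<noteq> 0" "\<And>x. x \<in> carr V \<Longrightarrow> norm (g x) \<le> 2 * p x"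
proof -
  obtain u where u: "\<And>x y. u (x + y) = u x + u y" "\<And>r x. u (real_scal r x) = r * u x"
    "\<And>x. u x \<le> p (proj x)" "u z = p (proj z)"
    using R.sublinear_point_support[OF sublinear_seminorm[OF p], of z] by blast
  show ?thesis
  proof
    show "complexify u \<in> lin_maps V ground"
      by (intro complexify_lin u)
    have "re_part (complexify u z) = u z"
      using z by (simp add: complexify_def re_part_imag)
    moreover have "re_part (0 :: 'k) = 0"
      using re_part_of_real_mult[of 0 "0 :: 'k"] by simp
    ultimately show "complexify u z \<noteq> 0"
      using z u(4) by (auto simp: proj)
    show "norm (complexify u x) \<le> 2 * p x" if "x \<in> carr V" for x
      using u(3) proj by (intro norm_complexify_le p that u(2)) metis
  qed
qed

text \<open>The real part of \<open>f\<close> is split by \<open>sublinear_decompose\<close> and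
  both pieces are complexified. This is what controls sums of seminorms: they admit no forms beyond
  sums of those that the summands admit.\<close>

lemma lin_form_decompose:
  assumes p: "seminorm_on p" and q: "seminorm_on q" and f: "f \<in> lin_maps V ground"
    and le: "\<And>x. x \<in> carr V \<Longrightarrow> norm (f x) \<le> p x + q x"
  obtains g h where "g \<in> lin_maps V ground" "h \<in> lin_maps V ground" "f = g + h"
    "\<And>x. x \<in> carr V \<Longrightarrow> norm (g x) \<le> 2 * p x" "\<And>x. x \<in> carr V \<Longrightarrow> norm (h x) \<le> 2 * q x"
proof -
  define u where "u x = re_part (f (proj x))" for x
  have u: "u (x + y) = u x + u y" "u (real_scal r x) = r * u x" for x y r
    by (simp_all add: u_def proj_simps proj lin_mapsD[OF f] re_part_add re_part_of_real_mult)
  have "u x \<le> p (proj x) + q (proj x)" for x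
    using re_part_le_norm[of "f (proj x)"] le[of "proj x"] by (simp add: u_def proj)
  then obtain v where v: "\<And>x y. v (x + y) = v x + v y" "\<And>r x. v (real_scal r x) = r * v x"
    "\<And>x. v x \<le> p (proj x)" "\<And>x. u x - v x \<le> q (proj x)"
    using R.sublinear_decompose[OF sublinear_seminorm[OF p] sublinear_seminorm[OF q], of u] u
    by blast
  show ?thesis
  proof
    show "complexify v \<in> lin_maps V ground" "complexify (\<lambda>x. u x - v x) \<in> lin_maps V ground"
      by (intro complexify_lin; simp add: u v algebra_simps)+
    have "f = complexify u"
      using complexify_re[OF f] by (simp add: u_def[abs_def])
    then show "f = complexify v + complexify (\<lambda>x. u x - v x)"
      by (simp add: fun_eq_iff complexify_def algebra_simps)
    show "norm (complexify v x) \<le> 2 * p x" if "x \<in> carr V" for x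
      using v(3) proj by (intro norm_complexify_le p that v(2)) metis
    show "norm (complexify (\<lambda>x. u x - v x) x) \<le> 2 * q x" if "x \<in> carr V" for x
    proof (rule norm_complexify_le[OF _ q _ that])
      show "u (real_scal r x) - v (real_scal r x) = r * (u x - v x)" for r x
        by (simp add: u v algebra_simps)
      show "u x - v x \<le> q x" if "x \<in> carr V" for x
        using v(4)[of x] proj(3)[OF that] by simp
    qed
  qed
qed

end

section \<open>Topologies defined by seminorms\<close>

context kvs
begin

text \<open>Closure under sums makes the family directed, so that balls of single seminorms form a
  base; the zero seminorm keeps it nonempty. Multiples are covered by the radius of the
  balls.\<close>

definition seminorm_family :: "('v \<Rightarrow> real) set \<Rightarrow> bool" where
  "seminorm_family G \<longleftrightarrow> (\<forall>p\<in>G. seminorm_on p) \<and> (\<lambda>x. 0) \<in> G \<and>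
     (\<forall>p\<in>G. \<forall>q\<in>G. (\<lambda>x. p x + q x) \<in> G)"

definition sball :: "('v \<Rightarrow> real) \<Rightarrow> 'v \<Rightarrow> real \<Rightarrow> 'v set" where
  "sball p x e = {y \<in> carr V. p (y - x) < e}"

definition seminorm_topology :: "('v \<Rightarrow> real) set \<Rightarrow> 'v topology" where
  "seminorm_topology G =
     topology (\<lambda>U. U \<subseteq> carr V \<and> (\<forall>x\<in>U. \<exists>p\<in>G. \<exists>e>0. sball p x e \<subseteq> U))"

lemma openin_seminorm_topology:
  assumes G: "seminorm_family G"
  shows "openin (seminorm_topology G) U \<longleftrightarrow>
    U \<subseteq> carr V \<and> (\<forall>x\<in>U. \<exists>p\<in>G. \<exists>e>0. sball p x e \<subseteq> U)"
proof -
  let ?L = "\<lambda>U. U \<subseteq> carr V \<and> (\<forall>x\<in>U. \<exists>p\<in>G. \<exists>e>0. sball p x e \<subseteq> U)"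
  have "istopology ?L"
    unfolding istopology_def
  proof (intro conjI allI impI)
    fix S T assume S: "?L S" and T: "?L T"
    have "\<exists>p\<in>G. \<exists>e>0. sball p x e \<subseteq> S \<inter> T" if x: "x \<in> S" "x \<in> T" for x
    proof -
      obtain p d where p: "p \<in> G" "d > 0" "sball p x d \<subseteq> S" using S x by blast
      obtain q e where q: "q \<in> G" "e > 0" "sball q x e \<subseteq> T" using T x by blast
      have xc: "x \<in> carr V" using S x by blast
      have "0 \<le> p (y - x) \<and> 0 \<le> q (y - x)" if "y \<in> carr V" for y
        using G p q that xc seminorm_on(5) by (auto simp: seminorm_family_def)
      then have "sball (\<lambda>x. p x + q x) x (min d e) \<subseteq> sball p x d \<inter> sball q x e"
        by (force simp: sball_def)
      moreover have "(\<lambda>x. p x + q x) \<in> G" using G p q by (simp add: seminorm_family_def)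
      ultimately show ?thesis
        using p q by (intro bexI[of _ "\<lambda>x. p x + q x"] exI[of _ "min d e"]) auto
    qed
    then show "S \<inter> T \<subseteq> carr V" "\<forall>x\<in>S \<inter> T. \<exists>p\<in>G. \<exists>e>0. sball p x e \<subseteq> S \<inter> T"
      using S by auto
  next
    fix K assume K: "\<forall>S\<in>K. ?L S"
    then show "\<Union>K \<subseteq> carr V" by blast
    show "\<forall>x\<in>\<Union>K. \<exists>p\<in>G. \<exists>e>0. sball p x e \<subseteq> \<Union>K"
    proof
      fix x assume "x \<in> \<Union>K"
      then obtain S where "S \<in> K" "x \<in> S" by blast
      with K obtain p e where "p \<in> G" "e > 0" "sball p x e \<subseteq> S" by blast
      with \<open>S \<in> K\<close> show "\<exists>p\<in>G. \<exists>e>0. sball p x e \<subseteq> \<Union>K" by blast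
    qed
  qed
  then show ?thesis
    unfolding seminorm_topology_def by (simp add: topology_inverse')
qed

lemma centre_in_sball: "seminorm_on p \<Longrightarrow> x \<in> carr V \<Longrightarrow> e > 0 \<Longrightarrow> x \<in> sball p x e"
  by (simp add: sball_def seminorm_on)

lemma openin_sball:
  assumes G: "seminorm_family G" and p: "p \<in> G" and x: "x \<in> carr V"
  shows "openin (seminorm_topology G) (sball p x e)"
  unfolding openin_seminorm_topology[OF G]
proof (intro conjI ballI)
  fix y assume y: "y \<in> sball p x e"
  have "sball p y (e - p (y - x)) \<subseteq> sball p x e"
  proof
    fix z assume z: "z \<in> sball p y (e - p (y - x))"
    then show "z \<in> sball p x e"
      using seminorm_on(7)[of p z y x] G p x y by (auto simp: sball_def seminorm_family_def)
  qed
  then show "\<exists>q\<in>G. \<exists>d>0. sball q y d \<subseteq> sball p x e"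
    using y p by (intro bexI[of _ p] exI[of _ "e - p (y - x)"]) (auto simp: sball_def)
qed (auto simp: sball_def)

lemma topspace_seminorm_topology:
  assumes G: "seminorm_family G" shows "topspace (seminorm_topology G) = carr V"
proof -
  have "\<exists>p\<in>G. \<exists>e>0. sball p x e \<subseteq> carr V" for x
    using G by (intro bexI[of _ "\<lambda>x. 0"] exI[of _ 1]) (auto simp: sball_def seminorm_family_def)
  then have "openin (seminorm_topology G) (carr V)"
    by (simp add: openin_seminorm_topology[OF G])
  then show ?thesis
    using openin_seminorm_topology[OF G] by (metis openin_subset openin_topspace subset_antisym)
qed

lemma continuous_map_seminorm_topology:
  assumes G: "seminorm_family G" and f: "\<And>x. x \<in> topspace X \<Longrightarrow> f x \<in> carr V"
    and cont: "\<And>x p e. x \<in> topspace X \<Longrightarrow> p \<in> G \<Longrightarrow> e > 0 \<Longrightarrow>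
      \<exists>U. openin X U \<and> x \<in> U \<and> (\<forall>y\<in>U. p (f y - f x) < e)"
  shows "continuous_map X (seminorm_topology G) f"
  unfolding continuous_map
proof (intro conjI allI impI)
  show "f ` topspace X \<subseteq> topspace (seminorm_topology G)"
    using f topspace_seminorm_topology[OF G] by auto
  fix O' assume O': "openin (seminorm_topology G) O'"
  show "openin X {x \<in> topspace X. f x \<in> O'}"
  proof (subst openin_subopen, intro ballI)
    fix x assume x: "x \<in> {x \<in> topspace X. f x \<in> O'}"
    then obtain p e where p: "p \<in> G" "e > 0" "sball p (f x) e \<subseteq> O'"
      using O' by (auto simp: openin_seminorm_topology[OF G])
    then obtain U where U: "openin X U" "x \<in> U" "\<And>y. y \<in> U \<Longrightarrow> p (f y - f x) < e"
      using cont[of x p e] x by blast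
    have "U \<subseteq> {x \<in> topspace X. f x \<in> O'}"
    proof
      fix y assume "y \<in> U"
      then have "y \<in> topspace X" using openin_subset[OF U(1)] by blast
      then show "y \<in> {x \<in> topspace X. f x \<in> O'}"
        using U(3)[OF \<open>y \<in> U\<close>] p(3) f by (auto simp: sball_def)
    qed
    then show "\<exists>T. openin X T \<and> x \<in> T \<and> T \<subseteq> {x \<in> topspace X. f x \<in> O'}"
      using U by blast
  qed
qed

lemma convex_sball:
  assumes p: "seminorm_on p" shows "convex_subset V (sball p 0 e)"
  unfolding convex_subset_def
proof (intro conjI ballI allI impI)
  fix x y and a b :: real
  assume x: "x \<in> sball p 0 e" and y: "y \<in> sball p 0 e" and ab: "0 \<le> a" "0 \<le> b" "a + b = 1"
  have "p (real_scal a x + real_scal b y) \<le> a * p x + b * p y"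
    using seminorm_on(1)[OF p, of "real_scal a x" "real_scal b y"] x y ab
    by (simp add: seminorm_on(2)[OF p] sball_def)
  also have "\<dots> < e"
    using x y ab convex_bound_lt[of "p x" e "p y" a b] by (simp add: sball_def)
  finally show "real_scal a x + real_scal b y \<in> sball p 0 e"
    using x y by (simp add: sball_def)
qed (auto simp: sball_def)

lemma hausdorff_lc_seminorm_topology:
  assumes G: "seminorm_family G"
    and sep: "\<And>x. x \<in> carr V \<Longrightarrow> x \<noteq> 0 \<Longrightarrow> \<exists>p\<in>G. p x \<noteq> 0"
  shows "hausdorff_lc_topology V (seminorm_topology G)"
proof -
  let ?T = "seminorm_topology G"
  note top = topspace_seminorm_topology[OF G]
  have sn: "seminorm_on p" if "p \<in> G" for p
    using that G by (simp add: seminorm_family_def)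
  show ?thesis
    unfolding hausdorff_lc_topology_def
  proof (intro conjI)
    show "topspace ?T = carr V" by (rule top)
    show "Hausdorff_space ?T"
      unfolding Hausdorff_space_def top
    proof (intro allI impI)
      fix x y assume xy: "x \<in> carr V \<and> y \<in> carr V \<and> x \<noteq> y"
      then obtain p where p: "p \<in> G" "p (x - y) \<noteq> 0" using sep[of "x - y"] by auto
      define e where "e = p (x - y) / 2"
      have e: "e > 0" using seminorm_on(5)[OF sn[OF p(1)], of "x - y"] xy p by (simp add: e_def)
      have "disjnt (sball p x e) (sball p y e)"
      proof -
        have False if "z \<in> sball p x e" "z \<in> sball p y e" for z
          using seminorm_on(7)[OF sn[OF p(1)], of x z y] seminorm_on(6)[OF sn[OF p(1)], of x z] xy that
          by (simp add: sball_def e_def)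
        then show ?thesis by (auto simp: disjnt_def)
      qed
      then show "\<exists>U W. openin ?T U \<and> openin ?T W \<and> x \<in> U \<and> y \<in> W \<and> disjnt U W"
        using openin_sball[OF G p(1)] xy centre_in_sball[OF sn[OF p(1)] _ e] by blast
    qed
    show "continuous_map (prod_topology ?T ?T) ?T (\<lambda>(x, y). x + y)"
    proof (rule continuous_map_seminorm_topology[OF G])
      fix z p and e :: real assume z: "z \<in> topspace (prod_topology ?T ?T)" and p: "p \<in> G" and "e > 0"
      obtain x y where xy: "z = (x, y)" "x \<in> carr V" "y \<in> carr V" using z by (auto simp: top)
      let ?U = "sball p x (e/2) \<times> sball p y (e/2)"
      have "p ((x' + y') - (x + y)) < e" if "x' \<in> sball p x (e/2)" "y' \<in> sball p y (e/2)" for x' y'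
        using that xy seminorm_on(1)[OF sn[OF p], of "x' - x" "y' - y"]
        by (simp add: sball_def algebra_simps)
      then show "\<exists>U. openin (prod_topology ?T ?T) U \<and> z \<in> U \<and>
          (\<forall>w\<in>U. p ((case w of (x, y) \<Rightarrow> x + y) - (case z of (x, y) \<Rightarrow> x + y)) < e)"
        using xy p \<open>e > 0\<close> openin_sball[OF G p] centre_in_sball[OF sn[OF p]]
        by (intro exI[of _ ?U]) (auto simp: openin_prod_Times_iff)
    qed (auto simp: top)
    show "continuous_map (prod_topology euclidean ?T) ?T (\<lambda>(c, x). scal V c x)"
    proof (rule continuous_map_seminorm_topology[OF G])
      fix z :: "'k \<times> 'v" and p and e :: real
      assume z: "z \<in> topspace (prod_topology euclidean ?T)" and p: "p \<in> G" and "e > 0"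
      obtain c x where cx: "z = (c, x)" "x \<in> carr V" using z by (auto simp: top)
      note s = seminorm_on[OF sn[OF p]]
      \<comment> \<open>Radii for \<open>c' x' - c x = c' (x' - x) + (c' - c) x\<close>:
        \<open>d\<close> keeps the second term below \<open>e / 2\<close> and \<open>norm c'\<close>
        at most \<open>norm c + 1\<close>, so that \<open>r\<close> keeps the first within
        \<open>e / 2\<close>. The summands 1 in the denominators avoid division by 0.\<close>
      define d where "d = min 1 (e / (2 * (p x + 1)))"
      define r where "r = e / (2 * (norm c + 1))"
      have px: "p x \<ge> 0" using s(5) cx by blast
      have d: "d > 0" "d \<le> 1" "d * p x < e / 2"
      proof -
        show "d > 0" "d \<le> 1" using \<open>e > 0\<close> px by (auto simp: d_def)
        have "d * p x \<le> e / (2 * (p x + 1)) * p x"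
          using px by (intro mult_right_mono) (auto simp: d_def)
        also have "\<dots> < e / 2" using px \<open>e > 0\<close> by (simp add: field_simps)
        finally show "d * p x < e / 2" .
      qed
      have r: "r > 0" using \<open>e > 0\<close> norm_ge_zero[of c] by (simp add: r_def add_nonneg_pos)
      have "p (scal V c' x' - scal V c x) < e" if c': "c' \<in> ball c d" and x': "x' \<in> sball p x r" for c' x'
      proof -
        have x'c: "x' \<in> carr V" "p (x' - x) < r" using x' by (auto simp: sball_def)
        have dc: "norm (c' - c) < d" using c' by (simp add: dist_norm norm_minus_commute)
        have nc: "norm c' \<le> norm c + 1"
          using norm_triangle_ineq[of c "c' - c"] dc d by simp
        have "scal V c' x' - scal V c x = scal V c' (x' - x) + scal V (c' - c) x"
          by (simp add: scale_right_diff_distrib scale_left_diff_distrib)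
        then have "p (scal V c' x' - scal V c x) \<le> norm c' * p (x' - x) + norm (c' - c) * p x"
          using s(1)[of "scal V c' (x' - x)" "scal V (c' - c) x"] cx x'c by (simp add: s(2))
        also have "norm c' * p (x' - x) \<le> (norm c + 1) * r"
          using nc x'c cx s(5)[of "x' - x"] by (intro mult_mono) auto
        also have "(norm c + 1) * r = e / 2"
          using norm_ge_zero[of c] by (simp add: r_def field_simps add_nonneg_eq_0_iff)
        also have "norm (c' - c) * p x \<le> d * p x"
          using dc px by (intro mult_right_mono) auto
        finally show ?thesis using d(3) by simp
      qed
      moreover have "openin (prod_topology euclidean ?T) (ball c d \<times> sball p x r)"
        using openin_sball[OF G p cx(2)] by (simp add: openin_prod_Times_iff)
      ultimately show "\<exists>U. openin (prod_topology euclidean ?T) U \<and> z \<in> U \<and>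
          (\<forall>w\<in>U. p ((case w of (c, x) \<Rightarrow> scal V c x) - (case z of (c, x) \<Rightarrow> scal V c x)) < e)"
        using cx d r centre_in_sball[OF sn[OF p] cx(2)]
        by (intro exI[of _ "ball c d \<times> sball p x r"]) auto
    qed (auto simp: top)
    show "neighbourhood_base_at 0 (convex_subset V) ?T"
      unfolding neighbourhood_base_at_def
    proof (intro allI impI)
      fix U assume U: "openin ?T U \<and> 0 \<in> U"
      then obtain p e where p: "p \<in> G" "e > 0" "sball p 0 e \<subseteq> U"
        by (auto simp: openin_seminorm_topology[OF G])
      then show "\<exists>U' C. openin ?T U' \<and> convex_subset V C \<and> 0 \<in> U' \<and> U' \<subseteq> C \<and> C \<subseteq> U"
        using openin_sball[OF G p(1)] convex_sball[OF sn[OF p(1)]] centre_in_sball[OF sn[OF p(1)]]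
        by (intro exI[of _ "sball p 0 e"]) auto
    qed
  qed
qed

text \<open>Continuity at 0 gives a ball of radius \<open>e\<close> on which
  \<open>norm (f x) < 1\<close>; homogeneity turns it into the bound with \<open>C = 1 / e\<close>.
  One seminorm suffices because the balls of single seminorms are a base.\<close>

lemma cont_forms_seminorm_topology:
  assumes G: "seminorm_family G" and f: "f \<in> cont_forms V (seminorm_topology G)"
  obtains p C where "p \<in> G" "C > 0" "\<And>x. x \<in> carr V \<Longrightarrow> norm (f x) \<le> C * p x"
proof -
  have lin: "f \<in> lin_maps V ground" and cont: "continuous_map (seminorm_topology G) euclidean f"
    using f by (auto simp: cont_forms_def)
  have "openin (seminorm_topology G) {x \<in> carr V. f x \<in> ball 0 1}"
    using openin_continuous_map_preimage[OF cont, of "ball 0 1"] topspace_seminorm_topology[OF G]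
    by simp
  moreover have "0 \<in> {x \<in> carr V. f x \<in> ball 0 1}" using lin_mapsD(4)[OF lin] by simp
  ultimately obtain p e where p: "p \<in> G" "e > 0" "sball p 0 e \<subseteq> {x \<in> carr V. f x \<in> ball 0 1}"
    by (auto simp: openin_seminorm_topology[OF G])
  show ?thesis
  proof
    show "p \<in> G" "1 / e > 0" using p by auto
    fix x assume x: "x \<in> carr V"
    have sn: "seminorm_on p" using G p by (simp add: seminorm_family_def)
    show "norm (f x) \<le> 1 / e * p x"
    proof (rule ccontr)
      assume "\<not> ?thesis"
      then have less: "p x < e * norm (f x)" using p(2) by (simp add: field_simps)
      then have fx: "norm (f x) > 0"
        using seminorm_on(5)[OF sn x] p(2) by (cases "f x = 0") auto
      \<comment> \<open>Normalised so that \<open>f ?y = 1\<close>, although \<open>p ?y < e\<close>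
        puts \<open>?y\<close> into the ball.\<close>
      let ?y = "scal V (inverse (f x)) x"
      have "p ?y < e"
        using less fx x by (simp add: seminorm_on(2)[OF sn] norm_divide field_simps)
      then have "norm (f ?y) < 1"
        using p(3) x by (auto simp: sball_def)
      then show False using fx x by (simp add: lin_mapsD(2)[OF lin])
    qed
  qed
qed

section \<open>Topologies generated by an arbitrary set of seminorms, and their continuous
  forms\<close>

inductive_set seminorm_sums :: "('v \<Rightarrow> real) set \<Rightarrow> ('v \<Rightarrow> real) set" for P where
  zero: "(\<lambda>x. 0) \<in> seminorm_sums P"
| base: "p \<in> P \<Longrightarrow> p \<in> seminorm_sums P"
| plus: "p \<in> seminorm_sums P \<Longrightarrow> q \<in> seminorm_sums P \<Longrightarrow> (\<lambda>x. p x + q x) \<in> seminorm_sums P"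

lemma seminorm_on_sums:
  assumes "\<And>p. p \<in> P \<Longrightarrow> seminorm_on p" "q \<in> seminorm_sums P" shows "seminorm_on q"
  using assms(2) by induction (auto intro: assms seminorm_on_zero seminorm_on_plus)

lemma seminorm_family_sums:
  assumes "\<And>p. p \<in> P \<Longrightarrow> seminorm_on p" shows "seminorm_family (seminorm_sums P)"
  using seminorm_on_sums[OF assms] seminorm_sums.intros by (auto simp: seminorm_family_def)

text \<open>A continuous form is bounded by a multiple of some sum; each \<open>plus\<close> is
  undone by \<open>lin_form_decompose\<close> until every piece is bounded by one generator. So it
  is enough that \<open>M\<close> contains these pieces and is closed under finite sums.\<close>

lemma cont_forms_sums_subset:
  assumes P: "\<And>p. p \<in> P \<Longrightarrow> seminorm_on p"
    and M: "0 \<in> M" "\<And>f g. f \<in> M \<Longrightarrow> g \<in> M \<Longrightarrow> f + g \<in> M"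
    and base: "\<And>p C f. p \<in> P \<Longrightarrow> C > 0 \<Longrightarrow> f \<in> lin_maps V ground \<Longrightarrow>
      (\<And>x. x \<in> carr V \<Longrightarrow> norm (f x) \<le> C * p x) \<Longrightarrow> f \<in> M"
  shows "cont_forms V (seminorm_topology (seminorm_sums P)) \<subseteq> M"
proof
  fix f assume f: "f \<in> cont_forms V (seminorm_topology (seminorm_sums P))"
  then obtain p C where pC: "p \<in> seminorm_sums P" "C > 0" "\<And>x. x \<in> carr V \<Longrightarrow> norm (f x) \<le> C * p x"
    using cont_forms_seminorm_topology[OF seminorm_family_sums[OF P]] by blast
  have "f \<in> lin_maps V ground" using f by (simp add: cont_forms_def)
  with pC show "f \<in> M"
  \<comment> \<open>\<open>f\<close> and \<open>C\<close> are generalised because a split passes to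
    new forms with the constant \<open>2 * C\<close>.\<close>
  proof (induction p arbitrary: f C rule: seminorm_sums.induct)
    case zero
    then have "f = 0"
      using lin_mapsD(3)[OF zero(3)] by (auto simp: fun_eq_iff)
    show ?case unfolding \<open>f = 0\<close> by (rule M(1))
  next
    case (base p)
    then show ?case using assms(4) by blast
  next
    case (plus p q)
    have sn: "seminorm_on p" "seminorm_on q"
      using plus seminorm_on_sums[OF P] by auto
    obtain g h where gh: "g \<in> lin_maps V ground" "h \<in> lin_maps V ground" "f = g + h"
      "\<And>x. x \<in> carr V \<Longrightarrow> norm (g x) \<le> 2 * (C * p x)" "\<And>x. x \<in> carr V \<Longrightarrow> norm (h x) \<le> 2 * (C * q x)"
    proof (rule lin_form_decompose)
      show "seminorm_on (\<lambda>x. C * p x)" "seminorm_on (\<lambda>x. C * q x)"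
        using sn plus(5) by (auto intro: seminorm_on_mult)
      show "f \<in> lin_maps V ground" by fact
      show "norm (f x) \<le> C * p x + C * q x" if "x \<in> carr V" for x
        using plus(6)[OF that] by (simp add: algebra_simps)
    qed blast
    have "g \<in> M" "h \<in> M"
      using plus(3)[of "2 * C" g] plus(4)[of "2 * C" h] gh plus(5) by (auto simp: mult.assoc)
    then show ?case unfolding gh(3) by (rule M(2))
  qed
qed


section \<open>Continuous seminorms\<close>

text \<open>Being at most 1 near 0 already is continuity for a seminorm; translation and scaling
  give the rest (\<open>cont_seminorm_small\<close>).\<close>

definition cont_seminorms :: "'v topology \<Rightarrow> ('v \<Rightarrow> real) set" where
  "cont_seminorms T = {p. seminorm_on p \<and> (\<exists>U. openin T U \<and> 0 \<in> U \<and> (\<forall>x\<in>U. p x \<le> 1))}"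

context
  fixes T assumes T: "hausdorff_lc_topology V T"
begin

lemma topspace_lc: "topspace T = carr V"
  using T by (simp add: hausdorff_lc_topology_def)

lemma continuous_map_scal: "continuous_map T T (scal V c)"
proof -
  have "continuous_map T (prod_topology euclidean T) (\<lambda>x. (c, x))"
    by (intro continuous_map_pairedI) auto
  from continuous_map_compose[OF this, of T "\<lambda>(c, x). scal V c x"] T show ?thesis
    by (auto simp: hausdorff_lc_topology_def o_def)
qed

lemma continuous_map_translate:
  assumes "a \<in> carr V" shows "continuous_map T T (\<lambda>x. x - a)"
proof -
  have "continuous_map T (prod_topology T T) (\<lambda>x. (x, - a))"
    using assms by (intro continuous_map_pairedI) (auto simp: topspace_lc)
  from continuous_map_compose[OF this, of T "\<lambda>(x, y). x + y"] T show ?thesis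
    by (auto simp: hausdorff_lc_topology_def o_def)
qed

lemma cont_seminorm_small:
  assumes p: "p \<in> cont_seminorms T" and x: "x \<in> carr V" and "e > 0"
  shows "\<exists>U. openin T U \<and> x \<in> U \<and> (\<forall>y\<in>U. p (y - x) < e)"
proof -
  obtain U where U: "openin T U" "0 \<in> U" "\<And>y. y \<in> U \<Longrightarrow> p y \<le> 1" and sn: "seminorm_on p"
    using p by (auto simp: cont_seminorms_def)
  \<comment> \<open>\<open>x\<close> is moved to 0 and the bound 1 is rescaled to
    \<open>e / 2\<close>, which leaves room for the strict inequality.\<close>
  let ?f = "\<lambda>y. real_scal (2 / e) (y - x)"
  have "continuous_map T T ?f"
    using continuous_map_compose[OF continuous_map_translate[OF x] continuous_map_scal]
    by (simp add: o_def)
  then have "openin T {y \<in> topspace T. ?f y \<in> U}"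
    using U(1) by (rule openin_continuous_map_preimage)
  moreover have "p (y - x) < e" if "y \<in> carr V" "?f y \<in> U" for y
  proof -
    have "2 / e * p (y - x) \<le> 1"
      using U(3)[OF that(2)] that(1) x \<open>e > 0\<close>
        seminorm_on(2)[OF sn, of "y - x" "of_real (2 / e)"] by (simp add: norm_divide)
    then have "2 * p (y - x) \<le> e" using \<open>e > 0\<close> by (simp add: field_simps)
    then show ?thesis using \<open>e > 0\<close> by simp
  qed
  ultimately show ?thesis
    using x U(2) by (intro exI[of _ "{y \<in> topspace T. ?f y \<in> U}"]) (auto simp: topspace_lc)
qed

lemma seminorm_family_cont_seminorms: "seminorm_family (cont_seminorms T)"
  unfolding seminorm_family_def
proof (intro conjI ballI)
  show "(\<lambda>x. 0) \<in> cont_seminorms T"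
    using openin_topspace[of T]
    by (auto simp: cont_seminorms_def seminorm_on_zero topspace_lc intro!: exI[of _ "carr V"])
  fix p q assume p: "p \<in> cont_seminorms T" and q: "q \<in> cont_seminorms T"
  then have sn: "seminorm_on p" "seminorm_on q" by (auto simp: cont_seminorms_def)
  obtain U where U: "openin T U" "0 \<in> U" "\<And>y. y \<in> U \<Longrightarrow> p y < 1/2"
    using cont_seminorm_small[OF p, of 0 "1/2"] by auto
  obtain W where W: "openin T W" "0 \<in> W" "\<And>y. y \<in> W \<Longrightarrow> q y < 1/2"
    using cont_seminorm_small[OF q, of 0 "1/2"] by auto
  have "p y + q y \<le> 1" if "y \<in> U \<inter> W" for y
    using U(3)[of y] W(3)[of y] that by simp
  then show "(\<lambda>x. p x + q x) \<in> cont_seminorms T"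
    using U W sn by (auto simp: cont_seminorms_def seminorm_on_plus intro!: exI[of _ "U \<inter> W"])
qed (simp add: cont_seminorms_def)

lemma cont_seminorms_sums:
  assumes "P \<subseteq> cont_seminorms T" shows "seminorm_sums P \<subseteq> cont_seminorms T"
proof
  fix p assume "p \<in> seminorm_sums P"
  then show "p \<in> cont_seminorms T"
    using seminorm_family_cont_seminorms assms
    by induction (auto simp: seminorm_family_def)
qed

lemma cont_forms_if_bounded:
  assumes f: "f \<in> lin_maps V ground" and p: "p \<in> cont_seminorms T"
    and le: "\<And>x. x \<in> carr V \<Longrightarrow> norm (f x) \<le> C * p x"
  shows "f \<in> cont_forms V T"
proof -
  have "continuous_map T euclidean f"
    unfolding continuous_map
  proof (intro conjI allI impI)
    fix U :: "'k set" assume "openin euclidean U"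
    show "openin T {x \<in> topspace T. f x \<in> U}"
    proof (subst openin_subopen, intro ballI)
      fix x assume x: "x \<in> {x \<in> topspace T. f x \<in> U}"
      then obtain e where e: "e > 0" "ball (f x) e \<subseteq> U"
        using \<open>openin euclidean U\<close> open_contains_ball[of U] by auto
      have xc: "x \<in> carr V" using x by (simp add: topspace_lc)
      \<comment> \<open>\<open>C\<close> may be 0 or negative, hence the positive denominator
        \<open>\<bar>C\<bar> + 1\<close>.\<close>
      obtain W where W: "openin T W" "x \<in> W" "\<And>y. y \<in> W \<Longrightarrow> p (y - x) < e / (\<bar>C\<bar> + 1)"
        using cont_seminorm_small[OF p xc, of "e / (\<bar>C\<bar> + 1)"] e by auto
      have "f y \<in> U \<and> y \<in> topspace T" if y: "y \<in> W" for y
      proof -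
        have yc: "y \<in> carr V" using openin_subset[OF W(1)] y by (auto simp: topspace_lc)
        have sn: "p (y - x) \<ge> 0"
          using p yc xc seminorm_on(5) by (auto simp: cont_seminorms_def)
        have "norm (f y - f x) \<le> C * p (y - x)"
          using le[of "y - x"] yc xc lin_mapsD(5)[OF f yc xc] by simp
        also have "\<dots> \<le> (\<bar>C\<bar> + 1) * p (y - x)"
          using sn by (intro mult_right_mono) auto
        also have "\<dots> < e"
          using W(3)[OF y] by (simp add: field_simps)
        finally show ?thesis
          using e(2) yc by (auto simp: dist_norm norm_minus_commute topspace_lc)
      qed
      then show "\<exists>S. openin T S \<and> x \<in> S \<and> S \<subseteq> {x \<in> topspace T. f x \<in> U}"
        using W by blast
    qed
  qed auto
  then show ?thesis using f by (simp add: cont_forms_def)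
qed

lemma cont_seminorms_norm:
  assumes f: "f \<in> cont_forms V T" shows "(\<lambda>x. norm (f x)) \<in> cont_seminorms T"
proof -
  have lin: "f \<in> lin_maps V ground" and cont: "continuous_map T euclidean f"
    using f by (auto simp: cont_forms_def)
  have "openin T {x \<in> topspace T. f x \<in> ball 0 1}"
    by (rule openin_continuous_map_preimage[OF cont]) auto
  then show ?thesis
    using lin_mapsD(4)[OF lin] seminorm_on_norm[OF lin]
    by (auto simp: cont_seminorms_def topspace_lc intro!: exI[of _ "{x \<in> topspace T. f x \<in> ball 0 1}"])
qed

lemma cont_forms_closed:
  "0 \<in> cont_forms V T"
  "f \<in> cont_forms V T \<Longrightarrow> g \<in> cont_forms V T \<Longrightarrow> f + g \<in> cont_forms V T"
  "f \<in> cont_forms V T \<Longrightarrow> functional_scal c f \<in> cont_forms V T"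
proof -
  show "functional_scal c f \<in> cont_forms V T" if f: "f \<in> cont_forms V T"
  proof -
    have "continuous_map euclidean euclidean ((*) c)"
      by (simp add: continuous_on_mult_left)
    then have "continuous_map T euclidean ((*) c \<circ> f)"
      using f by (intro continuous_map_compose) (auto simp: cont_forms_def)
    then show ?thesis
      using f lin_maps_closed(4) by (simp add: cont_forms_def functional_scal_def o_def)
  qed
qed (use lin_maps_closed in \<open>auto simp: cont_forms_def plus_fun_def zero_fun_def intro!: continuous_map_add\<close>)

lemma coarser_seminorm_topology:
  assumes "G \<subseteq> cont_seminorms T" "seminorm_family G"
  shows "coarser (seminorm_topology G) T"
  unfolding coarser_def
proof (intro conjI allI impI)
  show "topspace (seminorm_topology G) = topspace T"
    by (simp add: topspace_lc topspace_seminorm_topology assms)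
  fix U assume U: "openin (seminorm_topology G) U"
  show "openin T U"
  proof (subst openin_subopen, intro ballI)
    fix x assume x: "x \<in> U"
    then obtain p e where p: "p \<in> G" "e > 0" "sball p x e \<subseteq> U"
      using U by (auto simp: openin_seminorm_topology[OF assms(2)])
    have "x \<in> carr V" using U x by (auto simp: openin_seminorm_topology[OF assms(2)])
    then obtain W where "openin T W" "x \<in> W" "\<And>y. y \<in> W \<Longrightarrow> p (y - x) < e"
      using cont_seminorm_small[of p x e] assms p by blast
    then show "\<exists>S. openin T S \<and> x \<in> S \<and> S \<subseteq> U"
      using p(3) openin_subset[of T W] by (intro exI[of _ W]) (auto simp: sball_def topspace_lc)
  qed
qed

end

end

section \<open>Minkowski gauges, and the recovery of a locally convex topology from its continuous
  seminorms\<close>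

context kvs
begin

definition minkowski_gauge :: "'v set \<Rightarrow> 'v \<Rightarrow> real" where
  "minkowski_gauge B x = Inf {t. t > 0 \<and> real_scal (1 / t) x \<in> B}"

context
  fixes B assumes carr: "B \<subseteq> carr V"
    and convex: "\<And>x y a b. x \<in> B \<Longrightarrow> y \<in> B \<Longrightarrow> a \<ge> 0 \<Longrightarrow> b \<ge> 0 \<Longrightarrow> a + b = 1 \<Longrightarrow> real_scal a x + real_scal b y \<in> B"
    and balanced: "\<And>x c. x \<in> B \<Longrightarrow> norm c \<le> 1 \<Longrightarrow> scal V c x \<in> B"
    and absorbing: "\<And>x. x \<in> carr V \<Longrightarrow> \<exists>t>0. real_scal (1 / t) x \<in> B"
begin

lemma gauge_le: "t > 0 \<Longrightarrow> real_scal (1 / t) x \<in> B \<Longrightarrow> minkowski_gauge B x \<le> t"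
  unfolding minkowski_gauge_def by (rule cInf_lower) (auto intro!: bdd_belowI[of _ 0])

lemma gauge_ge:
  "x \<in> carr V \<Longrightarrow> (\<And>t. t > 0 \<Longrightarrow> real_scal (1 / t) x \<in> B \<Longrightarrow> m \<le> t) \<Longrightarrow> m \<le> minkowski_gauge B x"
  unfolding minkowski_gauge_def using absorbing by (intro cInf_greatest) blast+

lemma gauge_less_1:
  assumes x: "x \<in> carr V" and less: "minkowski_gauge B x < 1" shows "x \<in> B"
proof -
  obtain t where t: "t > 0" "t < 1" "real_scal (1 / t) x \<in> B"
    using gauge_ge[OF x, of 1] less by force
  from balanced[OF t(3), of "of_real t"] t show ?thesis by (simp flip: of_real_mult)
qed

lemma seminorm_gauge: "seminorm_on (minkowski_gauge B)"
proof -
  have le: "minkowski_gauge B (scal V c x) \<le> norm c * minkowski_gauge B x" if x: "x \<in> carr V" and c: "c \<noteq> 0" for c x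
  proof -
    have "minkowski_gauge B (scal V c x) / norm c \<le> minkowski_gauge B x"
    proof (rule gauge_ge[OF x])
      fix t :: real assume t: "t > 0" "real_scal (1 / t) x \<in> B"
      \<comment> \<open>The factor \<open>c / norm c\<close> has norm 1, so balancedness admits it;
        this trades \<open>c\<close> for \<open>norm c\<close>.\<close>
      have "scal V (c / of_real (norm c)) (real_scal (1 / t) x) \<in> B"
        by (rule balanced[OF t(2)]) (use c in \<open>simp add: norm_divide\<close>)
      then have "real_scal (1 / (norm c * t)) (scal V c x) \<in> B"
        by (simp add: field_simps)
      then have "minkowski_gauge B (scal V c x) \<le> norm c * t"
        using t c by (intro gauge_le) auto
      then show "minkowski_gauge B (scal V c x) / norm c \<le> t"
        using c by (simp add: field_simps)
    qed
    then show ?thesis using c by (simp add: field_simps)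
  qed
  have zero: "minkowski_gauge B 0 = 0"
  proof (rule antisym)
    have "0 \<in> B" using absorbing[of 0] by auto
    then have "minkowski_gauge B 0 \<le> t" if "t > 0" for t using gauge_le[OF that, of 0] by simp
    then show "minkowski_gauge B 0 \<le> 0" by (meson dense not_le)
    show "0 \<le> minkowski_gauge B 0" by (rule gauge_ge) auto
  qed
  show ?thesis
    unfolding seminorm_on_def
  proof (intro conjI ballI allI)
    fix x y assume x: "x \<in> carr V" and y: "y \<in> carr V"
    have "minkowski_gauge B (x + y) - minkowski_gauge B y \<le> minkowski_gauge B x"
    proof (rule gauge_ge[OF x])
      fix t :: real assume t: "t > 0" "real_scal (1 / t) x \<in> B"
      have "minkowski_gauge B (x + y) - t \<le> minkowski_gauge B y"
      proof (rule gauge_ge[OF y])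
        fix s :: real assume s: "s > 0" "real_scal (1 / s) y \<in> B"
        \<comment> \<open>\<open>(x + y) / (t + s)\<close> is the convex combination of
          \<open>x / t\<close> and \<open>y / s\<close> with these weights.\<close>
        have "real_scal (t / (t + s)) (real_scal (1 / t) x) + real_scal (s / (t + s)) (real_scal (1 / s) y) \<in> B"
          using t s by (intro convex) (simp_all flip: add_divide_distrib)
        moreover have "real_scal (t / (t + s)) (real_scal (1 / t) x) = real_scal (1 / (t + s)) x"
          "real_scal (s / (t + s)) (real_scal (1 / s) y) = real_scal (1 / (t + s)) y"
          using t s by (simp_all flip: of_real_mult)
        ultimately have "real_scal (1 / (t + s)) (x + y) \<in> B"
          by (simp only: scale_right_distrib)
        then show "minkowski_gauge B (x + y) - t \<le> s"
          using gauge_le[of "t + s" "x + y"] t s by simp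
      qed
      then show "minkowski_gauge B (x + y) - minkowski_gauge B y \<le> t" by simp
    qed
    then show "minkowski_gauge B (x + y) \<le> minkowski_gauge B x + minkowski_gauge B y" by simp
  next
    fix c x assume x: "x \<in> carr V"
    show "minkowski_gauge B (scal V c x) = norm c * minkowski_gauge B x"
    proof (cases "c = 0")
      case False
      \<comment> \<open>The converse inequality is \<open>le\<close> for the factor
        \<open>inverse c\<close>.\<close>
      have "minkowski_gauge B (scal V (inverse c) (scal V c x)) \<le> norm (inverse c) * minkowski_gauge B (scal V c x)"
        using x False by (intro le) auto
      then have "norm c * minkowski_gauge B x \<le> minkowski_gauge B (scal V c x)"
        using False by (simp add: norm_divide field_simps)
      with le[OF x False] show ?thesis by simp
    qed (simp add: zero)
  qed
qed

end

context
  fixes T assumes T: "hausdorff_lc_topology V T"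
begin

text \<open>The neighbourhoods at hand are convex but need not be balanced. The balanced core of a
  convex one is still convex, and it contains a neighbourhood of 0 by joint continuity of scaling,
  hence is absorbing; its gauge is the seminorm.\<close>

lemma ex_cont_seminorm_zero:
  assumes U: "openin T U" "0 \<in> U"
  obtains p where "p \<in> cont_seminorms T" "sball p 0 1 \<subseteq> U"
proof -
  note top = topspace_lc[OF T]
  obtain O1 N where N: "openin T O1" "convex_subset V N" "0 \<in> O1" "O1 \<subseteq> N" "N \<subseteq> U"
  proof -
    have "neighbourhood_base_at 0 (convex_subset V) T"
      using T by (simp add: hausdorff_lc_topology_def)
    then have "\<exists>O1 N. openin T O1 \<and> convex_subset V N \<and> 0 \<in> O1 \<and> O1 \<subseteq> N \<and> N \<subseteq> U"
      using U by (simp add: neighbourhood_base_at_def)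
    then show ?thesis using that by (elim exE conjE)
  qed
  have cont: "continuous_map (prod_topology euclidean T) T (\<lambda>(c, x). scal V c x)"
    using T by (simp add: hausdorff_lc_topology_def)
  let ?P = "{z \<in> topspace (prod_topology euclidean T). (case z of (c, x) \<Rightarrow> scal V c x) \<in> O1}"
  have "openin (prod_topology euclidean T) ?P"
    using cont N(1) by (rule openin_continuous_map_preimage)
  moreover have "(0, 0) \<in> ?P"
    using N(3) by (simp add: top)
  ultimately have "\<exists>A O2. openin euclidean A \<and> openin T O2 \<and> 0 \<in> A \<and> 0 \<in> O2 \<and> A \<times> O2 \<subseteq> ?P"
    by (rule openin_prod_topology_alt[THEN iffD1, rule_format])
  then obtain A O2 where A: "open A" "0 \<in> A" and O2: "openin T O2" "0 \<in> O2" and sub': "A \<times> O2 \<subseteq> ?P"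
    by (elim exE conjE) (simp only: open_openin)
  have sub: "scal V c x \<in> O1" if "c \<in> A" "x \<in> O2" for c x
    using sub' that by auto
  obtain d where d: "d > 0" "ball 0 d \<subseteq> A"
    using A open_contains_ball[of A] by blast
  \<comment> \<open>Half the radius, so that \<open>norm (c * r) < d\<close> whenever
    \<open>norm c \<le> 1\<close>. With \<open>W\<close> the dilate of \<open>O2\<close> by
    \<open>r\<close>, every \<open>c y\<close> equals \<open>(c r) (y / r)\<close> and lies in
    \<open>O1\<close>.\<close>
  define r where "r = d / 2"
  have r: "r > 0" using d by (simp add: r_def)
  define W where "W = {y \<in> carr V. real_scal (1 / r) y \<in> O2}"
  have W: "openin T W" "0 \<in> W"
    using openin_continuous_map_preimage[OF continuous_map_scal[OF T, of "of_real (1 / r)"] O2(1)] O2(2)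
    by (auto simp: W_def top)
  \<comment> \<open>The balanced core: the largest balanced subset of \<open>N\<close>.\<close>
  define B where "B = {x \<in> carr V. \<forall>c. norm c \<le> 1 \<longrightarrow> scal V c x \<in> N}"
  have WB: "W \<subseteq> B"
  proof
    fix y assume y: "y \<in> W"
    have "scal V c y \<in> N" if c: "norm c \<le> 1" for c
    proof -
      have "norm c * r < d" using mult_right_mono[OF c, of r] r d by (simp add: r_def)
      then have "c * of_real r \<in> A" using d(2) r by (auto simp: norm_mult)
      then have "scal V (c * of_real r) (real_scal (1 / r) y) \<in> O1"
        using y by (intro sub) (auto simp: W_def)
      then show ?thesis using r N(4) by auto
    qed
    then show "y \<in> B" using y by (auto simp: B_def W_def)
  qed
  have BN: "B \<subseteq> N"
  proof
    fix x assume "x \<in> B"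
    then have "scal V 1 x \<in> N" unfolding B_def by (metis (mono_tags, lifting) mem_Collect_eq norm_one order_refl)
    then show "x \<in> N" by simp
  qed
  have 1: "B \<subseteq> carr V" by (auto simp: B_def)
  have 2: "real_scal a x + real_scal b y \<in> B"
    if "x \<in> B" "y \<in> B" "a \<ge> 0" "b \<ge> 0" "a + b = 1" for x y a b
  proof -
    have "scal V c (real_scal a x + real_scal b y) \<in> N" if "norm c \<le> 1" for c
    proof -
      have "scal V c x \<in> N" "scal V c y \<in> N" using that \<open>x \<in> B\<close> \<open>y \<in> B\<close> by (auto simp: B_def)
      then have "real_scal a (scal V c x) + real_scal b (scal V c y) \<in> N"
        using N(2) \<open>a \<ge> 0\<close> \<open>b \<ge> 0\<close> \<open>a + b = 1\<close> unfolding convex_subset_def by blast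
      then show ?thesis by (simp add: scale_right_distrib mult.commute)
    qed
    then show ?thesis using that by (auto simp: B_def)
  qed
  have 3: "scal V c x \<in> B" if "x \<in> B" "norm c \<le> 1" for c x
  proof -
    have "norm (c' * c) \<le> 1" if "norm c' \<le> 1" for c'
      using mult_mono[OF that \<open>norm c \<le> 1\<close>] by (simp add: norm_mult)
    then show ?thesis using that by (auto simp: B_def)
  qed
  have 4: "\<exists>t>0. real_scal (1 / t) x \<in> B" if x: "x \<in> carr V" for x
  proof -
    have "continuous_map euclidean (prod_topology euclidean T) (\<lambda>c. (c, x))"
      using x by (intro continuous_map_pairedI) (auto simp: top)
    from continuous_map_compose[OF this cont] have "continuous_map euclidean T (\<lambda>c. scal V c x)"
      by (simp add: o_def)
    from openin_continuous_map_preimage[OF this W(1)] have "open {c. scal V c x \<in> W}"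
      by simp
    moreover have "0 \<in> {c. scal V c x \<in> W}" using W(2) by simp
    ultimately obtain e where e: "e > 0" "ball 0 e \<subseteq> {c. scal V c x \<in> W}"
      by (metis open_contains_ball)
    \<comment> \<open>The scalar \<open>e / 2\<close> lies in the ball, and \<open>2 / e\<close> is
      the witness \<open>t\<close> for absorption.\<close>
    have "real_scal (1 / (2 / e)) x \<in> W"
      using e(1) subsetD[OF e(2), of "of_real (1 / (2 / e))"] by (simp add: norm_divide)
    then show ?thesis using e(1) WB by (intro exI[of _ "2 / e"]) auto
  qed
  have g1: "minkowski_gauge B x \<le> 1" if "x \<in> B" for x
    by (rule gauge_le; (fact 1 2 3 4)?) (use that in auto)
  have g2: "x \<in> B" if "x \<in> carr V" "minkowski_gauge B x < 1" for x
    by (rule gauge_less_1; (fact 1 2 3 4 that)?)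
  have g3: "seminorm_on (minkowski_gauge B)"
    by (rule seminorm_gauge; (fact 1 2 3 4)?)
  show ?thesis
  proof
    have "minkowski_gauge B x \<le> 1" if "x \<in> W" for x
      using g1 that WB by auto
    then show "minkowski_gauge B \<in> cont_seminorms T"
      using W g3 by (auto simp: cont_seminorms_def)
    show "sball (minkowski_gauge B) 0 1 \<subseteq> U"
      using g2 BN N(5) by (auto simp: sball_def)
  qed
qed

lemma ex_cont_seminorm:
  assumes U: "openin T U" "x \<in> U"
  obtains p where "p \<in> cont_seminorms T" "sball p x 1 \<subseteq> U"
proof -
  note top = topspace_lc[OF T]
  have x: "x \<in> carr V" using openin_subset[OF U(1)] U(2) by (auto simp: top)
  have "openin T {y \<in> topspace T. y - (- x) \<in> U}"
    using x by (intro openin_continuous_map_preimage[OF continuous_map_translate[OF T] U(1)]) auto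
  moreover have "0 \<in> {y \<in> topspace T. y - (- x) \<in> U}" using U by (simp add: top)
  ultimately obtain p where p: "p \<in> cont_seminorms T" "sball p 0 1 \<subseteq> {y \<in> topspace T. y - (- x) \<in> U}"
    using ex_cont_seminorm_zero by blast
  have "sball p x 1 \<subseteq> U"
  proof
    fix y assume "y \<in> sball p x 1"
    then have "y - x \<in> sball p 0 1" using x by (simp add: sball_def)
    then show "y \<in> U" using p(2) by auto
  qed
  then show ?thesis using p(1) that by blast
qed

text \<open>Around each point of an open set, \<open>ex_cont_seminorm\<close> fits a ball of a
  continuous seminorm. This is where the local convexity of \<open>T\<close> enters.\<close>

lemma coarser_than_seminorm_topology:
  assumes "cont_seminorms T \<subseteq> G" "seminorm_family G"
  shows "coarser T (seminorm_topology G)"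
  unfolding coarser_def
proof (intro conjI allI impI)
  show "topspace T = topspace (seminorm_topology G)"
    by (simp add: topspace_lc[OF T] topspace_seminorm_topology assms)
  fix U assume U: "openin T U"
  have "\<exists>p\<in>G. \<exists>e>0. sball p x e \<subseteq> U" if "x \<in> U" for x
    using ex_cont_seminorm[OF U that] assms(1) zero_less_one by (metis subsetD)
  then show "openin (seminorm_topology G) U"
    using openin_subset[OF U] by (auto simp: openin_seminorm_topology[OF assms(2)] topspace_lc[OF T])
qed

text \<open>A neighbourhood of 0 that misses \<open>x\<close> contains the unit ball of a continuous
  seminorm \<open>p\<close>, so \<open>p x \<ge> 1\<close>; the form from
  \<open>seminorm_support\<close> is bounded by \<open>2 * p\<close>, hence continuous.\<close>

lemma cont_forms_separate:
  assumes x: "x \<in> carr V" "x \<noteq> 0"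
  obtains f where "f \<in> cont_forms V T" "f x \<noteq> 0"
proof -
  have "Hausdorff_space T" using T by (simp add: hausdorff_lc_topology_def)
  then obtain U W where U: "openin T U" "openin T W" "0 \<in> U" "x \<in> W" "disjnt U W"
    unfolding Hausdorff_space_def topspace_lc[OF T] using x by (metis carr_closed(1))
  obtain p where p: "p \<in> cont_seminorms T" "sball p 0 1 \<subseteq> U"
    using ex_cont_seminorm_zero[OF U(1,3)] .
  have sn: "seminorm_on p" using p(1) by (simp add: cont_seminorms_def)
  have "x \<notin> sball p 0 1" using U p(2) by (auto simp: disjnt_def)
  then have "p x \<noteq> 0" using x by (auto simp: sball_def)
  then obtain f where "f \<in> lin_maps V ground" "f x \<noteq> 0" "\<And>x. x \<in> carr V \<Longrightarrow> norm (f x) \<le> 2 * p x"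
    using seminorm_support[OF sn x(1)] by blast
  then show ?thesis
    using cont_forms_if_bounded[OF T _ p(1)] that by blast
qed

end

text \<open>\<open>f\<close> vanishes on the kernel of \<open>g\<close>, so it factors through
  \<open>g\<close>. For the weak topology this settles the forms bounded by a single
  generator.\<close>

lemma proportional_if_bounded:
  assumes f: "f \<in> lin_maps V ground" and g: "g \<in> lin_maps V ground"
    and le: "\<And>x. x \<in> carr V \<Longrightarrow> norm (f x) \<le> C * norm (g x)"
  obtains c where "f = functional_scal c g"
proof (cases "\<exists>z\<in>carr V. g z \<noteq> 0")
  case False
  then have "f x = 0" for x
    using le[of x] lin_mapsD(3)[OF f, of x] by (cases "x \<in> carr V") auto
  then have "f = functional_scal 0 g" by (auto simp: functional_scal_def)
  then show ?thesis by (rule that)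
next
  case True
  then obtain z where z: "z \<in> carr V" "g z \<noteq> 0" by blast
  have "f x = f z / g z * g x" for x
  proof (cases "x \<in> carr V")
    case True
    \<comment> \<open>The component of \<open>x\<close> in the kernel of \<open>g\<close> along
      \<open>z\<close>.\<close>
    let ?y = "x - scal V (g x / g z) z"
    have "g ?y = 0" using True z by (simp add: lin_mapsD[OF g])
    then have "f ?y = 0" using le[of ?y] True z by simp
    then show ?thesis using True z by (simp add: lin_mapsD[OF f] field_simps)
  qed (simp add: lin_mapsD(3)[OF f] lin_mapsD(3)[OF g])
  then have "f = functional_scal (f z / g z) g" unfolding functional_scal_def by (rule ext)
  then show ?thesis by (rule that)
qed

end

section \<open>The weak and the Mackey topology of a dual pair\<close>

lemma is_chuD:
  fixes P :: "('k::real_or_complex, 'v::ab_group_add, 'w::ab_group_add) chu"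
  assumes "is_chu P"
  shows "kvs (chu_left P)" "kvs (chu_right P)"
    "inj_on (left_to_dual P) (carr (chu_left P))" "inj_on (right_to_dual P) (carr (chu_right P))"
    "v \<in> carr (chu_left P) \<Longrightarrow> w \<in> carr (chu_right P) \<Longrightarrow> w' \<in> carr (chu_right P) \<Longrightarrow>
      pairing P v (w + w') = pairing P v w + pairing P v w'"
    "v \<in> carr (chu_left P) \<Longrightarrow> w \<in> carr (chu_right P) \<Longrightarrow>
      pairing P v (scal (chu_right P) c w) = c * pairing P v w"
    "v \<in> carr (chu_left P) \<Longrightarrow> v' \<in> carr (chu_left P) \<Longrightarrow> w \<in> carr (chu_right P) \<Longrightarrow>
      pairing P (v + v') w = pairing P v w + pairing P v' w"
    "v \<in> carr (chu_left P) \<Longrightarrow> w \<in> carr (chu_right P) \<Longrightarrow>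
      pairing P (scal (chu_left P) c v) w = c * pairing P v w"
  using assms
  by (simp_all add: is_chu_def kvs_def bilinear_betw_def linear_betw_def ground_def)

lemma is_chu_left_eqI:
  fixes P :: "('k::real_or_complex, 'v::ab_group_add, 'w::ab_group_add) chu"
  assumes P: "is_chu P" and v: "v \<in> carr (chu_left P)" "v' \<in> carr (chu_left P)"
    and eq: "\<And>w. w \<in> carr (chu_right P) \<Longrightarrow> pairing P v w = pairing P v' w"
  shows "v = v'"
  by (rule inj_onD[OF is_chuD(3)[OF P] _ v]) (auto simp: left_to_dual_def eq)

lemma is_chu_right_eqI:
  fixes P :: "('k::real_or_complex, 'v::ab_group_add, 'w::ab_group_add) chu"
  assumes P: "is_chu P" and w: "w \<in> carr (chu_right P)" "w' \<in> carr (chu_right P)"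
    and eq: "\<And>v. v \<in> carr (chu_left P) \<Longrightarrow> pairing P v w = pairing P v w'"
  shows "w = w'"
  by (rule inj_onD[OF is_chuD(4)[OF P] _ w]) (auto simp: right_to_dual_def eq)

lemma is_chu_dual: assumes P: "is_chu P" shows "is_chu (chu_dual P)"
proof -
  have "left_to_dual (chu_dual P) = right_to_dual P" "right_to_dual (chu_dual P) = left_to_dual P"
    by (auto simp: fun_eq_iff left_to_dual_def right_to_dual_def chu_dual_def)
  then show ?thesis
    using P by (auto simp: is_chu_def chu_dual_def bilinear_betw_def)
qed

lemma right_to_dual_lin_maps:
  fixes P :: "('k::real_or_complex, 'v::ab_group_add, 'w::ab_group_add) chu"
  assumes P: "is_chu P" and w: "w \<in> carr (chu_right P)"
  shows "right_to_dual P w \<in> lin_maps (chu_left P) ground"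
proof -
  interpret kvs "chu_left P" by (rule is_chuD(1)[OF P])
  show ?thesis
    by (rule lin_mapsI) (auto simp: right_to_dual_def is_chuD(5-)[OF P] w)
qed

text \<open>Makes the forms represented by the pair an admissible \<open>M\<close> in
  \<open>cont_forms_sums_subset\<close>; closure under scaling takes care of the multiples from
  \<open>proportional_if_bounded\<close>.\<close>

lemma right_to_dual_range_closed:
  fixes P :: "('k::real_or_complex, 'v::ab_group_add, 'w::ab_group_add) chu"
  assumes P: "is_chu P"
  shows "0 \<in> right_to_dual P ` carr (chu_right P)"
    "f \<in> right_to_dual P ` carr (chu_right P) \<Longrightarrow> g \<in> right_to_dual P ` carr (chu_right P) \<Longrightarrow>
      f + g \<in> right_to_dual P ` carr (chu_right P)"
    "f \<in> right_to_dual P ` carr (chu_right P) \<Longrightarrow>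
      functional_scal c f \<in> right_to_dual P ` carr (chu_right P)"
proof -
  interpret R: kvs "chu_right P" by (rule is_chuD(2)[OF P])
  have scale: "functional_scal c (right_to_dual P w) = right_to_dual P (scal (chu_right P) c w)"
    if "w \<in> carr (chu_right P)" for c w
    using that by (auto simp: fun_eq_iff right_to_dual_def functional_scal_def is_chuD(6)[OF P])
  have "0 = functional_scal 0 (right_to_dual P 0)"
    by (auto simp: fun_eq_iff functional_scal_def)
  also have "\<dots> = right_to_dual P (scal (chu_right P) 0 0)"
    by (rule scale) simp
  finally show "0 \<in> right_to_dual P ` carr (chu_right P)"
    by (rule image_eqI) simp
  show "f + g \<in> right_to_dual P ` carr (chu_right P)"
    if fg: "f \<in> right_to_dual P ` carr (chu_right P)" "g \<in> right_to_dual P ` carr (chu_right P)"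
  proof -
    obtain w w' where w: "w \<in> carr (chu_right P)" "w' \<in> carr (chu_right P)"
      "f = right_to_dual P w" "g = right_to_dual P w'" using fg by blast
    then have "f + g = right_to_dual P (w + w')"
      by (auto simp: fun_eq_iff right_to_dual_def is_chuD(5)[OF P])
    then show ?thesis by (rule image_eqI) (simp add: w)
  qed
  show "functional_scal c f \<in> right_to_dual P ` carr (chu_right P)"
    if f: "f \<in> right_to_dual P ` carr (chu_right P)"
  proof -
    obtain w where "w \<in> carr (chu_right P)" "f = right_to_dual P w" using f by blast
    then show ?thesis using scale by (intro image_eqI[of _ _ "scal (chu_right P) c w"]) auto
  qed
qed

text \<open>Injectivity belongs to \<open>is_chu\<close>, so the bijection reduces to an equality of
  two sets of forms.\<close>

lemma dual_topology_iff:
  fixes P :: "('k::real_or_complex, 'v::ab_group_add, 'w::ab_group_add) chu"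
  assumes "is_chu P"
  shows "dual_topology P T \<longleftrightarrow> hausdorff_lc_topology (chu_left P) T \<and>
    right_to_dual P ` carr (chu_right P) = cont_forms (chu_left P) T"
  using assms is_chuD(4)[OF assms] by (auto simp: dual_topology_def bij_betw_def)

definition pairing_seminorms :: "('k::real_or_complex, 'v::ab_group_add, 'w::ab_group_add) chu \<Rightarrow> ('v \<Rightarrow> real) set" where
  "pairing_seminorms P = (\<lambda>w v. norm (right_to_dual P w v)) ` carr (chu_right P)"

lemma coarser_antisym: "coarser S T \<Longrightarrow> coarser T S \<Longrightarrow> S = T"
  by (auto simp: coarser_def topology_eq)

lemma the_weakest_such: "weakest_such Q T \<Longrightarrow> (THE T. weakest_such Q T) = T"
  by (rule the_equality) (auto simp: weakest_such_def intro: coarser_antisym)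

lemma the_strongest_such: "strongest_such Q T \<Longrightarrow> (THE T. strongest_such Q T) = T"
  by (rule the_equality) (auto simp: strongest_such_def intro: coarser_antisym)

text \<open>A form bounded by a multiple of one generator is a multiple of some
  \<open>right_to_dual P w\<close>, so no form outside the pair becomes continuous. The generators
  are continuous for every dual topology, which gives minimality.\<close>

lemma weakest_dual_topology:
  fixes P :: "('k::real_or_complex, 'v::ab_group_add, 'w::ab_group_add) chu"
  assumes P: "is_chu P"
  shows "weakest_such (dual_topology P) (kvs.seminorm_topology (chu_left P)
    (kvs.seminorm_sums (pairing_seminorms P)))"
proof -
  interpret kvs "chu_left P" by (rule is_chuD(1)[OF P])
  let ?S = "pairing_seminorms P"
  let ?T = "seminorm_topology (seminorm_sums ?S)"
  note lin = right_to_dual_lin_maps[OF P]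
  have sn: "seminorm_on p" if "p \<in> ?S" for p
    using that seminorm_on_norm[OF lin] by (auto simp: pairing_seminorms_def)
  note fam = seminorm_family_sums[OF sn]
  have lc: "hausdorff_lc_topology (chu_left P) ?T"
  proof (rule hausdorff_lc_seminorm_topology[OF fam])
    fix x assume x: "x \<in> carr (chu_left P)" "x \<noteq> 0"
    obtain w where "w \<in> carr (chu_right P)" "pairing P x w \<noteq> 0"
    proof -
      have "pairing P 0 w = 0" if "w \<in> carr (chu_right P)" for w
        using is_chuD(8)[OF P, of 0 w 0] that by simp
      then show ?thesis using is_chu_left_eqI[OF P x(1), of 0] x(2) that by auto
    qed
    then show "\<exists>p\<in>seminorm_sums ?S. p x \<noteq> 0"
      using x by (intro bexI[of _ "\<lambda>v. norm (right_to_dual P w v)"] seminorm_sums.base)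
        (auto simp: pairing_seminorms_def right_to_dual_def)
  qed
  have sub: "cont_forms (chu_left P) ?T \<subseteq> right_to_dual P ` carr (chu_right P)"
  proof (rule cont_forms_sums_subset[OF sn])
    fix p C f assume p: "p \<in> ?S" and f: "f \<in> lin_maps (chu_left P) ground"
      and le: "\<And>x. x \<in> carr (chu_left P) \<Longrightarrow> norm (f x) \<le> C * p x"
    obtain w where w: "w \<in> carr (chu_right P)" "p = (\<lambda>v. norm (right_to_dual P w v))"
      using p by (auto simp: pairing_seminorms_def)
    obtain c where "f = functional_scal c (right_to_dual P w)"
      using proportional_if_bounded[OF f lin[OF w(1)], of C] le w(2) by blast
    then show "f \<in> right_to_dual P ` carr (chu_right P)"
      using right_to_dual_range_closed(3)[OF P] w(1) by blast
  qed (use right_to_dual_range_closed[OF P] in auto)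
  have cont: "right_to_dual P w \<in> cont_forms (chu_left P) ?T" if w: "w \<in> carr (chu_right P)" for w
  proof (rule cont_forms_if_bounded[OF lc lin[OF w], of "\<lambda>v. norm (right_to_dual P w v)" 1])
    have p: "(\<lambda>v. norm (right_to_dual P w v)) \<in> seminorm_sums ?S" (is "?p \<in> _")
      using w by (auto simp: pairing_seminorms_def intro: seminorm_sums.base)
    then have "openin ?T (sball ?p 0 1)" "0 \<in> sball ?p 0 1" "seminorm_on ?p"
      using openin_sball[OF fam p, of 0 1] centre_in_sball[of ?p 0 1] seminorm_on_norm[OF lin[OF w]]
      by auto
    then show "?p \<in> cont_seminorms ?T"
      by (auto simp: cont_seminorms_def sball_def intro!: exI[of _ "sball ?p 0 1"])
  qed simp
  show ?thesis
    unfolding weakest_such_def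
  proof (intro conjI allI impI)
    show "dual_topology P ?T"
      unfolding dual_topology_iff[OF P] using lc sub cont by blast
    fix T' assume T': "dual_topology P T'"
    then have T'lc: "hausdorff_lc_topology (chu_left P) T'"
      and eq: "right_to_dual P ` carr (chu_right P) = cont_forms (chu_left P) T'"
      by (auto simp: dual_topology_iff[OF P])
    have "?S \<subseteq> cont_seminorms T'"
      unfolding pairing_seminorms_def using cont_seminorms_norm[OF T'lc] eq by auto
    then show "coarser ?T T'"
      by (intro coarser_seminorm_topology[OF T'lc] cont_seminorms_sums[OF T'lc] fam)
  qed
qed

lemma weakest_sigma_topology: "is_chu P \<Longrightarrow> weakest_such (dual_topology P) (sigma_topology P)"
  for P :: "('k::real_or_complex, 'v::ab_group_add, 'w::ab_group_add) chu"
  unfolding sigma_topology_def using the_weakest_such[OF weakest_dual_topology] weakest_dual_topology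
  by metis

text \<open>A form bounded by a generator is continuous for the dual topology that the generator
  comes from, hence is represented by the pair. Every dual topology is recovered from its continuous
  seminorms, which gives maximality.\<close>

lemma strongest_dual_topology:
  fixes P :: "('k::real_or_complex, 'v::ab_group_add, 'w::ab_group_add) chu"
  assumes P: "is_chu P"
  shows "strongest_such (dual_topology P) (kvs.seminorm_topology (chu_left P)
    (kvs.seminorm_sums (\<Union>T\<in>Collect (dual_topology P). kvs.cont_seminorms (chu_left P) T)))"
proof -
  interpret kvs "chu_left P" by (rule is_chuD(1)[OF P])
  let ?S = "\<Union>T\<in>Collect (dual_topology P). cont_seminorms T"
  let ?T = "seminorm_topology (seminorm_sums ?S)"
  have sn: "seminorm_on p" if "p \<in> ?S" for p
    using that by (auto simp: cont_seminorms_def)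
  note fam = seminorm_family_sums[OF sn]
  \<comment> \<open>The generating set is a union over dual topologies, so one of them must be at
    hand: its forms make \<open>?T\<close> Hausdorff and show that all forms of the pair are
    continuous.\<close>
  define T0 where "T0 = sigma_topology P"
  have T0: "dual_topology P T0"
    using weakest_sigma_topology[OF P] by (simp add: weakest_such_def T0_def)
  then have T0lc: "hausdorff_lc_topology (chu_left P) T0"
    and T0eq: "right_to_dual P ` carr (chu_right P) = cont_forms (chu_left P) T0"
    by (auto simp: dual_topology_iff[OF P])
  have norm_S: "(\<lambda>v. norm (f v)) \<in> ?S" if "f \<in> cont_forms (chu_left P) T0" for f
    using cont_seminorms_norm[OF T0lc that] T0 by blast
  have lc: "hausdorff_lc_topology (chu_left P) ?T"
  proof (rule hausdorff_lc_seminorm_topology[OF fam])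
    fix x assume x: "x \<in> carr (chu_left P)" "x \<noteq> 0"
    obtain f where "f \<in> cont_forms (chu_left P) T0" "f x \<noteq> 0"
      using cont_forms_separate[OF T0lc x] .
    then show "\<exists>p\<in>seminorm_sums ?S. p x \<noteq> 0"
      using norm_S by (intro bexI[of _ "\<lambda>v. norm (f v)"] seminorm_sums.base) auto
  qed
  have sub: "cont_forms (chu_left P) ?T \<subseteq> right_to_dual P ` carr (chu_right P)"
  proof (rule cont_forms_sums_subset[OF sn])
    fix p C f assume p: "p \<in> ?S" and f: "f \<in> lin_maps (chu_left P) ground"
      and le: "\<And>x. x \<in> carr (chu_left P) \<Longrightarrow> norm (f x) \<le> C * p x"
    obtain T where T: "dual_topology P T" "p \<in> cont_seminorms T" using p by blast
    then have "hausdorff_lc_topology (chu_left P) T"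
      and "right_to_dual P ` carr (chu_right P) = cont_forms (chu_left P) T"
      by (auto simp: dual_topology_iff[OF P])
    then show "f \<in> right_to_dual P ` carr (chu_right P)"
      using cont_forms_if_bounded[OF _ f T(2)] le by blast
  qed (use right_to_dual_range_closed[OF P] in auto)
  have cont: "f \<in> cont_forms (chu_left P) ?T" if f: "f \<in> cont_forms (chu_left P) T0" for f
  proof -
    have lin: "f \<in> lin_maps (chu_left P) ground" using f by (simp add: cont_forms_def)
    show ?thesis
    proof (rule cont_forms_if_bounded[OF lc lin, of "\<lambda>v. norm (f v)" 1])
      have p: "(\<lambda>v. norm (f v)) \<in> seminorm_sums ?S" (is "?p \<in> _")
        using norm_S[OF f] by (rule seminorm_sums.base)
      then have "openin ?T (sball ?p 0 1)" "0 \<in> sball ?p 0 1" "seminorm_on ?p"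
        using openin_sball[OF fam p, of 0 1] centre_in_sball[of ?p 0 1] seminorm_on_norm[OF lin]
        by auto
      then show "?p \<in> cont_seminorms ?T"
        by (auto simp: cont_seminorms_def sball_def intro!: exI[of _ "sball ?p 0 1"])
    qed simp
  qed
  show ?thesis
    unfolding strongest_such_def
  proof (intro conjI allI impI)
    have "right_to_dual P ` carr (chu_right P) \<subseteq> cont_forms (chu_left P) ?T"
      unfolding T0eq by (rule subsetI) (rule cont)
    with lc sub show "dual_topology P ?T"
      by (simp only: dual_topology_iff[OF P] set_eq_subset simp_thms)
    fix T' assume T': "dual_topology P T'"
    then have T'lc: "hausdorff_lc_topology (chu_left P) T'"
      by (auto simp: dual_topology_iff[OF P])
    show "coarser T' ?T"
      using T' by (intro coarser_than_seminorm_topology[OF T'lc] fam) (auto intro: seminorm_sums.base)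
  qed
qed

lemma strongest_tau_topology: "is_chu P \<Longrightarrow> strongest_such (dual_topology P) (tau_topology P)"
  for P :: "('k::real_or_complex, 'v::ab_group_add, 'w::ab_group_add) chu"
  unfolding tau_topology_def using the_strongest_such[OF strongest_dual_topology] strongest_dual_topology
  by metis


section \<open>The pair of a locally convex space and its dual\<close>

lemma is_tvsD:
  "is_tvs V \<Longrightarrow> kvs (underlying V)" "is_tvs V \<Longrightarrow> hausdorff_lc_topology (underlying V) (topo V)"
  by (simp_all add: is_tvs_def kvs_def)

lemma is_kspace_top_dual:
  fixes V :: "('k::real_or_complex, 'v::ab_group_add) tvs"
  assumes V: "is_tvs V" shows "is_kspace (top_dual V)"
proof -
  interpret F: vector_space "functional_scal :: 'k \<Rightarrow> ('v \<Rightarrow> 'k) \<Rightarrow> 'v \<Rightarrow> 'k"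
    by (rule vector_space_functional_scal)
  interpret kvs "underlying V" by (rule is_tvsD(1)[OF V])
  show ?thesis
    using F.vector_space_axioms cont_forms_closed[OF is_tvsD(2)[OF V]]
    by (auto simp: is_kspace_def top_dual_def intro!: F.subspaceI)
qed

text \<open>Points are separated by continuous forms, by Hahn-Banach; forms are determined by their
  values on the carrier since they vanish elsewhere.\<close>

lemma is_chu_to_chu:
  fixes V :: "('k::real_or_complex, 'v::ab_group_add) tvs"
  assumes V: "is_tvs V" shows "is_chu (to_chu V)"
proof -
  interpret kvs "underlying V" by (rule is_tvsD(1)[OF V])
  have lin: "f \<in> lin_maps (underlying V) ground" if "f \<in> carr (top_dual V)" for f
    using that by (simp add: top_dual_def cont_forms_def)
  have "inj_on (left_to_dual (to_chu V)) (carr (underlying V))"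
  proof (rule inj_onI, rule ccontr)
    fix x y assume xy: "x \<in> carr (underlying V)" "y \<in> carr (underlying V)" "x \<noteq> y"
      and eq: "left_to_dual (to_chu V) x = left_to_dual (to_chu V) y"
    obtain f where f: "f \<in> cont_forms (underlying V) (topo V)" "f (x - y) \<noteq> 0"
      using cont_forms_separate[OF is_tvsD(2)[OF V], of "x - y"] xy by auto
    then have "f \<in> carr (top_dual V)" by (simp add: top_dual_def)
    moreover have "f x = f y"
      using fun_cong[OF eq, of f] \<open>f \<in> carr (top_dual V)\<close> by (simp add: left_to_dual_def to_chu_def)
    ultimately show False using f(2) lin_mapsD(5)[OF lin, of f x y] xy by simp
  qed
  moreover have "right_to_dual (to_chu V) f = f" if "f \<in> carr (top_dual V)" for f
    using lin_mapsD(3)[OF lin[OF that]] by (auto simp: right_to_dual_def to_chu_def)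
  then have "inj_on (right_to_dual (to_chu V)) (carr (top_dual V))"
    by (metis inj_onI)
  moreover have "bilinear_betw (underlying V) (top_dual V) ground (\<lambda>v f. f v)"
    using lin_mapsD[OF lin]
    by (auto simp: bilinear_betw_def linear_betw_def ground_def) (simp_all add: top_dual_def functional_scal_def)
  ultimately show ?thesis
    using is_kspace is_kspace_top_dual[OF V] by (simp add: is_chu_def to_chu_def)
qed


section \<open>Transport along linear isomorphisms\<close>

text \<open>The cut-off keeps composites inside \<open>lin_maps\<close>. With \<open>id\<close> for
  \<open>f\<close> it cuts off the map \<open>\<kappa>\<close> itself, which is how inverse
  isomorphisms are formed.\<close>

definition precompose :: "'v set \<Rightarrow> ('v \<Rightarrow> 'w) \<Rightarrow> ('w \<Rightarrow> 'k) \<Rightarrow> 'v \<Rightarrow> 'k::zero" where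
  "precompose A \<kappa> f = (\<lambda>x. if x \<in> A then f (\<kappa> x) else 0)"

locale kspace_iso = V1: kvs V1 + V2: kvs V2
  for V1 :: "('k::real_or_complex, 'v::ab_group_add) kspace"
    and V2 :: "('k, 'w::ab_group_add) kspace" +
  fixes \<kappa> :: "'v \<Rightarrow> 'w"
  assumes lin: "\<kappa> \<in> lin_maps V1 V2" and bij: "bij_betw \<kappa> (carr V1) (carr V2)"
begin

lemma kappa_simps:
  "x \<in> carr V1 \<Longrightarrow> y \<in> carr V1 \<Longrightarrow> \<kappa> (x + y) = \<kappa> x + \<kappa> y"
  "x \<in> carr V1 \<Longrightarrow> \<kappa> (scal V1 c x) = scal V2 c (\<kappa> x)"
  "x \<in> carr V1 \<Longrightarrow> \<kappa> x \<in> carr V2"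
  using lin by (auto simp: lin_maps_def linear_betw_def)

text \<open>Continuity into the pullback is tested after applying \<open>\<kappa>\<close>, which
  turns the operations into those of \<open>V2\<close>; convex neighbourhoods are obtained as
  preimages.\<close>

lemma hausdorff_lc_pullback:
  assumes T: "hausdorff_lc_topology V2 T"
  shows "hausdorff_lc_topology V1 (pullback_topology (carr V1) \<kappa> T)" (is "hausdorff_lc_topology V1 ?T")
proof -
  note topT = V2.topspace_lc[OF T]
  have top: "topspace ?T = carr V1"
    using kappa_simps(3) by (auto simp: topspace_pullback_topology topT)
  have k: "continuous_map ?T T \<kappa>"
    using continuous_map_pullback[of T T id "carr V1" \<kappa>] by simp
  have inj: "inj_on \<kappa> (carr V1)" using bij by (simp add: bij_betw_def)
  have \<kappa>0: "\<kappa> 0 = 0" using kappa_simps(2)[of 0 0] by simp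
  show ?thesis
    unfolding hausdorff_lc_topology_def
  proof (intro conjI)
    show "Hausdorff_space ?T"
      using T Hausdorff_space_injective_preimage[of T ?T \<kappa>] k inj top
      by (simp add: hausdorff_lc_topology_def)
    show "continuous_map (prod_topology ?T ?T) ?T (\<lambda>(x, y). x + y)"
    proof (rule continuous_map_pullback')
      have "continuous_map (prod_topology ?T ?T) (prod_topology T T) (\<lambda>z. (\<kappa> (fst z), \<kappa> (snd z)))"
        using continuous_map_compose[OF continuous_map_fst k] continuous_map_compose[OF continuous_map_snd k]
        by (intro continuous_map_pairedI) (auto simp: o_def)
      from continuous_map_compose[OF this, of T "\<lambda>(x, y). x + y"]
      have "continuous_map (prod_topology ?T ?T) T (\<lambda>z. \<kappa> (fst z) + \<kappa> (snd z))"
        using T by (simp add: hausdorff_lc_topology_def o_def)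
      then show "continuous_map (prod_topology ?T ?T) T (\<kappa> \<circ> (\<lambda>(x, y). x + y))"
        by (rule continuous_map_eq) (auto simp: top kappa_simps)
    qed (auto simp: top)
    show "continuous_map (prod_topology euclidean ?T) ?T (\<lambda>(c, x). scal V1 c x)"
    proof (rule continuous_map_pullback')
      have "continuous_map (prod_topology euclidean ?T) (prod_topology euclidean T) (\<lambda>z. (fst z, \<kappa> (snd z)))"
        using continuous_map_fst continuous_map_compose[OF continuous_map_snd k]
        by (intro continuous_map_pairedI) (auto simp: o_def)
      from continuous_map_compose[OF this, of T "\<lambda>(c, x). scal V2 c x"]
      have "continuous_map (prod_topology euclidean ?T) T (\<lambda>z. scal V2 (fst z) (\<kappa> (snd z)))"
        using T by (simp add: hausdorff_lc_topology_def o_def)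
      then show "continuous_map (prod_topology euclidean ?T) T (\<kappa> \<circ> (\<lambda>(c, x). scal V1 c x))"
        by (rule continuous_map_eq) (auto simp: top kappa_simps)
    qed (auto simp: top)
    show "neighbourhood_base_at 0 (convex_subset V1) ?T"
      unfolding neighbourhood_base_at_def
    proof (intro allI impI)
      fix W assume "openin ?T W \<and> 0 \<in> W"
      then obtain U where U: "openin T U" "W = \<kappa> -` U \<inter> carr V1" "0 \<in> W"
        by (auto simp: openin_pullback_topology)
      then have "0 \<in> U" using \<kappa>0 by auto
      moreover have "neighbourhood_base_at 0 (convex_subset V2) T"
        using T by (simp add: hausdorff_lc_topology_def)
      ultimately have "\<exists>O1 C. openin T O1 \<and> convex_subset V2 C \<and> 0 \<in> O1 \<and> O1 \<subseteq> C \<and> C \<subseteq> U"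
        using U(1) by (simp add: neighbourhood_base_at_def)
      then obtain O1 C where C: "openin T O1" "convex_subset V2 C" "0 \<in> O1" "O1 \<subseteq> C" "C \<subseteq> U"
        by (elim exE conjE)
      have "convex_subset V1 (\<kappa> -` C \<inter> carr V1)"
        using C(2) unfolding convex_subset_def by (auto simp: kappa_simps)
      moreover have "openin ?T (\<kappa> -` O1 \<inter> carr V1)"
        using C(1) by (auto simp: openin_pullback_topology)
      ultimately show "\<exists>O2 D. openin ?T O2 \<and> convex_subset V1 D \<and> 0 \<in> O2 \<and> O2 \<subseteq> D \<and> D \<subseteq> W"
        using C U \<kappa>0
        by (intro exI[of _ "\<kappa> -` O1 \<inter> carr V1"] exI[of _ "\<kappa> -` C \<inter> carr V1"]) auto
    qed
  qed (rule top)
qed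

lemma inverse_iso: "kspace_iso V2 V1 (precompose (carr V2) (inv_into (carr V1) \<kappa>) id)"
proof -
  let ?i = "inv_into (carr V1) \<kappa>"
  have i: "?i y \<in> carr V1" "\<kappa> (?i y) = y" if "y \<in> carr V2" for y
    using bij that by (metis bij_betw_def inv_into_into, metis bij_betw_inv_into_right)
  have ii: "?i (\<kappa> x) = x" if "x \<in> carr V1" for x
    using bij that by (rule bij_betw_inv_into_left)
  have "precompose (carr V2) ?i id \<in> lin_maps V2 V1"
  proof -
    have "?i (x + y) = ?i x + ?i y" if "x \<in> carr V2" "y \<in> carr V2" for x y
      using ii[of "?i x + ?i y"] i that by (simp add: kappa_simps)
    moreover have "?i (scal V2 c x) = scal V1 c (?i x)" if "x \<in> carr V2" for c x
      using ii[of "scal V1 c (?i x)"] i that by (simp add: kappa_simps)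
    ultimately show ?thesis
      using i by (auto simp: lin_maps_def linear_betw_def precompose_def)
  qed
  moreover have "bij_betw (precompose (carr V2) ?i id) (carr V2) (carr V1)"
    using bij_betw_cong[of "carr V2" "precompose (carr V2) ?i id" ?i "carr V1"] bij_betw_inv_into[OF bij]
    by (simp add: precompose_def)
  ultimately show ?thesis
    by (simp add: kspace_iso_def kspace_iso_axioms_def V1.kvs_axioms V2.kvs_axioms)
qed

lemma cont_forms_pullback_subset:
  assumes T: "hausdorff_lc_topology V2 T" and f: "f \<in> cont_forms V2 T"
  shows "precompose (carr V1) \<kappa> f \<in> cont_forms V1 (pullback_topology (carr V1) \<kappa> T)"
proof -
  have lin: "f \<in> lin_maps V2 ground" and cont: "continuous_map T euclidean f"
    using f by (auto simp: cont_forms_def)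
  have "precompose (carr V1) \<kappa> f \<in> lin_maps V1 ground"
    by (rule V1.lin_mapsI) (auto simp: precompose_def kappa_simps V2.lin_mapsD[OF lin])
  moreover have "continuous_map (pullback_topology (carr V1) \<kappa> T) euclidean (precompose (carr V1) \<kappa> f)"
    by (rule continuous_map_eq[OF continuous_map_pullback[OF cont]])
      (auto simp: topspace_pullback_topology precompose_def)
  ultimately show ?thesis by (simp add: cont_forms_def)
qed

text \<open>The round trip turns an open \<open>U\<close> into \<open>U \<inter> carr V1\<close>,
  hence the condition on \<open>topspace T\<close>.\<close>

lemma pullback_inverse:
  assumes "topspace T \<subseteq> carr V1"
  shows "pullback_topology (carr V1) \<kappa>
    (pullback_topology (carr V2) (precompose (carr V2) (inv_into (carr V1) \<kappa>) id) T) = T"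
proof -
  let ?i = "precompose (carr V2) (inv_into (carr V1) \<kappa>) id"
  have "\<kappa> -` (?i -` U \<inter> carr V2) \<inter> carr V1 = U" if "openin T U" for U
    using openin_subset[OF that] assms bij_betw_inv_into_left[OF bij] kappa_simps(3)
    by (auto simp: precompose_def)
  then show ?thesis
    unfolding topology_eq openin_pullback_topology by metis
qed

text \<open>One inclusion is composition with \<open>\<kappa>\<close>. The other is the same
  inclusion for the inverse isomorphism, whose pullback undoes this one.\<close>

lemma cont_forms_pullback:
  assumes T: "hausdorff_lc_topology V2 T"
  shows "cont_forms V1 (pullback_topology (carr V1) \<kappa> T) = precompose (carr V1) \<kappa> ` cont_forms V2 T"
proof -
  let ?T = "pullback_topology (carr V1) \<kappa> T"
  let ?i = "precompose (carr V2) (inv_into (carr V1) \<kappa>) id"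
  interpret I: kspace_iso V2 V1 ?i by (rule inverse_iso)
  have eq: "pullback_topology (carr V2) ?i ?T = T"
  proof -
    have "?i -` (\<kappa> -` U \<inter> carr V1) \<inter> carr V2 = U" if "openin T U" for U
      using openin_subset[OF that] V2.topspace_lc[OF T] bij_betw_inv_into_right[OF bij]
        bij_betwE[OF bij_betw_inv_into[OF bij]]
      by (auto simp: precompose_def)
    then show ?thesis
      unfolding topology_eq openin_pullback_topology by metis
  qed
  have "f \<in> precompose (carr V1) \<kappa> ` cont_forms V2 T" if f: "f \<in> cont_forms V1 ?T" for f
  proof (rule image_eqI)
    show "precompose (carr V2) ?i f \<in> cont_forms V2 T"
      using I.cont_forms_pullback_subset[OF hausdorff_lc_pullback[OF T] f] by (simp only: eq)
    have "f \<in> lin_maps V1 ground" using f by (simp add: cont_forms_def)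
    then show "f = precompose (carr V1) \<kappa> (precompose (carr V2) ?i f)"
      using V1.lin_mapsD(3) bij_betw_inv_into_left[OF bij] kappa_simps(3)
      by (auto simp: precompose_def fun_eq_iff)
  qed
  then show ?thesis using cont_forms_pullback_subset[OF T] by blast
qed

end

lemma coarser_pullback:
  "coarser S T \<Longrightarrow> coarser (pullback_topology A f S) (pullback_topology A f T)"
  by (auto simp: coarser_def topspace_pullback_topology openin_pullback_topology)

text \<open>An isomorphism of pairs given by its left component alone: on the right it is enough
  that the sets of represented forms correspond, since \<open>dual_topology_iff\<close> refers only
  to these.\<close>

locale chu_iso = kspace_iso "chu_left P" "chu_left Q" \<kappa>
  for P :: "('k::real_or_complex, 'v1::ab_group_add, 'w1::ab_group_add) chu"
    and Q :: "('k, 'v2::ab_group_add, 'w2::ab_group_add) chu"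
    and \<kappa> +
  assumes P: "is_chu P" and Q: "is_chu Q"
    and duals: "right_to_dual P ` carr (chu_right P) =
      precompose (carr (chu_left P)) \<kappa> ` right_to_dual Q ` carr (chu_right Q)"
begin

lemma dual_topology_pullback:
  "dual_topology Q T \<Longrightarrow> dual_topology P (pullback_topology (carr (chu_left P)) \<kappa> T)"
  unfolding dual_topology_iff[OF P] dual_topology_iff[OF Q] duals
  using cont_forms_pullback hausdorff_lc_pullback by metis

text \<open>Extremality compares with every dual topology of \<open>P\<close>, so each of them has
  to be recognised as a pullback from \<open>Q\<close>.\<close>

lemma dual_topology_pullback_inverse:
  assumes T: "dual_topology P T"
  obtains T' where "dual_topology Q T'" "T = pullback_topology (carr (chu_left P)) \<kappa> T'"
proof
  let ?i = "precompose (carr (chu_left Q)) (inv_into (carr (chu_left P)) \<kappa>) id"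
  interpret I: kspace_iso "chu_left Q" "chu_left P" ?i by (rule inverse_iso)
  have Tlc: "hausdorff_lc_topology (chu_left P) T"
    and Teq: "right_to_dual P ` carr (chu_right P) = cont_forms (chu_left P) T"
    using T by (simp_all add: dual_topology_iff[OF P])
  have "precompose (carr (chu_left Q)) ?i (precompose (carr (chu_left P)) \<kappa> f) = f"
    if "f \<in> right_to_dual Q ` carr (chu_right Q)" for f
    using that bij_betw_inv_into_right[OF bij] bij_betwE[OF bij_betw_inv_into[OF bij]]
    by (auto simp: precompose_def right_to_dual_def fun_eq_iff)
  then have "precompose (carr (chu_left Q)) ?i ` cont_forms (chu_left P) T = right_to_dual Q ` carr (chu_right Q)"
    unfolding Teq[symmetric] duals image_image by force
  then show "dual_topology Q (pullback_topology (carr (chu_left Q)) ?i T)"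
    unfolding dual_topology_iff[OF Q]
    using I.hausdorff_lc_pullback[OF Tlc] I.cont_forms_pullback[OF Tlc] by simp
  show "T = pullback_topology (carr (chu_left P)) \<kappa> (pullback_topology (carr (chu_left Q)) ?i T)"
    using pullback_inverse V1.topspace_lc[OF Tlc] by simp
qed

lemma weakest_pullback:
  "weakest_such (dual_topology Q) T \<Longrightarrow>
    weakest_such (dual_topology P) (pullback_topology (carr (chu_left P)) \<kappa> T)"
  unfolding weakest_such_def
  using dual_topology_pullback dual_topology_pullback_inverse coarser_pullback by metis

lemma strongest_pullback:
  "strongest_such (dual_topology Q) T \<Longrightarrow>
    strongest_such (dual_topology P) (pullback_topology (carr (chu_left P)) \<kappa> T)"
  unfolding strongest_such_def
  using dual_topology_pullback dual_topology_pullback_inverse coarser_pullback by metis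

end

section \<open>Evaluation and separation in the tensor product\<close>

context kvs
begin

lemma lin_maps_sum:
  assumes f: "f \<in> lin_maps V ground" and x: "\<And>e. e \<in> F \<Longrightarrow> x e \<in> carr V"
  shows "f (sum x F) = (\<Sum>e\<in>F. f (x e))"
proof -
  have "sum x F \<in> carr V \<and> f (sum x F) = (\<Sum>e\<in>F. f (x e))"
    using x by (induction F rule: infinite_finite_induct) (auto simp: lin_mapsD[OF f])
  then show ?thesis ..
qed

end

text \<open>Tensors are functionals that carry information only on forms vanishing outside the
  carriers, so a bilinear form is cut off before a tensor is applied to it.\<close>

definition bilin_restrict ::
  "('k::field, 'v::ab_group_add) kspace \<Rightarrow> ('k, 'w::ab_group_add) kspace \<Rightarrow> ('v \<Rightarrow> 'w \<Rightarrow> 'k) \<Rightarrow> 'v \<Rightarrow> 'w \<Rightarrow> 'k" where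
  "bilin_restrict V W b = (\<lambda>v w. if v \<in> carr V \<and> w \<in> carr W then b v w else 0)"

lemma functional_scal_apply: "functional_scal c f x = c * f x"
  by (simp add: functional_scal_def)

lemma scal_tensor: "scal (tensor V W) = functional_scal"
  by (simp add: tensor_def)

lemma tensor_lift_cong:
  "(\<And>v w. v \<in> carr V \<Longrightarrow> w \<in> carr W \<Longrightarrow> b v w = b' v w) \<Longrightarrow> tensor_lift V W X b = tensor_lift V W X b'"
  by (simp add: tensor_lift_def cong: ball_cong)

locale kvs_pair = V: kvs V + W: kvs W
  for V :: "('k::real_or_complex, 'v::ab_group_add) kspace"
    and W :: "('k, 'w::ab_group_add) kspace"
begin

sublocale F: vector_space "functional_scal :: 'k \<Rightarrow> (('v \<Rightarrow> 'w \<Rightarrow> 'k) \<Rightarrow> 'k) \<Rightarrow> _"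
  by (rule vector_space_functional_scal)

sublocale T: kvs "tensor V W"
  by unfold_locales (rule is_kspace_tensor)

lemma pure_tensor_simps:
  "v \<in> carr V \<Longrightarrow> w \<in> carr W \<Longrightarrow> pure_tensor V W v w \<in> carr (tensor V W)"
  "v \<in> carr V \<Longrightarrow> v' \<in> carr V \<Longrightarrow> w \<in> carr W \<Longrightarrow>
    pure_tensor V W (v + v') w = pure_tensor V W v w + pure_tensor V W v' w"
  "v \<in> carr V \<Longrightarrow> w \<in> carr W \<Longrightarrow> w' \<in> carr W \<Longrightarrow>
    pure_tensor V W v (w + w') = pure_tensor V W v w + pure_tensor V W v w'"
  "v \<in> carr V \<Longrightarrow> w \<in> carr W \<Longrightarrow> pure_tensor V W (scal V c v) w = functional_scal c (pure_tensor V W v w)"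
  "v \<in> carr V \<Longrightarrow> w \<in> carr W \<Longrightarrow> pure_tensor V W v (scal W c w) = functional_scal c (pure_tensor V W v w)"
  "w \<in> carr W \<Longrightarrow> pure_tensor V W 0 w = 0" "v \<in> carr V \<Longrightarrow> pure_tensor V W v 0 = 0"
proof -
  show *: "v \<in> carr V \<Longrightarrow> w \<in> carr W \<Longrightarrow> pure_tensor V W v w \<in> carr (tensor V W)"
    "v \<in> carr V \<Longrightarrow> v' \<in> carr V \<Longrightarrow> w \<in> carr W \<Longrightarrow>
      pure_tensor V W (v + v') w = pure_tensor V W v w + pure_tensor V W v' w"
    "v \<in> carr V \<Longrightarrow> w \<in> carr W \<Longrightarrow> w' \<in> carr W \<Longrightarrow>
      pure_tensor V W v (w + w') = pure_tensor V W v w + pure_tensor V W v w'"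
    "v \<in> carr V \<Longrightarrow> w \<in> carr W \<Longrightarrow> pure_tensor V W (scal V c v) w = functional_scal c (pure_tensor V W v w)"
    "v \<in> carr V \<Longrightarrow> w \<in> carr W \<Longrightarrow> pure_tensor V W v (scal W c w) = functional_scal c (pure_tensor V W v w)"
    for v v' w w' c
    using bilinear_pure_tensor[of V W]
    unfolding bilinear_betw_def linear_betw_def image_subset_iff by (simp_all add: tensor_def)
  show "w \<in> carr W \<Longrightarrow> pure_tensor V W 0 w = 0" using *(2)[of 0 0 w] by simp
  show "v \<in> carr V \<Longrightarrow> pure_tensor V W v 0 = 0" using *(3)[of v 0 0] by simp
qed

lemma tensor_closed:
  "s \<in> carr (tensor V W) \<Longrightarrow> functional_scal c s \<in> carr (tensor V W)"
  using T.carr_closed(3)[of s c] by (simp add: tensor_def)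

lemma tensor_induct [consumes 1, case_names zero plus scale pure]:
  assumes "t \<in> carr (tensor V W)"
    and "P 0"
    and "\<And>s t. s \<in> carr (tensor V W) \<Longrightarrow> t \<in> carr (tensor V W) \<Longrightarrow> P s \<Longrightarrow> P t \<Longrightarrow> P (s + t)"
    and "\<And>c t. t \<in> carr (tensor V W) \<Longrightarrow> P t \<Longrightarrow> P (functional_scal c t)"
    and "\<And>v w. v \<in> carr V \<Longrightarrow> w \<in> carr W \<Longrightarrow> P (pure_tensor V W v w)"
  shows "P t"
proof -
  have "t \<in> F.span {pure_tensor V W v w | v w. v \<in> carr V \<and> w \<in> carr W}"
    using assms(1) by (simp add: tensor_def)
  then have "t \<in> carr (tensor V W) \<and> P t"
  proof (induction rule: F.span_induct)
    case base
    show ?case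
      using assms(2-4) tensor_closed by (auto intro!: F.subspaceI)
  next
    case (step t)
    then show ?case using assms(5) pure_tensor_simps(1) by auto
  qed
  then show ?thesis ..
qed

lemma bilin_mapsD:
  assumes "b \<in> bilin_maps V W ground"
  shows "v \<in> carr V \<Longrightarrow> v' \<in> carr V \<Longrightarrow> w \<in> carr W \<Longrightarrow> b (v + v') w = b v w + b v' w"
    "v \<in> carr V \<Longrightarrow> w \<in> carr W \<Longrightarrow> w' \<in> carr W \<Longrightarrow> b v (w + w') = b v w + b v w'"
    "v \<in> carr V \<Longrightarrow> w \<in> carr W \<Longrightarrow> b (scal V c v) w = c * b v w"
    "v \<in> carr V \<Longrightarrow> w \<in> carr W \<Longrightarrow> b v (scal W c w) = c * b v w"
    "v \<notin> carr V \<or> w \<notin> carr W \<Longrightarrow> b v w = 0"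
  using assms by (auto simp: bilin_maps_def bilinear_betw_def linear_betw_def ground_def)

lemma bilin_mapsI:
  assumes "\<And>v v' w. v \<in> carr V \<Longrightarrow> v' \<in> carr V \<Longrightarrow> w \<in> carr W \<Longrightarrow> b (v + v') w = b v w + b v' w"
    "\<And>v w w'. v \<in> carr V \<Longrightarrow> w \<in> carr W \<Longrightarrow> w' \<in> carr W \<Longrightarrow> b v (w + w') = b v w + b v w'"
    "\<And>v w c. v \<in> carr V \<Longrightarrow> w \<in> carr W \<Longrightarrow> b (scal V c v) w = c * b v w"
    "\<And>v w c. v \<in> carr V \<Longrightarrow> w \<in> carr W \<Longrightarrow> b v (scal W c w) = c * b v w"
    "\<And>v w. v \<notin> carr V \<or> w \<notin> carr W \<Longrightarrow> b v w = 0"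
  shows "b \<in> bilin_maps V W ground"
  using assms by (auto simp: bilin_maps_def bilinear_betw_def linear_betw_def ground_def)

lemma bilin_maps_bilinear: "b \<in> bilin_maps V W ground \<Longrightarrow> bilinear_betw V W ground b"
  by (simp add: bilin_maps_def)

lemma bilin_maps_restrict:
  assumes b: "bilinear_betw V W ground b" shows "bilin_restrict V W b \<in> bilin_maps V W ground"
  using b by (intro bilin_mapsI)
    (auto simp: bilin_restrict_def bilinear_betw_def linear_betw_def ground_def)

lemma is_kspace_ground: "is_kspace (ground :: ('k, 'k) kspace)"
  using vector_space_ground[where 'k = 'k]
  by (simp add: is_kspace_def ground_def module.subspace_UNIV vector_space_def module_def)

lemma pure_tensor_apply: "b \<in> bilin_maps V W ground \<Longrightarrow> pure_tensor V W v w b = b v w"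
  by (simp add: pure_tensor_def)

text \<open>Tensors are themselves functionals on bilinear forms, so evaluation at \<open>b\<close>
  is linear with the right values on elementary tensors; uniqueness identifies it with the
  lift.\<close>

lemma tensor_lift_eq:
  assumes b: "b \<in> bilin_maps V W ground"
  shows "tensor_lift V W ground b = (\<lambda>t. if t \<in> carr (tensor V W) then t b else 0)"
  unfolding tensor_lift_def
proof (rule the1_equality[OF tensor_universal[OF V.is_kspace W.is_kspace is_kspace_ground bilin_maps_bilinear[OF b]]],
    intro conjI ballI)
  show "(\<lambda>t. if t \<in> carr (tensor V W) then t b else 0) \<in> lin_maps (tensor V W) ground"
    by (rule T.lin_mapsI) (auto simp: scal_tensor tensor_closed functional_scal_apply)
qed (simp add: pure_tensor_simps pure_tensor_apply[OF b])

lemma tensor_lift_apply: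
  assumes "bilinear_betw V W ground b" "t \<in> carr (tensor V W)"
  shows "tensor_lift V W ground b t = t (bilin_restrict V W b)"
proof -
  have "tensor_lift V W ground b = tensor_lift V W ground (bilin_restrict V W b)"
    by (rule tensor_lift_cong) (simp add: bilin_restrict_def)
  then show ?thesis
    using tensor_lift_eq[OF bilin_maps_restrict[OF assms(1)]] assms(2) by simp
qed

lemma bilin_maps_closed:
  "0 \<in> bilin_maps V W ground"
  "b \<in> bilin_maps V W ground \<Longrightarrow> b' \<in> bilin_maps V W ground \<Longrightarrow> b + b' \<in> bilin_maps V W ground"
  "b \<in> bilin_maps V W ground \<Longrightarrow> (\<lambda>v w. c * b v w) \<in> bilin_maps V W ground"
  by (auto intro!: bilin_mapsI simp: bilin_mapsD algebra_simps)

text \<open>Clear for elementary tensors and preserved by linear combinations; it makes the pairing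
  of tensors with forms bilinear.\<close>

lemma tensor_apply_linear:
  assumes t: "t \<in> carr (tensor V W)" and b: "b \<in> bilin_maps V W ground" and b': "b' \<in> bilin_maps V W ground"
  shows "t (b + b') = t b + t b'" "t (\<lambda>v w. c * b v w) = c * t b"
  using t
  by (induction rule: tensor_induct)
    (auto simp: functional_scal_def algebra_simps pure_tensor_apply b b' bilin_maps_closed)

lemma tensor_basis_expansion:
  assumes B: "B \<subseteq> carr W" "carr W \<subseteq> W.span B" and t: "t \<in> carr (tensor V W)"
  obtains F u where "finite F" "F \<subseteq> B" "\<And>e. u e \<in> carr V" "t = (\<Sum>e\<in>F. pure_tensor V W (u e) e)"
proof -
  \<comment> \<open>\<open>u\<close> vanishes off \<open>F\<close>, so two expansions can be
    extended to the common index set \<open>F \<union> G\<close> and added.\<close>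
  let ?Q = "\<lambda>F u t. finite F \<and> F \<subseteq> B \<and> (\<forall>e. u e \<in> carr V) \<and> (\<forall>e. e \<notin> F \<longrightarrow> u e = 0) \<and>
    t = (\<Sum>e\<in>F. pure_tensor V W (u e) e)"
  define R where "R t \<longleftrightarrow> (\<exists>F u. ?Q F u t)" for t
  have zero: "R 0"
    unfolding R_def by (intro exI[of _ "{}"] exI[of _ "\<lambda>e. 0"]) simp
  have plus: "R (s + t)" if st: "R s" "R t" for s t
  proof -
    obtain F u where F: "?Q F u s" using st(1) unfolding R_def by blast
    obtain G v where G: "?Q G v t" using st(2) unfolding R_def by blast
    have "s = (\<Sum>e\<in>F \<union> G. pure_tensor V W (u e) e)" "t = (\<Sum>e\<in>F \<union> G. pure_tensor V W (v e) e)"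
      using F G B(1) by (auto intro!: sum.mono_neutral_left pure_tensor_simps(6))
    then have "s + t = (\<Sum>e\<in>F \<union> G. pure_tensor V W (u e) e + pure_tensor V W (v e) e)"
      by (simp only: sum.distrib)
    also have "\<dots> = (\<Sum>e\<in>F \<union> G. pure_tensor V W (u e + v e) e)"
      using F G B(1) by (intro sum.cong) (auto simp: pure_tensor_simps(2))
    finally show ?thesis
      using F G unfolding R_def by (intro exI[of _ "F \<union> G"] exI[of _ "\<lambda>e. u e + v e"]) auto
  qed
  have scale: "R (functional_scal c t)" if t: "R t" for c t
  proof -
    obtain F u where F: "?Q F u t" using t unfolding R_def by blast
    then have "functional_scal c t = (\<Sum>e\<in>F. functional_scal c (pure_tensor V W (u e) e))"
      by (simp add: F.scale_sum_right)
    also have "\<dots> = (\<Sum>e\<in>F. pure_tensor V W (scal V c (u e)) e)"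
      using F B(1) by (intro sum.cong) (auto simp: pure_tensor_simps(4))
    finally show ?thesis
      using F unfolding R_def by (intro exI[of _ F] exI[of _ "\<lambda>e. scal V c (u e)"]) auto
  qed
  have "R t" using t
  proof (induction rule: tensor_induct)
    case (pure v w)
    have "w \<in> W.span B" using pure(2) B(2) by blast
    \<comment> \<open>Elementary tensors are additive on the carrier only, so membership is carried
      through the induction.\<close>
    then have "w \<in> carr W \<and> R (pure_tensor V W v w)"
    proof (induction rule: W.span_induct)
      case base
      show ?case
        by (rule W.subspaceI) (use zero plus scale pure(1) in \<open>simp_all only: mem_Collect_eq
          pure_tensor_simps W.carr_closed simp_thms\<close>)
    next
      case (step e)
      have Q: "?Q {e} (\<lambda>e'. if e' = e then v else 0) (pure_tensor V W v e)"
        using step pure(1) by auto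
      have "R (pure_tensor V W v e)" unfolding R_def by (intro exI) (rule Q)
      then show ?case using step B(1) by blast
    qed
    then show ?case ..
  qed (rule zero, erule (1) plus, erule scale)
  then show ?thesis unfolding R_def by (elim exE conjE) (rule that, simp_all)
qed

text \<open>For fixed \<open>\<phi>\<close>, the vector of \<open>W\<close> with basis coordinates
  \<open>\<phi> (u e)\<close> is killed by all \<open>\<psi>\<close> and so is 0; independence gives
  \<open>\<phi> (u e) = 0\<close>, and varying \<open>\<phi>\<close> gives \<open>u e = 0\<close>.
  Arbitrary separating sets are allowed because both the internal hom and the separately continuous
  forms need it.\<close>

lemma tensor_separation:
  assumes \<Phi>: "\<Phi> \<subseteq> lin_maps V ground" and \<Phi>_sep: "\<And>v. v \<in> carr V \<Longrightarrow> (\<And>\<phi>. \<phi> \<in> \<Phi> \<Longrightarrow> \<phi> v = 0) \<Longrightarrow> v = 0"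
    and \<Psi>: "\<Psi> \<subseteq> lin_maps W ground" and \<Psi>_sep: "\<And>w. w \<in> carr W \<Longrightarrow> (\<And>\<psi>. \<psi> \<in> \<Psi> \<Longrightarrow> \<psi> w = 0) \<Longrightarrow> w = 0"
    and t: "t \<in> carr (tensor V W)" and null: "\<And>\<phi> \<psi>. \<phi> \<in> \<Phi> \<Longrightarrow> \<psi> \<in> \<Psi> \<Longrightarrow> t (\<lambda>v w. \<phi> v * \<psi> w) = 0"
  shows "t = 0"
proof -
  obtain B where B: "B \<subseteq> carr W" "W.independent B" "carr W \<subseteq> W.span B"
    by (rule W.maximal_independent_subset)
  obtain F u where F: "finite F" "F \<subseteq> B" "\<And>e. u e \<in> carr V" "t = (\<Sum>e\<in>F. pure_tensor V W (u e) e)"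
    using tensor_basis_expansion[OF B(1,3) t] by blast
  have u: "u e = 0" if e: "e \<in> F" for e
  proof (rule \<Phi>_sep[OF F(3)])
    fix \<phi> assume \<phi>: "\<phi> \<in> \<Phi>"
    note \<phi>D = V.lin_mapsD[OF subsetD[OF \<Phi> \<phi>]]
    let ?y = "\<Sum>e\<in>F. scal W (\<phi> (u e)) e"
    have carr: "scal W (\<phi> (u e)) e \<in> carr W" if "e \<in> F" for e
      using that F B by auto
    have "?y = 0"
    proof (rule \<Psi>_sep)
      show "?y \<in> carr W" using carr by (rule W.subspace_sum[OF W.subspace_carr])
      fix \<psi> assume \<psi>: "\<psi> \<in> \<Psi>"
      note \<psi>D = W.lin_mapsD[OF subsetD[OF \<Psi> \<psi>]]
      have bil: "(\<lambda>v w. \<phi> v * \<psi> w) \<in> bilin_maps V W ground"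
        by (rule bilin_mapsI) (auto simp: \<phi>D \<psi>D algebra_simps)
      have "\<psi> ?y = (\<Sum>e\<in>F. \<phi> (u e) * \<psi> e)"
        by (subst W.lin_maps_sum[OF subsetD[OF \<Psi> \<psi>] carr])
          (use F(2) B(1) in \<open>auto simp: \<psi>D intro!: sum.cong\<close>)
      also have "\<dots> = (\<Sum>e\<in>F. pure_tensor V W (u e) e (\<lambda>v w. \<phi> v * \<psi> w))"
        by (simp add: pure_tensor_apply[OF bil])
      also have "\<dots> = t (\<lambda>v w. \<phi> v * \<psi> w)"
        unfolding F(4) using F(1) by (induction F) auto
      finally show "\<psi> ?y = 0" using null[OF \<phi> \<psi>] by simp
    qed
    then show "\<phi> (u e) = 0"
      using W.independentD[OF B(2) F(1,2) _ e, of "\<lambda>e. \<phi> (u e)"] by simp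
  qed
  have "pure_tensor V W (u e) e = 0" if "e \<in> F" for e
    using u[OF that] that F(2) B(1) by (auto simp: pure_tensor_simps(6))
  then show ?thesis unfolding F(4) by simp
qed

end

section \<open>The internal hom and separately continuous bilinear forms as dual pairs\<close>

lemma chu_hom_simps:
  "chu_left (chu_hom P Q) = \<lparr>scal = (\<lambda>c (f, g). (\<lambda>v. scal (chu_left Q) c (f v), \<lambda>w. scal (chu_right P) c (g w))),
     carr = chu_morphisms P Q\<rparr>"
  "chu_right (chu_hom P Q) = tensor (chu_left P) (chu_right Q)"
  "pairing (chu_hom P Q) p = tensor_lift (chu_left P) (chu_right Q) ground (\<lambda>v w. pairing Q (fst p v) w)"
  by (auto simp: chu_hom_def split: prod.split)

lemma chu_morphismsD:
  assumes "p \<in> chu_morphisms P Q"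
  shows "fst p \<in> lin_maps (chu_left P) (chu_left Q)" "snd p \<in> lin_maps (chu_right Q) (chu_right P)"
    "v \<in> carr (chu_left P) \<Longrightarrow> w \<in> carr (chu_right Q) \<Longrightarrow> pairing Q (fst p v) w = pairing P v (snd p w)"
  using assms by (auto simp: chu_morphisms_def)

locale chu_pair =
  fixes P :: "('k::real_or_complex, 'v1::ab_group_add, 'w1::ab_group_add) chu"
    and Q :: "('k, 'v2::ab_group_add, 'w2::ab_group_add) chu"
  assumes P: "is_chu P" and Q: "is_chu Q"
begin

sublocale A: kvs "chu_left P" by (rule is_chuD(1)[OF P])
sublocale B: kvs "chu_right P" by (rule is_chuD(2)[OF P])
sublocale C: kvs "chu_left Q" by (rule is_chuD(1)[OF Q])
sublocale D: kvs "chu_right Q" by (rule is_chuD(2)[OF Q])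
sublocale AD: kvs_pair "chu_left P" "chu_right Q" ..

abbreviation form_of where
  "form_of p \<equiv> bilin_restrict (chu_left P) (chu_right Q) (\<lambda>v w. pairing Q (fst p v) w)"

lemma morphism_simps:
  assumes "p \<in> chu_morphisms P Q"
  shows "v \<in> carr (chu_left P) \<Longrightarrow> fst p v \<in> carr (chu_left Q)"
    "v \<in> carr (chu_left P) \<Longrightarrow> v' \<in> carr (chu_left P) \<Longrightarrow> fst p (v + v') = fst p v + fst p v'"
    "v \<in> carr (chu_left P) \<Longrightarrow> fst p (scal (chu_left P) c v) = scal (chu_left Q) c (fst p v)"
    "v \<notin> carr (chu_left P) \<Longrightarrow> fst p v = 0"
    "w \<in> carr (chu_right Q) \<Longrightarrow> snd p w \<in> carr (chu_right P)"
    "w \<in> carr (chu_right Q) \<Longrightarrow> w' \<in> carr (chu_right Q) \<Longrightarrow> snd p (w + w') = snd p w + snd p w'"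
    "w \<in> carr (chu_right Q) \<Longrightarrow> snd p (scal (chu_right Q) c w) = scal (chu_right P) c (snd p w)"
    "w \<notin> carr (chu_right Q) \<Longrightarrow> snd p w = 0"
  using chu_morphismsD(1,2)[OF assms] by (auto simp: lin_maps_def linear_betw_def)

lemma bilinear_form_of:
  assumes "p \<in> chu_morphisms P Q"
  shows "bilinear_betw (chu_left P) (chu_right Q) ground (\<lambda>v w. pairing Q (fst p v) w)"
  using morphism_simps[OF assms] is_chuD(5-)[OF Q]
  by (auto simp: bilinear_betw_def linear_betw_def ground_def)

lemma pairing_chu_hom:
  assumes "p \<in> chu_morphisms P Q" "t \<in> carr (tensor (chu_left P) (chu_right Q))"
  shows "pairing (chu_hom P Q) p t = t (form_of p)"
  unfolding chu_hom_simps by (rule AD.tensor_lift_apply[OF bilinear_form_of[OF assms(1)] assms(2)])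

lemma pairing_chu_hom_pure:
  assumes "p \<in> chu_morphisms P Q" "v \<in> carr (chu_left P)" "w \<in> carr (chu_right Q)"
  shows "pairing (chu_hom P Q) p (pure_tensor (chu_left P) (chu_right Q) v w) = pairing Q (fst p v) w"
  using assms AD.pure_tensor_apply[OF AD.bilin_maps_restrict[OF bilinear_form_of[OF assms(1)]]]
  by (simp add: pairing_chu_hom AD.pure_tensor_simps bilin_restrict_def)

lemma is_kspace_chu_hom: "is_kspace (chu_left (chu_hom P Q))"
proof -
  let ?s = "\<lambda>c (f, g). (\<lambda>v. scal (chu_left Q) c (f v), \<lambda>w. scal (chu_right P) c (g w))"
  interpret M: vector_space ?s
    by unfold_locales (auto simp: fun_eq_iff B.scale_right_distrib B.scale_left_distrib
        C.scale_right_distrib C.scale_left_distrib)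
  have "M.subspace (chu_morphisms P Q)"
  proof (rule M.subspaceI)
    show "0 \<in> chu_morphisms P Q"
      using is_chuD(6)[OF P, of _ 0 0] is_chuD(8)[OF Q, of 0 _ 0]
      by (auto simp: chu_morphisms_def lin_maps_def linear_betw_def zero_prod_def)
    fix p q assume p: "p \<in> chu_morphisms P Q" and q: "q \<in> chu_morphisms P Q"
    show "p + q \<in> chu_morphisms P Q"
      using morphism_simps[OF p] morphism_simps[OF q] chu_morphismsD(3)[OF p] chu_morphismsD(3)[OF q]
        is_chuD(5-)[OF P] is_chuD(5-)[OF Q]
      by (auto simp: chu_morphisms_def lin_maps_def linear_betw_def plus_prod_def
          B.scale_right_distrib C.scale_right_distrib)
  next
    fix c p assume p: "p \<in> chu_morphisms P Q"
    show "?s c p \<in> chu_morphisms P Q"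
      using morphism_simps[OF p] chu_morphismsD(3)[OF p] is_chuD(5-)[OF P] is_chuD(5-)[OF Q]
      by (auto simp: chu_morphisms_def lin_maps_def linear_betw_def split_beta
          B.scale_right_distrib C.scale_right_distrib mult.commute)
  qed
  then show ?thesis
    using M.vector_space_axioms by (simp add: is_kspace_def chu_hom_simps)
qed

text \<open>The maps \<open>v \<mapsto> \<langle>v, b\<rangle> c\<close> and
  \<open>w \<mapsto> \<langle>c, w\<rangle> b\<close> are adjoint. They supply the product forms
  that separate tensors.\<close>

lemma rank_one_morphism:
  assumes b: "b \<in> carr (chu_right P)" and c: "c \<in> carr (chu_left Q)"
  obtains p where "p \<in> chu_morphisms P Q" "form_of p = (\<lambda>v w. right_to_dual P b v * left_to_dual Q c w)"
proof
  let ?p = "(\<lambda>v. if v \<in> carr (chu_left P) then scal (chu_left Q) (pairing P v b) c else 0,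
    \<lambda>w. if w \<in> carr (chu_right Q) then scal (chu_right P) (pairing Q c w) b else 0)"
  show "?p \<in> chu_morphisms P Q"
    using b c is_chuD(5-)[OF P] is_chuD(5-)[OF Q]
    by (auto simp: chu_morphisms_def lin_maps_def linear_betw_def B.scale_left_distrib C.scale_left_distrib)
  show "form_of ?p = (\<lambda>v w. right_to_dual P b v * left_to_dual Q c w)"
    using b c is_chuD(5-)[OF P] is_chuD(5-)[OF Q]
    by (auto simp: fun_eq_iff bilin_restrict_def right_to_dual_def left_to_dual_def)
qed

text \<open>Elementary tensors recover the first component of a morphism through the nondegeneracy
  of \<open>Q\<close>, and then the second by adjointness and the nondegeneracy of \<open>P\<close>.
  Tensors are separated by rank one morphisms.\<close>

lemma is_chu_hom: "is_chu (chu_hom P Q)"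
proof -
  let ?M = "chu_morphisms P Q" and ?T = "tensor (chu_left P) (chu_right Q)"
  have bil: "form_of p \<in> bilin_maps (chu_left P) (chu_right Q) ground" if "p \<in> ?M" for p
    by (rule AD.bilin_maps_restrict[OF bilinear_form_of[OF that]])
  interpret M: kvs "chu_left (chu_hom P Q)"
    by unfold_locales (rule is_kspace_chu_hom)
  have closed: "p + q \<in> ?M" "scal (chu_left (chu_hom P Q)) c p \<in> ?M" if "p \<in> ?M" "q \<in> ?M" for p q c
    using M.carr_closed(2)[of p q] M.carr_closed(3)[of p c] that by (simp_all add: chu_hom_simps(1))
  have form_add: "form_of (p + q) = form_of p + form_of q" if "p \<in> ?M" "q \<in> ?M" for p q
    using morphism_simps[OF that(1)] morphism_simps[OF that(2)] is_chuD(5-)[OF Q]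
    by (auto simp: fun_eq_iff bilin_restrict_def)
  have form_scale: "form_of (scal (chu_left (chu_hom P Q)) c p) = (\<lambda>v w. c * form_of p v w)" if "p \<in> ?M" for c p
    using morphism_simps[OF that] is_chuD(5-)[OF Q]
    by (auto simp: fun_eq_iff bilin_restrict_def chu_hom_simps(1) split_beta)
  have "bilinear_betw (chu_left (chu_hom P Q)) ?T ground (pairing (chu_hom P Q))"
    unfolding bilinear_betw_def linear_betw_def
  proof (intro conjI ballI allI)
    fix p s t c assume p: "p \<in> carr (chu_left (chu_hom P Q))" and s: "s \<in> carr ?T" and t: "t \<in> carr ?T"
    then have p: "p \<in> ?M" by (simp add: chu_hom_simps(1))
    show "pairing (chu_hom P Q) p (s + t) = pairing (chu_hom P Q) p s + pairing (chu_hom P Q) p t"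
      using p s t by (simp add: pairing_chu_hom)
    show "pairing (chu_hom P Q) p (scal ?T c s) = scal ground c (pairing (chu_hom P Q) p s)"
      using p s by (simp add: pairing_chu_hom scal_tensor AD.tensor_closed functional_scal_apply ground_def)
  next
    fix p q s c assume p: "p \<in> carr (chu_left (chu_hom P Q))" and q: "q \<in> carr (chu_left (chu_hom P Q))"
      and s: "s \<in> carr ?T"
    from p q have p: "p \<in> ?M" and q: "q \<in> ?M" by (simp_all add: chu_hom_simps(1))
    show "pairing (chu_hom P Q) (p + q) s = pairing (chu_hom P Q) p s + pairing (chu_hom P Q) q s"
      using AD.tensor_apply_linear(1)[OF s bil[OF p] bil[OF q]] p q s closed[OF p q]
      by (simp only: pairing_chu_hom form_add)
    show "pairing (chu_hom P Q) (scal (chu_left (chu_hom P Q)) c p) s =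
        scal ground c (pairing (chu_hom P Q) p s)"
      using AD.tensor_apply_linear(2)[OF s bil[OF p] bil[OF p]] p s closed(2)[OF p p]
      by (simp only: pairing_chu_hom form_scale) (simp add: ground_def)
  qed (auto simp: ground_def)
  moreover have "inj_on (left_to_dual (chu_hom P Q)) (carr (chu_left (chu_hom P Q)))"
  proof (rule inj_onI)
    fix p q assume pq: "p \<in> carr (chu_left (chu_hom P Q))" "q \<in> carr (chu_left (chu_hom P Q))"
      and eq: "left_to_dual (chu_hom P Q) p = left_to_dual (chu_hom P Q) q"
    then have p: "p \<in> ?M" and q: "q \<in> ?M" by (simp_all add: chu_hom_simps(1))
    have *: "pairing Q (fst p v) w = pairing Q (fst q v) w"
      if "v \<in> carr (chu_left P)" "w \<in> carr (chu_right Q)" for v w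
      using fun_cong[OF eq, of "pure_tensor (chu_left P) (chu_right Q) v w"] that
      by (simp add: left_to_dual_def chu_hom_simps(2) AD.pure_tensor_simps
          pairing_chu_hom_pure[OF p] pairing_chu_hom_pure[OF q])
    have "fst p v = fst q v" for v
      using is_chu_left_eqI[OF Q, of "fst p v" "fst q v"] * morphism_simps(1,4)[OF p] morphism_simps(1,4)[OF q]
      by (cases "v \<in> carr (chu_left P)") auto
    moreover have "snd p w = snd q w" for w
      using is_chu_right_eqI[OF P, of "snd p w" "snd q w"] * morphism_simps(5,8)[OF p] morphism_simps(5,8)[OF q]
        chu_morphismsD(3)[OF p] chu_morphismsD(3)[OF q]
      by (cases "w \<in> carr (chu_right Q)") auto
    ultimately show "p = q" by (auto simp: prod_eq_iff)
  qed
  moreover have "inj_on (right_to_dual (chu_hom P Q)) (carr ?T)"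
  proof (rule inj_onI)
    fix s t assume s: "s \<in> carr ?T" and t: "t \<in> carr ?T"
      and eq: "right_to_dual (chu_hom P Q) s = right_to_dual (chu_hom P Q) t"
    have "s - t = 0"
    proof (rule AD.tensor_separation[where \<Phi> = "right_to_dual P ` carr (chu_right P)"
          and \<Psi> = "left_to_dual Q ` carr (chu_left Q)"])
      show "right_to_dual P ` carr (chu_right P) \<subseteq> lin_maps (chu_left P) ground"
        using right_to_dual_lin_maps[OF P] by blast
      have dual: "right_to_dual (chu_dual Q) = left_to_dual Q"
        by (auto simp: fun_eq_iff right_to_dual_def left_to_dual_def chu_dual_def)
      show "left_to_dual Q ` carr (chu_left Q) \<subseteq> lin_maps (chu_right Q) ground"
        using right_to_dual_lin_maps[OF is_chu_dual[OF Q]] unfolding dual by (auto simp: chu_dual_def)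
      show "v = 0" if v: "v \<in> carr (chu_left P)"
        "\<And>\<phi>. \<phi> \<in> right_to_dual P ` carr (chu_right P) \<Longrightarrow> \<phi> v = 0" for v
      proof (rule is_chu_left_eqI[OF P v(1)])
        fix w assume "w \<in> carr (chu_right P)"
        then show "pairing P v w = pairing P 0 w"
          using v(2)[of "right_to_dual P w"] v(1) is_chuD(8)[OF P, of 0 w 0] by (auto simp: right_to_dual_def)
      qed simp
      show "w = 0" if w: "w \<in> carr (chu_right Q)"
        "\<And>\<psi>. \<psi> \<in> left_to_dual Q ` carr (chu_left Q) \<Longrightarrow> \<psi> w = 0" for w
      proof (rule is_chu_right_eqI[OF Q w(1)])
        fix v assume "v \<in> carr (chu_left Q)"
        then show "pairing Q v w = pairing Q v 0"
          using w(2)[of "left_to_dual Q v"] w(1) is_chuD(6)[OF Q, of v 0 0] by (auto simp: left_to_dual_def)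
      qed simp
      show "s - t \<in> carr ?T" using s t by simp
      fix \<phi> \<psi> assume "\<phi> \<in> right_to_dual P ` carr (chu_right P)" "\<psi> \<in> left_to_dual Q ` carr (chu_left Q)"
      then obtain p where p: "p \<in> ?M" "form_of p = (\<lambda>v w. \<phi> v * \<psi> w)"
        using rank_one_morphism by blast
      have "pairing (chu_hom P Q) p s = pairing (chu_hom P Q) p t"
        using fun_cong[OF eq, of p] p(1) by (simp add: right_to_dual_def chu_hom_simps(1))
      then show "(s - t) (\<lambda>v w. \<phi> v * \<psi> w) = 0"
        using p s t by (simp add: pairing_chu_hom)
    qed
    then show "s = t" by simp
  qed
  ultimately show ?thesis
    using is_kspace_chu_hom is_kspace_tensor[of "chu_left P" "chu_right Q"]
    by (simp add: is_chu_def chu_hom_simps(2))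
qed

end

section \<open>The dual pair of tensors and separately continuous bilinear forms\<close>

definition sep_cont_chu ::
  "('k::real_or_complex, 'v::ab_group_add) tvs \<Rightarrow> ('k, 'w::ab_group_add) tvs \<Rightarrow>
   ('k, ('v \<Rightarrow> 'w \<Rightarrow> 'k) \<Rightarrow> 'k, 'v \<Rightarrow> 'w \<Rightarrow> 'k) chu" where
  "sep_cont_chu V W = \<lparr>chu_left = alg_tensor V W,
     chu_right = \<lparr>scal = (\<lambda>c b v w. c * b v w), carr = sep_cont_bilin_forms V W\<rparr>,
     pairing = (\<lambda>t b. t b)\<rparr>"

lemma sep_cont_chu_simps:
  "chu_left (sep_cont_chu V W) = alg_tensor V W"
  "carr (chu_right (sep_cont_chu V W)) = sep_cont_bilin_forms V W"
  "pairing (sep_cont_chu V W) t b = t b"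
  by (simp_all add: sep_cont_chu_def)

locale tvs_pair =
  fixes V :: "('k::real_or_complex, 'v::ab_group_add) tvs" and W :: "('k, 'w::ab_group_add) tvs"
  assumes V: "is_tvs V" and W: "is_tvs W"
begin

sublocale kvs_pair "underlying V" "underlying W"
  by (simp add: kvs_pair_def is_tvsD(1) V W)

lemma sep_cont_subset: "sep_cont_bilin_forms V W \<subseteq> bilin_maps (underlying V) (underlying W) ground"
  by (auto simp: sep_cont_bilin_forms_def)

text \<open>Phrased through topological duals so that closure properties of
  \<open>cont_forms\<close> carry over to separately continuous forms.\<close>

lemma sep_cont_iff:
  "b \<in> sep_cont_bilin_forms V W \<longleftrightarrow> b \<in> bilin_maps (underlying V) (underlying W) ground \<and>
    (\<forall>v\<in>carr (underlying V). b v \<in> cont_forms (underlying W) (topo W)) \<and>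
    (\<forall>w\<in>carr (underlying W). (\<lambda>v. b v w) \<in> cont_forms (underlying V) (topo V))"
proof -
  have "b v \<in> lin_maps (underlying W) ground"
    if "b \<in> bilin_maps (underlying V) (underlying W) ground" "v \<in> carr (underlying V)" for v
    using that bilin_mapsD[OF that(1)] by (auto intro!: W.lin_mapsI)
  moreover have "(\<lambda>v. b v w) \<in> lin_maps (underlying V) ground"
    if "b \<in> bilin_maps (underlying V) (underlying W) ground" "w \<in> carr (underlying W)" for w
    using that bilin_mapsD[OF that(1)] by (auto intro!: V.lin_mapsI)
  ultimately show ?thesis
    unfolding sep_cont_bilin_forms_def cont_forms_def by blast
qed

lemma sep_cont_product:
  assumes \<phi>: "\<phi> \<in> cont_forms (underlying V) (topo V)" and \<psi>: "\<psi> \<in> cont_forms (underlying W) (topo W)"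
  shows "(\<lambda>v w. \<phi> v * \<psi> w) \<in> sep_cont_bilin_forms V W"
proof -
  have lin: "\<phi> \<in> lin_maps (underlying V) ground" "\<psi> \<in> lin_maps (underlying W) ground"
    using assms by (auto simp: cont_forms_def)
  have "(\<lambda>v w. \<phi> v * \<psi> w) \<in> bilin_maps (underlying V) (underlying W) ground"
    by (rule bilin_mapsI) (auto simp: V.lin_mapsD[OF lin(1)] W.lin_mapsD[OF lin(2)] algebra_simps)
  moreover have "(\<lambda>w. \<phi> v * \<psi> w) \<in> cont_forms (underlying W) (topo W)" for v
    using W.cont_forms_closed(3)[OF is_tvsD(2)[OF W] \<psi>, of "\<phi> v"] by (simp add: functional_scal_def)
  moreover have "(\<lambda>v. \<phi> v * \<psi> w) \<in> cont_forms (underlying V) (topo V)" for w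
    using V.cont_forms_closed(3)[OF is_tvsD(2)[OF V] \<phi>, of "\<psi> w"]
    by (simp add: functional_scal_def mult.commute)
  ultimately show ?thesis by (simp add: sep_cont_iff)
qed

text \<open>Products of continuous forms are separately continuous and separate tensors, because
  continuous forms separate points on both sides. A form is recovered from its values on elementary
  tensors.\<close>

lemma is_chu_sep_cont: "is_chu (sep_cont_chu V W)"
proof -
  let ?T = "alg_tensor V W" and ?S = "sep_cont_bilin_forms V W"
  let ?R = "chu_right (sep_cont_chu V W)"
  note S = subsetD[OF sep_cont_subset]
  interpret S: vector_space "(\<lambda>c b v w. c * b v w) :: 'k \<Rightarrow> ('v \<Rightarrow> 'w \<Rightarrow> 'k) \<Rightarrow> _"
    by unfold_locales (auto simp: fun_eq_iff algebra_simps)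
  note Vc = V.cont_forms_closed[OF is_tvsD(2)[OF V]] and Wc = W.cont_forms_closed[OF is_tvsD(2)[OF W]]
  have "S.subspace ?S"
  proof (rule S.subspaceI)
    show "0 \<in> ?S" using Vc(1) Wc(1) bilin_maps_closed(1) by (simp add: sep_cont_iff zero_fun_def)
    show "b + b' \<in> ?S" if "b \<in> ?S" "b' \<in> ?S" for b b'
      using that Vc(2) Wc(2) bilin_maps_closed(2) by (simp add: sep_cont_iff plus_fun_def)
    show "(\<lambda>v w. c * b v w) \<in> ?S" if "b \<in> ?S" for c b
      using that Vc(3) Wc(3) bilin_maps_closed(3) by (simp add: sep_cont_iff functional_scal_def)
  qed
  then have "is_kspace ?R"
    using S.vector_space_axioms by (simp add: is_kspace_def sep_cont_chu_def)
  moreover have "bilinear_betw ?T ?R ground (\<lambda>t b. t b)"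
    using tensor_apply_linear[OF _ S S]
    by (auto simp: bilinear_betw_def linear_betw_def sep_cont_chu_def ground_def scal_tensor functional_scal_apply)
  moreover have "inj_on (left_to_dual (sep_cont_chu V W)) (carr ?T)"
  proof (rule inj_onI)
    fix s t assume s: "s \<in> carr ?T" and t: "t \<in> carr ?T"
      and eq: "left_to_dual (sep_cont_chu V W) s = left_to_dual (sep_cont_chu V W) t"
    have "s - t = 0"
    proof (rule tensor_separation[where \<Phi> = "cont_forms (underlying V) (topo V)"
          and \<Psi> = "cont_forms (underlying W) (topo W)"])
      show "v = 0" if "v \<in> carr (underlying V)" "\<And>\<phi>. \<phi> \<in> cont_forms (underlying V) (topo V) \<Longrightarrow> \<phi> v = 0" for v
        using V.cont_forms_separate[OF is_tvsD(2)[OF V]] that by metis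
      show "w = 0" if "w \<in> carr (underlying W)" "\<And>\<psi>. \<psi> \<in> cont_forms (underlying W) (topo W) \<Longrightarrow> \<psi> w = 0" for w
        using W.cont_forms_separate[OF is_tvsD(2)[OF W]] that by metis
      show "s - t \<in> carr ?T" using s t by simp
      fix \<phi> \<psi> assume "\<phi> \<in> cont_forms (underlying V) (topo V)" "\<psi> \<in> cont_forms (underlying W) (topo W)"
      then have "(\<lambda>v w. \<phi> v * \<psi> w) \<in> ?S" by (rule sep_cont_product)
      then show "(s - t) (\<lambda>v w. \<phi> v * \<psi> w) = 0"
        using fun_cong[OF eq, of "\<lambda>v w. \<phi> v * \<psi> w"] by (simp add: left_to_dual_def sep_cont_chu_simps)
    qed (auto simp: cont_forms_def)
    then show "s = t" by simp
  qed
  moreover have "inj_on (right_to_dual (sep_cont_chu V W)) ?S"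
  proof (rule inj_onI)
    fix b b' assume b: "b \<in> ?S" and b': "b' \<in> ?S"
      and eq: "right_to_dual (sep_cont_chu V W) b = right_to_dual (sep_cont_chu V W) b'"
    have "b v w = b' v w" for v w
    proof (cases "v \<in> carr (underlying V) \<and> w \<in> carr (underlying W)")
      case True
      then show ?thesis
        using fun_cong[OF eq, of "pure_tensor (underlying V) (underlying W) v w"]
        by (simp add: right_to_dual_def sep_cont_chu_simps pure_tensor_simps pure_tensor_apply S[OF b] S[OF b'])
    qed (use bilin_mapsD(5)[OF S[OF b]] bilin_mapsD(5)[OF S[OF b']] in auto)
    then show "b = b'" by blast
  qed
  ultimately show ?thesis
    using is_kspace_tensor by (simp add: is_chu_def sep_cont_chu_simps sep_cont_chu_simps(3)[abs_def])
qed

text \<open>The lift of \<open>b\<close> is evaluation at \<open>b\<close>, which is also the form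
  that \<open>b\<close> represents in the pair; so both conditions ask for the same
  bijection.\<close>

lemma classifies_sep_cont_iff: "classifies_sep_cont V W = dual_topology (sep_cont_chu V W)"
proof
  fix T
  have "right_to_dual (sep_cont_chu V W) b = tensor_lift (underlying V) (underlying W) ground b"
    if "b \<in> sep_cont_bilin_forms V W" for b
    unfolding right_to_dual_def sep_cont_chu_simps
    by (rule tensor_lift_eq[OF subsetD[OF sep_cont_subset that], symmetric])
  then show "classifies_sep_cont V W T = dual_topology (sep_cont_chu V W) T"
    using is_chu_sep_cont
      bij_betw_cong[of "sep_cont_bilin_forms V W" "right_to_dual (sep_cont_chu V W)"
        "tensor_lift (underlying V) (underlying W) ground"]
    by (simp add: classifies_sep_cont_def dual_topology_def sep_cont_chu_simps)
qed

end

section \<open>The canonical isomorphism\<close>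

text \<open>\<open>TW\<close> and \<open>TH\<close> are arbitrary dual topologies, so that the weak and the Mackey case
  are treated at once.\<close>

locale tensor_iso = tvs_pair V W
  for V :: "('k::real_or_complex, 'v::ab_group_add) tvs" and W :: "('k, 'w::ab_group_add) tvs" +
  fixes TW DW TH H
  assumes TW: "dual_topology (chu_dual (to_chu W)) TW"
  defines "DW \<equiv> \<lparr>underlying = chu_left (chu_dual (to_chu W)), topo = TW\<rparr>"
  assumes TH: "dual_topology (chu_hom (to_chu V) (to_chu DW)) TH"
  defines "H \<equiv> \<lparr>underlying = chu_left (chu_hom (to_chu V) (to_chu DW)), topo = TH\<rparr>"
begin

lemma to_chu_simps:
  "chu_left (to_chu X) = underlying X" "chu_right (to_chu X) = top_dual X" "pairing (to_chu X) x f = f x"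
  "chu_left (chu_dual P) = chu_right P" "chu_right (chu_dual P) = chu_left P"
  "pairing (chu_dual P) w v = pairing P v w"
  "carr (top_dual X) = cont_forms (underlying X) (topo X)" "scal (top_dual X) = functional_scal"
  by (simp_all add: to_chu_def chu_dual_def top_dual_def)

lemma DW_simps: "underlying DW = top_dual W" "topo DW = TW"
  by (simp_all add: DW_def to_chu_simps)

lemma H_simps: "carr (underlying H) = chu_morphisms (to_chu V) (to_chu DW)" "topo H = TH"
  by (simp_all add: H_def chu_hom_simps)

lemma is_tvs_DW: "is_tvs DW"
  using TW is_kspace_top_dual[OF W]
  by (simp add: is_tvs_def DW_simps dual_topology_def to_chu_simps)

sublocale hom: chu_pair "to_chu V" "to_chu DW"
  by (simp add: chu_pair_def is_chu_to_chu V is_tvs_DW)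

lemma is_tvs_H: "is_tvs H"
  using TH hom.is_kspace_chu_hom by (simp add: is_tvs_def H_def dual_topology_def)

definition ev :: "'w \<Rightarrow> ('w \<Rightarrow> 'k) \<Rightarrow> 'k" where
  "ev w = (\<lambda>f. if f \<in> carr (top_dual W) then f w else 0)"

text \<open>\<open>TW\<close> is a dual topology for the swapped pair, so every continuous form on
  \<open>DW\<close> is evaluation at a point: the dual of \<open>DW\<close> is \<open>W\<close>
  again.\<close>

lemma top_dual_DW: "carr (top_dual DW) = ev ` carr (underlying W)"
proof -
  have "right_to_dual (chu_dual (to_chu W)) w = ev w" for w
    by (auto simp: right_to_dual_def ev_def to_chu_simps fun_eq_iff)
  then show ?thesis
    using TW by (simp add: dual_topology_iff[OF is_chu_dual[OF is_chu_to_chu[OF W]]] to_chu_simps DW_simps)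
qed

lemma ev_mem: "w \<in> carr (underlying W) \<Longrightarrow> ev w \<in> carr (top_dual DW)"
  by (simp add: top_dual_DW)

lemma ev_fst:
  assumes p: "p \<in> carr (underlying H)" and v: "v \<in> carr (underlying V)"
  shows "ev w (fst p v) = fst p v w"
  using hom.morphism_simps(1)[of p v] p v by (simp add: ev_def H_simps to_chu_simps DW_simps)

text \<open>Write \<open>p = (f, g)\<close>. Continuity in \<open>w\<close> holds because
  \<open>f\<close> takes values in the dual of \<open>W\<close>. Continuity in \<open>v\<close>
  comes from the adjoint: \<open>v \<mapsto> f v w\<close> is \<open>g (ev w)\<close>, an element of
  the dual of \<open>V\<close>.\<close>

lemma fst_sep_cont:
  assumes p: "p \<in> carr (underlying H)" shows "fst p \<in> sep_cont_bilin_forms V W"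
proof -
  have pm: "p \<in> chu_morphisms (to_chu V) (to_chu DW)" using p by (simp add: H_simps)
  note m = hom.morphism_simps[OF pm, unfolded to_chu_simps DW_simps]
  have lin: "fst p v \<in> lin_maps (underlying W) ground" if "v \<in> carr (underlying V)" for v
    using m(1)[OF that] by (simp add: cont_forms_def)
  have "fst p v w = 0" if "v \<notin> carr (underlying V) \<or> w \<notin> carr (underlying W)" for v w
    using that m(4)[of v] W.lin_mapsD(3)[OF lin, of v w] by (cases "v \<in> carr (underlying V)") auto
  then have bil: "fst p \<in> bilin_maps (underlying V) (underlying W) ground"
    using m(2-3) W.lin_mapsD[OF lin]
    by (intro bilin_mapsI) (auto simp: functional_scal_apply)
  have "(\<lambda>v. fst p v w) = snd p (ev w)" if w: "w \<in> carr (underlying W)" for w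
  proof
    fix v
    have "snd p (ev w) \<in> lin_maps (underlying V) ground"
      using hom.morphism_simps(5)[OF pm, of "ev w"] ev_mem[OF w]
      by (simp add: to_chu_simps cont_forms_def)
    then show "fst p v w = snd p (ev w) v"
      using chu_morphismsD(3)[OF pm, of v "ev w"] ev_mem[OF w] ev_fst[OF p, of v w] V.lin_mapsD(3) m(4)[of v]
      by (cases "v \<in> carr (underlying V)") (auto simp: to_chu_simps)
  qed
  then have "(\<lambda>v. fst p v w) \<in> cont_forms (underlying V) (topo V)" if "w \<in> carr (underlying W)" for w
    using that hom.morphism_simps(5)[OF pm, of "ev w"] ev_mem by (simp add: to_chu_simps)
  then show ?thesis
    using bil m(1) by (simp add: sep_cont_iff)
qed

lemma sep_cont_morphism:
  assumes b: "b \<in> sep_cont_bilin_forms V W"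
  obtains p where "p \<in> carr (underlying H)" "fst p = b"
proof
  \<comment> \<open>The adjoint must be composition with \<open>b\<close>. It lands in the dual of
    \<open>V\<close> because each \<open>\<psi>\<close> is some \<open>ev w\<close>, which makes the
    result \<open>v \<mapsto> b v w\<close>.\<close>
  let ?g = "\<lambda>\<psi>. if \<psi> \<in> carr (top_dual DW) then (\<lambda>v. \<psi> (b v)) else 0"
  interpret DW: kvs "top_dual W"
    by unfold_locales (rule is_kspace_top_dual[OF W])
  interpret DDW: kvs "top_dual DW"
    by unfold_locales (rule is_kspace_top_dual[OF is_tvs_DW])
  note bD = b[unfolded sep_cont_iff]
  have bil: "b \<in> bilin_maps (underlying V) (underlying W) ground" using bD by blast
  \<comment> \<open>Also needed off the carrier, where \<open>b v\<close> is 0, so that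
    \<open>ev\<close> can be unfolded at every \<open>v\<close>.\<close>
  have bv: "b v \<in> carr (top_dual W)" for v
  proof (cases "v \<in> carr (underlying V)")
    case False
    then have "b v = 0" using bilin_mapsD(5)[OF bil] by auto
    then show ?thesis by (simp only: DW.carr_closed)
  qed (use bD in \<open>simp add: to_chu_simps\<close>)
  have ext: "b (v + v') = b v + b v'" "b (scal (underlying V) c v) = functional_scal c (b v)"
    if "v \<in> carr (underlying V)" "v' \<in> carr (underlying V)" for v v' c
  proof -
    show "b (v + v') = b v + b v'"
      using bilin_mapsD(1,5)[OF bil] that by (auto simp: fun_eq_iff) (metis add.left_neutral)
    show "b (scal (underlying V) c v) = functional_scal c (b v)"
      using bilin_mapsD(3,5)[OF bil] that by (auto simp: fun_eq_iff functional_scal_apply) (metis mult_zero_right)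
  qed
  have "b \<in> lin_maps (underlying V) (top_dual W)"
    using bv ext bilin_mapsD(5)[OF bil] by (auto simp: lin_maps_def linear_betw_def to_chu_simps)
  moreover have "?g \<in> lin_maps (top_dual DW) (top_dual V)"
  proof -
    have "(\<lambda>v. \<psi> (b v)) \<in> carr (top_dual V)" if \<psi>: "\<psi> \<in> carr (top_dual DW)" for \<psi>
    proof -
      obtain w where w: "w \<in> carr (underlying W)" "\<psi> = ev w" using \<psi> by (auto simp: top_dual_DW)
      then have "(\<lambda>v. \<psi> (b v)) = (\<lambda>v. b v w)" using bv by (simp add: ev_def)
      then show ?thesis using bD w(1) by (simp add: to_chu_simps)
    qed
    moreover have "functional_scal c \<psi> \<in> carr (top_dual DW)" if "\<psi> \<in> carr (top_dual DW)" for c \<psi>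
      using DDW.carr_closed(3)[OF that, of c] by (simp only: to_chu_simps(8))
    ultimately show ?thesis
      by (auto simp: lin_maps_def linear_betw_def fun_eq_iff to_chu_simps(8) functional_scal_apply)
  qed
  ultimately show "(b, ?g) \<in> carr (underlying H)"
    unfolding H_simps by (auto simp: chu_morphisms_def to_chu_simps DW_simps)
qed simp

abbreviation "\<kappa> \<equiv> tensor_lift (underlying V) (underlying W) (top_dual H) (hom_eval H)"

text \<open>Exhibits \<open>hom_eval\<close> as a functional represented by a tensor over
  \<open>V\<close> and the dual of \<open>DW\<close>, whence its continuity for
  \<open>TH\<close>.\<close>

lemma hom_eval_eq:
  assumes v: "v \<in> carr (underlying V)" and w: "w \<in> carr (underlying W)"
  shows "hom_eval H v w = right_to_dual (chu_hom (to_chu V) (to_chu DW))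
    (pure_tensor (underlying V) (top_dual DW) v (ev w))"
proof
  fix p show "hom_eval H v w p = right_to_dual (chu_hom (to_chu V) (to_chu DW))
    (pure_tensor (underlying V) (top_dual DW) v (ev w)) p"
    using hom.pairing_chu_hom_pure[of p v "ev w"] v w ev_mem[OF w] ev_fst[of p v w]
    by (simp add: hom_eval_def right_to_dual_def H_simps chu_hom_simps(1) to_chu_simps)
qed

lemma top_dual_H:
  "carr (top_dual H) = right_to_dual (chu_hom (to_chu V) (to_chu DW)) ` carr (tensor (underlying V) (top_dual DW))"
  using TH unfolding dual_topology_iff[OF hom.is_chu_hom]
  by (simp add: to_chu_simps H_def chu_hom_simps(2))

lemma is_kspace_top_dual_H: "is_kspace (top_dual H)"
  by (rule is_kspace_top_dual[OF is_tvs_H])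

lemma bilinear_hom_eval: "bilinear_betw (underlying V) (underlying W) (top_dual H) (hom_eval H)"
proof -
  interpret DT: kvs_pair "underlying V" "top_dual DW"
    by unfold_locales (rule is_kspace_top_dual[OF is_tvs_DW])
  have "hom_eval H v w \<in> carr (top_dual H)" if "v \<in> carr (underlying V)" "w \<in> carr (underlying W)" for v w
    unfolding hom_eval_eq[OF that] top_dual_H
    by (intro imageI DT.pure_tensor_simps that ev_mem)
  then show ?thesis
    using bilin_mapsD[OF subsetD[OF sep_cont_subset fst_sep_cont]]
    by (auto simp: bilinear_betw_def linear_betw_def hom_eval_def fun_eq_iff functional_scal_apply to_chu_simps(8))
qed

lemma kappa:
  shows "\<kappa> \<in> lin_maps (alg_tensor V W) (top_dual H)"
    and "v \<in> carr (underlying V) \<Longrightarrow> w \<in> carr (underlying W) \<Longrightarrow>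
      \<kappa> (pure_tensor (underlying V) (underlying W) v w) = hom_eval H v w"
  by (rule tensor_lift[OF V.is_kspace W.is_kspace is_kspace_top_dual_H bilinear_hom_eval]; assumption)+

lemma kappa_linear:
  "s \<in> carr (alg_tensor V W) \<Longrightarrow> t \<in> carr (alg_tensor V W) \<Longrightarrow> \<kappa> (s + t) = \<kappa> s + \<kappa> t"
  "t \<in> carr (alg_tensor V W) \<Longrightarrow> \<kappa> (functional_scal c t) = functional_scal c (\<kappa> t)"
  "t \<in> carr (alg_tensor V W) \<Longrightarrow> \<kappa> t \<in> carr (top_dual H)"
  "\<kappa> 0 = 0"
proof -
  show *: "s \<in> carr (alg_tensor V W) \<Longrightarrow> t \<in> carr (alg_tensor V W) \<Longrightarrow> \<kappa> (s + t) = \<kappa> s + \<kappa> t"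
    "t \<in> carr (alg_tensor V W) \<Longrightarrow> \<kappa> (functional_scal c t) = functional_scal c (\<kappa> t)"
    "t \<in> carr (alg_tensor V W) \<Longrightarrow> \<kappa> t \<in> carr (top_dual H)" for s t c
    using kappa(1) by (auto simp: lin_maps_def linear_betw_def scal_tensor to_chu_simps(8))
  show "\<kappa> 0 = 0" using *(1)[of 0 0] by simp
qed

text \<open>Both sides are linear in \<open>t\<close> and agree on elementary tensors. Injectivity
  of \<open>\<kappa>\<close> and the matching of forms are read off from this formula.\<close>

lemma kappa_apply:
  assumes t: "t \<in> carr (alg_tensor V W)" and p: "p \<in> carr (underlying H)"
  shows "\<kappa> t p = t (fst p)"
  using t
proof (induction rule: tensor_induct)
  case (pure v w)
  show ?case
    unfolding kappa(2)[OF pure] pure_tensor_apply[OF subsetD[OF sep_cont_subset fst_sep_cont[OF p]]]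
    using p by (simp add: hom_eval_def)
next
  case zero
  show ?case unfolding kappa_linear(4) by simp
next
  case (plus s t)
  then show ?case unfolding kappa_linear(1)[OF plus(1,2)] by simp
next
  case (scale c t)
  then show ?case unfolding kappa_linear(2)[OF scale(1)] by (simp add: functional_scal_apply)
qed

text \<open>Injective: the forms \<open>fst p\<close> exhaust the separately continuous ones, and
  these separate tensors. Surjective: the dual of \<open>H\<close> is represented by tensors over
  \<open>V\<close> and the dual of \<open>DW\<close>, whose elementary tensors
  \<open>v \<otimes> ev w\<close> are the images of \<open>v \<otimes> w\<close>.\<close>

lemma kappa_bij: "bij_betw \<kappa> (carr (alg_tensor V W)) (carr (top_dual H))"
proof (rule bij_betw_imageI)
  show "inj_on \<kappa> (carr (alg_tensor V W))"
  proof (rule inj_onI)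
    fix s t assume s: "s \<in> carr (alg_tensor V W)" and t: "t \<in> carr (alg_tensor V W)" and eq: "\<kappa> s = \<kappa> t"
    show "s = t"
    proof (rule is_chu_left_eqI[OF is_chu_sep_cont])
      fix b assume "b \<in> carr (chu_right (sep_cont_chu V W))"
      then obtain p where p: "p \<in> carr (underlying H)" "fst p = b"
        using sep_cont_morphism by (auto simp: sep_cont_chu_simps)
      show "pairing (sep_cont_chu V W) s b = pairing (sep_cont_chu V W) t b"
        using kappa_apply[OF s p(1)] kappa_apply[OF t p(1)] by (simp add: eq sep_cont_chu_simps p(2))
    qed (use s t in \<open>simp_all add: sep_cont_chu_simps\<close>)
  qed
  interpret DT: kvs_pair "underlying V" "top_dual DW"
    by unfold_locales (rule is_kspace_top_dual[OF is_tvs_DW])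
  let ?C = "chu_hom (to_chu V) (to_chu DW)"
  note bil = is_chuD(5-)[OF hom.is_chu_hom, unfolded chu_hom_simps(2) to_chu_simps(1,2) DW_simps scal_tensor]
  have rd_add: "right_to_dual ?C (s + t) = right_to_dual ?C s + right_to_dual ?C t"
    if "s \<in> carr (tensor (underlying V) (top_dual DW))" "t \<in> carr (tensor (underlying V) (top_dual DW))" for s t
  proof
    fix p show "right_to_dual ?C (s + t) p = (right_to_dual ?C s + right_to_dual ?C t) p"
      unfolding right_to_dual_def using bil(1)[OF _ that, of p]
      by (cases "p \<in> carr (chu_left ?C)") (simp_all only: if_True if_False plus_fun_apply add_0_left)
  qed
  have rd_scale: "right_to_dual ?C (functional_scal c s) = functional_scal c (right_to_dual ?C s)"
    if "s \<in> carr (tensor (underlying V) (top_dual DW))" for c s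
  proof
    fix p show "right_to_dual ?C (functional_scal c s) p = functional_scal c (right_to_dual ?C s) p"
      unfolding right_to_dual_def functional_scal_apply[of c "\<lambda>v. if v \<in> _ then _ v else _"]
      using bil(2)[OF _ that, of p c]
      by (cases "p \<in> carr (chu_left ?C)") (simp_all only: if_True if_False mult_zero_right)
  qed
  have "right_to_dual ?C s \<in> \<kappa> ` carr (alg_tensor V W)" if "s \<in> carr (tensor (underlying V) (top_dual DW))" for s
    using that
  proof (induction rule: DT.tensor_induct)
    case zero
    have "right_to_dual ?C 0 = 0"
      using rd_add[OF DT.T.carr_closed(1) DT.T.carr_closed(1)]
      unfolding add_0_left by (simp only: add_cancel_right_right)
    also have "\<dots> = \<kappa> 0" by (simp only: kappa_linear)
    finally show ?case by (rule image_eqI[of _ \<kappa> 0]) (rule T.carr_closed(1))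
  next
    case (plus s t)
    then obtain x y where "x \<in> carr (alg_tensor V W)" "y \<in> carr (alg_tensor V W)"
      "right_to_dual ?C s = \<kappa> x" "right_to_dual ?C t = \<kappa> y" by blast
    with plus(1,2) show ?case
      by (intro image_eqI[of _ _ "x + y"]) (simp_all only: rd_add kappa_linear T.carr_closed)
  next
    case (scale c s)
    then obtain x where "x \<in> carr (alg_tensor V W)" "right_to_dual ?C s = \<kappa> x" by blast
    with scale(1) show ?case
      by (intro image_eqI[of _ _ "functional_scal c x"]) (simp_all only: rd_scale kappa_linear tensor_closed)
  next
    case (pure v \<psi>)
    then obtain w where w: "w \<in> carr (underlying W)" "\<psi> = ev w" by (auto simp: top_dual_DW)
    then show ?case
      using hom_eval_eq[OF pure(1) w(1)] kappa(2)[OF pure(1) w(1)] pure_tensor_simps(1)[OF pure(1) w(1)]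
      by (intro image_eqI[of _ _ "pure_tensor (underlying V) (underlying W) v w"]) simp_all
  qed
  then show "\<kappa> ` carr (alg_tensor V W) = carr (top_dual H)"
    using kappa_linear(3) top_dual_H by auto
qed

text \<open>Evaluation at \<open>p\<close> pulls back along \<open>\<kappa>\<close> to evaluation of
  tensors at \<open>fst p\<close>, and \<open>fst\<close> maps onto the separately continuous
  forms.\<close>

lemma chu_iso_kappa: "chu_iso (sep_cont_chu V W) (chu_dual (to_chu H)) \<kappa>"
proof -
  have "right_to_dual (sep_cont_chu V W) ` sep_cont_bilin_forms V W =
    precompose (carr (alg_tensor V W)) \<kappa> ` right_to_dual (chu_dual (to_chu H)) ` carr (underlying H)"
  proof -
    have "precompose (carr (alg_tensor V W)) \<kappa> (right_to_dual (chu_dual (to_chu H)) p) =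
        right_to_dual (sep_cont_chu V W) (fst p)" if "p \<in> carr (underlying H)" for p
    proof
      fix t show "precompose (carr (alg_tensor V W)) \<kappa> (right_to_dual (chu_dual (to_chu H)) p) t =
        right_to_dual (sep_cont_chu V W) (fst p) t"
      proof (cases "t \<in> carr (alg_tensor V W)")
        case True
        have "right_to_dual (chu_dual (to_chu H)) p (\<kappa> t) = \<kappa> t p"
          using kappa_linear(3)[OF True] by (simp add: right_to_dual_def to_chu_simps)
        then show ?thesis
          using True kappa_apply[OF True that]
          by (simp add: precompose_def right_to_dual_def[of "sep_cont_chu V W"] sep_cont_chu_simps)
      qed (simp add: precompose_def right_to_dual_def[of "sep_cont_chu V W"] sep_cont_chu_simps)
    qed
    moreover have "sep_cont_bilin_forms V W = fst ` carr (underlying H)"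
      using fst_sep_cont sep_cont_morphism by blast
    ultimately show ?thesis by (simp add: image_image)
  qed
  then show ?thesis
    using kappa(1) kappa_bij is_chu_sep_cont is_chu_dual[OF is_chu_to_chu[OF is_tvs_H]]
      is_kspace_top_dual_H T.kvs_axioms
    by (simp add: chu_iso_def chu_iso_axioms_def kspace_iso_def kspace_iso_axioms_def kvs_def
        sep_cont_chu_simps to_chu_simps(1,2,4,5))
qed

end

theorem lemma4p3p8:
  fixes V :: "('k::real_or_complex, 'v::ab_group_add) tvs"
    and W :: "('k, 'w::ab_group_add) tvs"
  shows
    "(weakly_topologized V \<and> weakly_topologized W \<longrightarrow>
        canonical_w V W \<in> lin_maps (alg_tensor V W) (underlying (tensor_w V W)) \<and>
        bij_betw (canonical_w V W) (carr (alg_tensor V W)) (carr (underlying (tensor_w V W))) \<and>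
        weakest_such (classifies_sep_cont V W) (tensor_w_topology V W)) \<and>
     (mackey_space V \<and> mackey_space W \<longrightarrow>
        canonical_m V W \<in> lin_maps (alg_tensor V W) (underlying (tensor_m V W)) \<and>
        bij_betw (canonical_m V W) (carr (alg_tensor V W)) (carr (underlying (tensor_m V W))) \<and>
        strongest_such (classifies_sep_cont V W) (tensor_m_topology V W))"
proof (intro conjI impI; elim conjE)
  have left: "chu_left (chu_dual (to_chu X)) = top_dual X" for X :: "('k, 'x::ab_group_add) tvs"
    by (simp add: chu_dual_def to_chu_def)
  {
    assume "weakly_topologized V" "weakly_topologized W"
    then have V: "is_tvs V" and W: "is_tvs W" by (simp_all add: weakly_topologized_def)
    interpret tvs_pair V W by unfold_locales (fact V W)+
    \<comment> \<open>On the dual of \<open>W\<close> and on the internal hom, sigma serves as one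
      dual topology that fixes the continuous forms; its minimality is used for the outermost dual.
      The Mackey case runs in parallel with tau.\<close>
    have TW: "dual_topology (chu_dual (to_chu W)) (sigma_topology (chu_dual (to_chu W)))"
      using weakest_sigma_topology[OF is_chu_dual[OF is_chu_to_chu[OF W]]] by (simp add: weakest_such_def)
    have "is_tvs (dual_w W)"
      using TW is_kspace_top_dual[OF W]
      by (simp add: is_tvs_def dual_w_def weak_tvs_def dual_topology_def left)
    then have "is_chu (chu_hom (to_chu V) (to_chu (dual_w W)))"
      by (intro chu_pair.is_chu_hom chu_pair.intro is_chu_to_chu V)
    then have TH: "dual_topology (chu_hom (to_chu V) (to_chu (dual_w W)))
        (sigma_topology (chu_hom (to_chu V) (to_chu (dual_w W))))"
      using weakest_sigma_topology by (auto simp: weakest_such_def)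
    interpret tensor_iso V W "sigma_topology (chu_dual (to_chu W))" "dual_w W"
      "sigma_topology (chu_hom (to_chu V) (to_chu (dual_w W)))" "hom_w V (dual_w W)"
      by unfold_locales (use TW TH in \<open>simp_all add: dual_w_def hom_w_def weak_tvs_def\<close>)
    interpret chu_iso "sep_cont_chu V W" "chu_dual (to_chu (hom_w V (dual_w W)))" \<kappa>
      by (rule chu_iso_kappa)
    have under: "underlying (tensor_w V W) = top_dual (hom_w V (dual_w W))"
      "topo (tensor_w V W) = sigma_topology (chu_dual (to_chu (hom_w V (dual_w W))))"
      by (simp_all add: tensor_w_def dual_w_def[of "hom_w V (dual_w W)"] weak_tvs_def left)
    have can: "canonical_w V W = \<kappa>"
      by (simp add: canonical_w_def under)
    show "canonical_w V W \<in> lin_maps (alg_tensor V W) (underlying (tensor_w V W))"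
      unfolding can under by (rule kappa(1))
    show "bij_betw (canonical_w V W) (carr (alg_tensor V W)) (carr (underlying (tensor_w V W)))"
      unfolding can under by (rule kappa_bij)
    show "weakest_such (classifies_sep_cont V W) (tensor_w_topology V W)"
      using weakest_pullback[OF weakest_sigma_topology[OF is_chu_dual[OF is_chu_to_chu[OF is_tvs_H]]]]
      unfolding classifies_sep_cont_iff tensor_w_topology_def can under sep_cont_chu_simps .
  }
  {
    assume "mackey_space V" "mackey_space W"
    then have V: "is_tvs V" and W: "is_tvs W" by (simp_all add: mackey_space_def)
    interpret tvs_pair V W by unfold_locales (fact V W)+
    have TW: "dual_topology (chu_dual (to_chu W)) (tau_topology (chu_dual (to_chu W)))"
      using strongest_tau_topology[OF is_chu_dual[OF is_chu_to_chu[OF W]]] by (simp add: strongest_such_def)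
    have "is_tvs (dual_m W)"
      using TW is_kspace_top_dual[OF W]
      by (simp add: is_tvs_def dual_m_def mackey_tvs_def dual_topology_def left)
    then have "is_chu (chu_hom (to_chu V) (to_chu (dual_m W)))"
      by (intro chu_pair.is_chu_hom chu_pair.intro is_chu_to_chu V)
    then have TH: "dual_topology (chu_hom (to_chu V) (to_chu (dual_m W)))
        (tau_topology (chu_hom (to_chu V) (to_chu (dual_m W))))"
      using strongest_tau_topology by (auto simp: strongest_such_def)
    interpret tensor_iso V W "tau_topology (chu_dual (to_chu W))" "dual_m W"
      "tau_topology (chu_hom (to_chu V) (to_chu (dual_m W)))" "hom_m V (dual_m W)"
      by unfold_locales (use TW TH in \<open>simp_all add: dual_m_def hom_m_def mackey_tvs_def\<close>)
    interpret chu_iso "sep_cont_chu V W" "chu_dual (to_chu (hom_m V (dual_m W)))" \<kappa>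
      by (rule chu_iso_kappa)
    have under: "underlying (tensor_m V W) = top_dual (hom_m V (dual_m W))"
      "topo (tensor_m V W) = tau_topology (chu_dual (to_chu (hom_m V (dual_m W))))"
      by (simp_all add: tensor_m_def dual_m_def[of "hom_m V (dual_m W)"] mackey_tvs_def left)
    have can: "canonical_m V W = \<kappa>"
      by (simp add: canonical_m_def under)
    show "canonical_m V W \<in> lin_maps (alg_tensor V W) (underlying (tensor_m V W))"
      unfolding can under by (rule kappa(1))
    show "bij_betw (canonical_m V W) (carr (alg_tensor V W)) (carr (underlying (tensor_m V W)))"
      unfolding can under by (rule kappa_bij)
    show "strongest_such (classifies_sep_cont V W) (tensor_m_topology V W)"
      using strongest_pullback[OF strongest_tau_topology[OF is_chu_dual[OF is_chu_to_chu[OF is_tvs_H]]]]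
      unfolding classifies_sep_cont_iff tensor_m_topology_def can under sep_cont_chu_simps .
  }
qed

end
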